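(* Let $X$ be a super-Brownian motion in $d=3$ with initial condition $X_0=\mu\in M_F(\mathbb{R}^3)$ and local time $L_t^x$, and let $$D=\Big\{x_0\in\mathbb{R}^3:\ \int\frac{1}{|y-x_0|}\,\mu(dy)=\infty\Big\}.$$ Then for any point $x_0\in D$, with $P_\mu$-probability one we have that for any $t>0$, $x\mapsto L_t^x$ is discontinuous at $x_0$. Moreover, for $t>0$, $$\lim_{x\in D^c,\ x\to x_0}L_t^x=\infty\quad\text{in probability.}$$
   Context: $M_F(\mathbb{R}^d)$ is the space of finite measures on $\mathbb{R}^d$ with the weak topology; $X_t(\phi)=\int\phi(y)X_t(dy)$. A super-Brownian motion $X$ with $X_0=\mu\in M_F(\mathbb{R}^d)$ (law $P_\mu$) is the continuous $M_F(\mathbb{R}^d)$-valued strong Markov process whose law is uniquely determined by: for all $\phi\in C_b^2(\mathbb{R}^d)$, $X_t(\phi)=X_0(\phi)+M_t(\phi)+\int_0^t X_s(\frac{\Delta}{2}\phi)\,ds$, where $M_t(\phi)$ is a continuous martingale with $M_0(\phi)=0$ and $[M(\phi)]_t=\int_0^t X_s(\phi^2)\,ds$. Local time: for $d\le3$, $L_t^x$ is the (jointly lower semicontinuous, increasing in $t$) random function with $\int_0^tX_s(\phi)\,ds=\int\phi(x)L_t^x\,dx$ for all $\phi\in C_b(\mathbb{R}^d)$; it can also be defined as $L_t^x=\lim_{\varepsilon\to0}\int_0^tX_s(p_\varepsilon(\cdot-x))\,ds$, with $p_\varepsilon$ the Brownian transition density. One uses the version jointly continuous on the set of continuity points of $(t,x)\mapsto\int\mu(dy)\int_0^tp_s(y-x)\,ds$.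 Convergence to $\infty$ in probability means that $P_\mu(L_t^x>K)\to1$ for every $K<\infty$. *)

theory Defs
  imports "HOL-Probability.Probability"
begin

section \<open>The space of finite measures\<close>

definition finite_measures :: "'a::euclidean_space measure set" where
  "finite_measures = {m. finite_measure m \<and> sets m = sets borel}"

definition weak_topology :: "'a::euclidean_space measure topology" where
  "weak_topology = topology_generated_by
     {{m \<in> finite_measures. integral\<^sup>L m \<phi> \<in> U} | (\<phi> :: 'a \<Rightarrow> real) U. \<phi> \<in> bcontfun \<and> open U}"

definition finite_measure_algebra :: "'a::euclidean_space measure measure" where
  "finite_measure_algebra = sigma finite_measures {U. openin weak_topology U}"


section \<open>Martingales in continuous time\<close>

text \<open>Processes and filtrations are indexed by \<^typ>\<open>real\<close>, but only the times \<open>t \<ge> 0\<close> matter.\<close>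

definition martingale :: "'w measure \<Rightarrow> (real \<Rightarrow> 'w measure) \<Rightarrow> (real \<Rightarrow> 'w \<Rightarrow> real) \<Rightarrow> bool" where
  "martingale P F Z \<longleftrightarrow>
     (\<forall>t\<ge>0. Z t \<in> borel_measurable (F t) \<and> integrable P (Z t)) \<and>
     (\<forall>s\<ge>0. \<forall>t\<ge>s. AE \<omega> in P. real_cond_exp P (F s) (Z t) \<omega> = Z s \<omega>)"

definition continuous_paths :: "'w measure \<Rightarrow> (real \<Rightarrow> 'w \<Rightarrow> real) \<Rightarrow> bool" where
  "continuous_paths P Z \<longleftrightarrow> (\<forall>\<omega>\<in>space P. continuous_on {0..} (\<lambda>t. Z t \<omega>))"

text \<open>Real-valued (hence finite) localizing times lose no generality: replace \<open>T n\<close> by \<open>min (T n) n\<close>.\<close>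

definition local_martingale :: "'w measure \<Rightarrow> (real \<Rightarrow> 'w measure) \<Rightarrow> (real \<Rightarrow> 'w \<Rightarrow> real) \<Rightarrow> bool" where
  "local_martingale P F Z \<longleftrightarrow>
     (\<exists>T :: nat \<Rightarrow> 'w \<Rightarrow> real.
        (\<forall>n. stopping_time F (T n) \<and> (\<forall>\<omega>\<in>space P. 0 \<le> T n \<omega>)) \<and>
        (AE \<omega> in P. incseq (\<lambda>n. T n \<omega>) \<and> filterlim (\<lambda>n. T n \<omega>) at_top sequentially) \<and>
        (\<forall>n. martingale P F (\<lambda>t \<omega>. Z (min t (T n \<omega>)) \<omega>)))"

text \<open>\<open>A\<close> is (a version of) the bracket \<open>[Z]\<close> of a continuous martingale \<open>Z\<close> with \<open>Z\<^sub>0 = 0\<close>: the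
  increasing continuous adapted process, null at \<open>0\<close>, that compensates \<open>Z\<^sup>2\<close>; it is unique up to
  indistinguishability.\<close>

definition quadratic_variation ::
    "'w measure \<Rightarrow> (real \<Rightarrow> 'w measure) \<Rightarrow> (real \<Rightarrow> 'w \<Rightarrow> real) \<Rightarrow> (real \<Rightarrow> 'w \<Rightarrow> real) \<Rightarrow> bool" where
  "quadratic_variation P F Z A \<longleftrightarrow>
     continuous_paths P A \<and>
     (\<forall>\<omega>\<in>space P. A 0 \<omega> = 0 \<and> mono_on {0..} (\<lambda>t. A t \<omega>)) \<and>
     (\<forall>t\<ge>0. A t \<in> borel_measurable (F t)) \<and>
     local_martingale P F (\<lambda>t \<omega>. (Z t \<omega>)\<^sup>2 - A t \<omega>)"

definition strong_markov ::
    "'w measure \<Rightarrow> (real \<Rightarrow> 'w measure) \<Rightarrow> 's measure \<Rightarrow> (real \<Rightarrow> 'w \<Rightarrow> 's) \<Rightarrow> bool" where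
  "strong_markov P F S X \<longleftrightarrow>
     (\<exists>Q. (\<forall>t\<ge>0. Q t \<in> measurable S (prob_algebra S)) \<and>
       (\<forall>T t. stopping_time F T \<and> (\<forall>\<omega>\<in>space P. 0 \<le> T \<omega>) \<and> 0 \<le> t \<longrightarrow>
         (\<forall>A\<in>sets S. AE \<omega> in P.
            real_cond_exp P (filtration.pre_sigma (space P) F T)
              (\<lambda>\<omega>'. indicator A (X (T \<omega>' + t) \<omega>')) \<omega> = measure (Q t (X (T \<omega>) \<omega>)) A)))"


section \<open>Super-Brownian motion\<close>

definition Cb2 :: "('a::euclidean_space \<Rightarrow> real) set" where
  "Cb2 = {\<phi>. bounded (range \<phi>) \<and>
     (\<exists>(g :: 'a \<Rightarrow> 'a) (H :: 'a \<Rightarrow> 'a \<Rightarrow>\<^sub>L 'a).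
        (\<forall>x. (\<phi> has_derivative (\<lambda>h. g x \<bullet> h)) (at x)) \<and> bounded (range g) \<and>
        (\<forall>x. (g has_derivative blinfun_apply (H x)) (at x)) \<and> bounded (range H) \<and>
        continuous_on UNIV H)}"

definition laplacian :: "('a::euclidean_space \<Rightarrow> real) \<Rightarrow> 'a \<Rightarrow> real" where
  "laplacian \<phi> x = (\<Sum>b\<in>Basis. (deriv ^^ 2) (\<lambda>s. \<phi> (x + s *\<^sub>R b)) 0)"

definition super_brownian_motion ::
    "'w measure \<Rightarrow> (real \<Rightarrow> 'w measure) \<Rightarrow> (real \<Rightarrow> 'w \<Rightarrow> 'a::euclidean_space measure) \<Rightarrow>
     'a measure \<Rightarrow> bool" where
  "super_brownian_motion P F X \<mu> \<longleftrightarrow>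
     prob_space P \<and> filtration (space P) F \<and> (\<forall>t. subalgebra P (F t)) \<and>
     \<mu> \<in> finite_measures \<and>
     (\<forall>t\<ge>0. X t \<in> measurable (F t) finite_measure_algebra) \<and>
     (\<forall>\<omega>\<in>space P. continuous_map (top_of_set {0..}) weak_topology (\<lambda>t. X t \<omega>)) \<and>
     (AE \<omega> in P. X 0 \<omega> = \<mu>) \<and>
     strong_markov P F finite_measure_algebra X \<and>
     (\<forall>\<phi>\<in>Cb2. \<exists>Z.
        martingale P F Z \<and> continuous_paths P Z \<and> (\<forall>\<omega>\<in>space P. Z 0 \<omega> = 0) \<and>
        (\<forall>\<omega>\<in>space P. \<forall>t\<ge>0. integral\<^sup>L (X t \<omega>) \<phi> = integral\<^sup>L (X 0 \<omega>) \<phi> + Z t \<omega> +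
            (LBINT s:{0..t}. integral\<^sup>L (X s \<omega>) (\<lambda>y. laplacian \<phi> y / 2))) \<and>
        quadratic_variation P F Z (\<lambda>t \<omega>. LBINT s:{0..t}. integral\<^sup>L (X s \<omega>) (\<lambda>y. (\<phi> y)\<^sup>2)))"


section \<open>Local time\<close>

definition heat_kernel :: "real \<Rightarrow> 'a::euclidean_space \<Rightarrow> real" where
  "heat_kernel s z = exp (- (norm z)\<^sup>2 / (2 * s)) / (2 * pi * s) powr (real DIM('a) / 2)"

definition potential :: "'a::euclidean_space measure \<Rightarrow> real \<times> 'a \<Rightarrow> ennreal" where
  "potential \<mu> = (\<lambda>(t, x).
     \<integral>\<^sup>+y. (\<integral>\<^sup>+s. ennreal (heat_kernel s (y - x)) * indicator {0..t} s \<partial>lborel) \<partial>\<mu>)"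

text \<open>Functions with values in \<open>[0, \<infinity>]\<close> are continuous at a point if they are so as numerical
  functions: a point with value \<open>\<infinity>\<close> never counts as a point of continuity, even if the function
  tends to \<open>\<infinity>\<close> there. (For a finite value, convergence in \<^typ>\<open>ennreal\<close> is convergence in
  the reals, and forces the function to be finite near the point.)\<close>

definition finite_cont_within :: "'b::t2_space set \<Rightarrow> ('b \<Rightarrow> ennreal) \<Rightarrow> 'b \<Rightarrow> bool" where
  "finite_cont_within S f p \<longleftrightarrow> f p < \<infinity> \<and> continuous (at p within S) f"

definition tendsto_in_prob ::
    "'w measure \<Rightarrow> ('i \<Rightarrow> 'w \<Rightarrow> real) \<Rightarrow> ('w \<Rightarrow> real) \<Rightarrow> 'i filter \<Rightarrow> bool" where
  "tendsto_in_prob P Z Y G \<longleftrightarrow>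
     (\<forall>\<delta>>0. ((\<lambda>i. measure P {\<omega>\<in>space P. \<bar>Z i \<omega> - Y \<omega>\<bar> > \<delta>}) \<longlongrightarrow> 0) G)"

text \<open>The local time may be infinite at exceptional points, where moreover the approximations by
  the heat kernel need not have a finite limit; hence the values in \<^typ>\<open>ennreal\<close>, and the
  condition in the last clause, which determines \<open>L t x\<close> almost surely wherever these approximations
  converge to a finite random variable. On the other points \<open>L\<close> is any version subject to
  the remaining clauses.\<close>

definition sbm_local_time ::
    "'w measure \<Rightarrow> (real \<Rightarrow> 'w \<Rightarrow> 'a::euclidean_space measure) \<Rightarrow> 'a measure \<Rightarrow>
     (real \<Rightarrow> 'a \<Rightarrow> 'w \<Rightarrow> ennreal) \<Rightarrow> bool" where
  "sbm_local_time P X \<mu> L \<longleftrightarrow>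
     (\<forall>t\<ge>0. \<forall>x. L t x \<in> borel_measurable P) \<and>
     (AE \<omega> in P. \<forall>p\<in>{0..} \<times> UNIV.
        L (fst p) (snd p) \<omega> \<le> Liminf (at p within {0..} \<times> UNIV) (\<lambda>q. L (fst q) (snd q) \<omega>)) \<and>
     (AE \<omega> in P. \<forall>x. mono_on {0..} (\<lambda>t. L t x \<omega>)) \<and>
     (AE \<omega> in P. \<forall>t\<ge>0. (AE x in lborel. L t x \<omega> < \<infinity>) \<and>
        (\<forall>\<phi>\<in>bcontfun. has_bochner_integral lborel (\<lambda>x. \<phi> x * enn2real (L t x \<omega>))
                     (LBINT s:{0..t}. integral\<^sup>L (X s \<omega>) \<phi>))) \<and>
     (let C = {p \<in> {0..} \<times> UNIV. finite_cont_within ({0..} \<times> UNIV) (potential \<mu>) p}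
      in AE \<omega> in P. \<forall>p\<in>C. finite_cont_within C (\<lambda>(t, x). L t x \<omega>) p) \<and>
     (\<forall>t\<ge>0. \<forall>x. \<forall>Y\<in>borel_measurable P.
        tendsto_in_prob P (\<lambda>\<epsilon> \<omega>. LBINT s:{0..t}. integral\<^sup>L (X s \<omega>) (\<lambda>y. heat_kernel \<epsilon> (y - x))) Y
          (at_right 0) \<longrightarrow>
        (AE \<omega> in P. L t x \<omega> = ennreal (Y \<omega>)))"

text \<open>The quotient is taken in \<^typ>\<open>ennreal\<close>, where \<open>1 / 0 = \<infinity>\<close>; so atoms of \<open>\<mu>\<close> belong to
  the set.\<close>

definition singular_points :: "'a::euclidean_space measure \<Rightarrow> 'a set" where
  "singular_points \<mu> = {x\<^sub>0. (\<integral>\<^sup>+y. 1 / ennreal (norm (y - x\<^sub>0)) \<partial>\<mu>) = \<infinity>}"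

end

theory Submission
  imports Defs
begin

text \<open>
  Let \<open>G\<^sub>\<epsilon>\<close> be the Newtonian potential of the heat kernel \<open>p\<^sub>\<epsilon>\<close>, so \<open>\<Delta>/2 G\<^sub>\<epsilon> = - p\<^sub>\<epsilon>\<close>. The martingale problem for
  \<open>G\<^sub>\<epsilon>(\<cdot> - x)\<close> is Tanaka's formula: \<open>\<integral>\<^sub>0\<^sup>t X\<^sub>s(p\<^sub>\<epsilon>) ds = \<mu>(G\<^sub>\<epsilon>) + Z\<^sub>t - X\<^sub>t(G\<^sub>\<epsilon>)\<close>.
  With \<open>r = |y - x|\<close>, the test function \<open>r powr (-1/2)\<close> (regularized) is superharmonic with Laplacian of order
  \<open>- r powr (-5/2)\<close>, which dominates \<open>G\<^sup>2 \<approx> r powr (-2)\<close> near the singularity; hence the variance of \<open>Z\<^sub>t\<close>, and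
  (by monotonicity of \<open>E X\<^sub>s(G\<^sub>\<epsilon>)\<close> in \<open>s\<close>) also the mean of \<open>X\<^sub>t(G\<^sub>\<epsilon>)\<close>, are bounded by a constant plus a multiple of
  \<open>\<integral> r powr (-1/2) d\<mu>\<close>. By Cauchy--Schwarz this is of smaller order than \<open>\<mu>(G\<^sub>\<epsilon>) \<approx> \<integral> 1/r d\<mu>\<close>, which tends to
  infinity as \<open>x\<close> approaches a singular point, so the local time does so in probability. The same estimates
  applied to differences \<open>G\<^sub>\<delta> - G\<^sub>\<epsilon>\<close> show that the approximations of the local time at a regular point are
  Cauchy in \<open>L\<^sup>1\<close>, which identifies \<open>L t x\<close>. As the singular points form a null set, Borel--Cantelli along a
  sequence of regular points gives the discontinuity, simultaneously for all \<open>t\<close> by monotonicity in \<open>t\<close>.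
\<close>

section \<open>Radial test functions\<close>

text \<open>All moment information on \<open>X\<close> is drawn from the martingale problem: an
  expectation is bounded by inserting a nonnegative superharmonic test function and dropping a
  nonnegative term. Controlling the variance of \<open>Z\<close> thus asks for a test function whose
  Laplacian dominates the squared kernel, of order r powr (-2). The exact candidate, -log r, is
  unbounded below at infinity. In dimension three r powr (-p) with 0 < p < 1 has Laplacian -p (1 -
  p) r powr (-p - 2): it is positive and slightly more singular than necessary, and for large r the
  missing domination costs only a constant, paid for by the total mass. The choice p = 1/2 makes
  Cauchy-Schwarz compare it directly with 1/r. Test functions must lie in \<open>Cb2\<close>, so
  every kernel is smoothed at a scale 1/b, and all bounds involve b and x only through integrals of
  smoothed kernels against \<mu>. Near a singular point the scale may therefore be chosen after the
  regular point x, as small as the approximation of the local time at x demands.\<close>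

lemma laplacian_eq_sum_second_derivative:
  fixes \<phi> :: "'a::euclidean_space \<Rightarrow> real" and H :: "'a \<Rightarrow> 'a \<Rightarrow>\<^sub>L 'a"
  assumes g: "\<And>x. (\<phi> has_derivative (\<lambda>h. g x \<bullet> h)) (at x)"
    and H: "\<And>x. (g has_derivative blinfun_apply (H x)) (at x)"
  shows "laplacian \<phi> x = (\<Sum>b\<in>Basis. blinfun_apply (H x) b \<bullet> b)"
proof -
  have "(deriv ^^ 2) (\<lambda>s. \<phi> (x + s *\<^sub>R b)) 0 = blinfun_apply (H x) b \<bullet> b" for b
  proof -
    \<comment> \<open>\<open>laplacian\<close> iterates one-dimensional derivatives along coordinate
      lines, while \<open>Cb2\<close> supplies a gradient and a Hessian; restricting both to the
      line connects them.\<close>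
    have line: "((\<lambda>s. x + s *\<^sub>R b) has_derivative (\<lambda>h. h *\<^sub>R b)) (at s)" for s :: real
      by (auto intro!: derivative_eq_intros)
    have "((\<lambda>s. \<phi> (x + s *\<^sub>R b)) has_real_derivative g (x + s *\<^sub>R b) \<bullet> b) (at s)" for s
      using has_derivative_compose[OF line g]
      by (simp add: has_field_derivative_def mult_commute_abs)
    then have first: "deriv (\<lambda>s. \<phi> (x + s *\<^sub>R b)) = (\<lambda>s. g (x + s *\<^sub>R b) \<bullet> b)"
      by (auto intro: DERIV_imp_deriv)
    have "((\<lambda>s. g (x + s *\<^sub>R b)) has_derivative (\<lambda>h. blinfun_apply (H x) (h *\<^sub>R b))) (at 0)"
      using has_derivative_compose[OF line[of 0], of g "blinfun_apply (H x)"] H[of x] by simp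
    from has_derivative_inner_left[OF this, of b]
    have "((\<lambda>s. g (x + s *\<^sub>R b) \<bullet> b) has_real_derivative blinfun_apply (H x) b \<bullet> b) (at 0)"
      by (simp add: has_field_derivative_def blinfun.scaleR_right mult_commute_abs)
    then show ?thesis
      by (simp add: first numeral_2_eq_2 DERIV_imp_deriv)
  qed
  then show ?thesis
    by (simp add: laplacian_def)
qed

text \<open>The weak topology controls pairings with bounded continuous functions only. The drift
  term pairs \<open>X\<close> with the Laplacian, so this is where boundedness and continuity of the
  Hessian in \<open>Cb2\<close> enter.\<close>

lemma Cb2_imp_bcontfun:
  fixes \<phi> :: "'a::euclidean_space \<Rightarrow> real"
  assumes "\<phi> \<in> Cb2"
  shows "\<phi> \<in> bcontfun" and "laplacian \<phi> \<in> bcontfun"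
proof -
  obtain g :: "'a \<Rightarrow> 'a" and H :: "'a \<Rightarrow> 'a \<Rightarrow>\<^sub>L 'a"
    where g: "\<And>x. (\<phi> has_derivative (\<lambda>h. g x \<bullet> h)) (at x)"
      and H: "\<And>x. (g has_derivative blinfun_apply (H x)) (at x)"
      and bd: "bounded (range \<phi>)" "bounded (range H)" and cont: "continuous_on UNIV H"
    using assms unfolding Cb2_def by blast
  have "continuous_on UNIV \<phi>"
    by (intro differentiable_imp_continuous_on) (auto simp: differentiable_on_def differentiable_def intro: g)
  then show "\<phi> \<in> bcontfun"
    using bd by (simp add: bcontfun_def)
  obtain B where B: "\<And>x. norm (H x) \<le> B"
    using bd(2) by (auto simp: bounded_iff)
  have lap: "laplacian \<phi> = (\<lambda>x. \<Sum>b\<in>Basis. blinfun_apply (H x) b \<bullet> b)"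
    using laplacian_eq_sum_second_derivative[OF g H] by auto
  show "laplacian \<phi> \<in> bcontfun"
  proof (rule bcontfun_normI)
    show "continuous_on UNIV (laplacian \<phi>)"
      unfolding lap by (intro continuous_intros cont)
    show "norm (laplacian \<phi> x) \<le> (\<Sum>b\<in>(Basis::'a set). B)" for x
      unfolding lap
    proof (rule order_trans[OF norm_sum], rule sum_mono)
      fix b :: 'a assume b: "b \<in> Basis"
      have "\<bar>blinfun_apply (H x) b \<bullet> b\<bar> \<le> norm (blinfun_apply (H x) b) * norm b"
        by (rule Cauchy_Schwarz_ineq2)
      also have "\<dots> \<le> norm (H x)"
        using norm_blinfun[of "H x" b] b by simp
      finally show "norm (blinfun_apply (H x) b \<bullet> b) \<le> B"
        using B[of x] by simp
    qed
  qed
qed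

text \<open>The bounds on the derivatives carry the weights that the chain rule for \<open>(norm y)\<^sup>2\<close> produces.\<close>

lemma
  fixes x :: "'a::euclidean_space" and f f' f'' :: "real \<Rightarrow> real"
  assumes f': "\<And>u. 0 \<le> u \<Longrightarrow> (f has_real_derivative f' u) (at u)"
    and f'': "\<And>u. 0 \<le> u \<Longrightarrow> (f' has_real_derivative f'' u) (at u)"
    and cont: "continuous_on {0..} f''"
    and bd: "\<And>u. 0 \<le> u \<Longrightarrow> \<bar>f u\<bar> \<le> B" "\<And>u. 0 \<le> u \<Longrightarrow> (1 + u) * \<bar>f' u\<bar> \<le> B"
      "\<And>u. 0 \<le> u \<Longrightarrow> u * \<bar>f'' u\<bar> \<le> B"
  shows radial_in_Cb2: "(\<lambda>y. f ((norm (y - x))\<^sup>2)) \<in> Cb2"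
    and laplacian_radial: "laplacian (\<lambda>y. f ((norm (y - x))\<^sup>2)) y =
      2 * DIM('a) * f' ((norm (y - x))\<^sup>2) + 4 * (norm (y - x))\<^sup>2 * f'' ((norm (y - x))\<^sup>2)"
proof -
  define q where "q = (\<lambda>y. (norm (y - x))\<^sup>2)"
  define \<phi> where "\<phi> = (\<lambda>y. f (q y))"
  define g where "g = (\<lambda>y. (2 * f' (q y)) *\<^sub>R (y - x))"
  define H :: "'a \<Rightarrow> 'a \<Rightarrow>\<^sub>L 'a" where "H = (\<lambda>y. (2 * f' (q y)) *\<^sub>R id_blinfun +
    (4 * f'' (q y)) *\<^sub>R (blinfun_scaleR_left (y - x) o\<^sub>L blinfun_inner_left (y - x)))"
  have H_apply: "blinfun_apply (H y) h = (2 * f' (q y)) *\<^sub>R h + (4 * f'' (q y) * (h \<bullet> (y - x))) *\<^sub>R (y - x)" for y h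
    by (simp add: H_def blinfun.add_left blinfun.scaleR_left)
  have q_nonneg: "0 \<le> q y" for y
    by (simp add: q_def)
  have q_inner: "q y = (y - x) \<bullet> (y - x)" for y
    by (simp add: q_def power2_norm_eq_inner)
  have q_deriv: "(q has_derivative (\<lambda>h. 2 * (h \<bullet> (y - x)))) (at y)" for y
    unfolding q_inner[abs_def] by (auto intro!: derivative_eq_intros simp: inner_commute)
  have f'_comp: "((\<lambda>y. f' (q y)) has_derivative (\<lambda>h. f'' (q y) * (2 * (h \<bullet> (y - x))))) (at y)" for y
    using has_derivative_compose[OF q_deriv f''[OF q_nonneg, unfolded has_field_derivative_def]] by simp
  have phi_deriv: "(\<phi> has_derivative (\<lambda>h. g y \<bullet> h)) (at y)" for y
    using has_derivative_compose[OF q_deriv f'[OF q_nonneg, unfolded has_field_derivative_def]]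
    by (simp add: \<phi>_def g_def mult.assoc mult.left_commute inner_commute)
  have g_deriv: "(g has_derivative blinfun_apply (H y)) (at y)" for y
    unfolding g_def
    by (rule has_derivative_eq_rhs, (rule derivative_intros f'_comp)+)
       (auto simp: H_apply fun_eq_iff algebra_simps)
  have q_cont: "continuous_on UNIV q"
    unfolding q_def by (intro continuous_intros)
  have f'_cont: "continuous_on {0..} f'"
    by (rule DERIV_continuous_on[where D = f'']) (auto intro: has_field_derivative_at_within f'')
  have comp_cont: "continuous_on UNIV (\<lambda>y. h (q y))" if "continuous_on {0..} h" for h :: "real \<Rightarrow> real"
    by (rule continuous_on_compose2[OF that q_cont]) (auto simp: q_nonneg)
  have H_cont: "continuous_on UNIV H"
    unfolding H_def
    by (rule continuous_on_blinfun_componentwise)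
       (simp add: blinfun.add_left blinfun.scaleR_left,
        intro continuous_intros comp_cont f'_cont cont)
  \<comment> \<open>From (n - 1)^2 \<ge> 0. The gradient \<open>2 f' (y - x)\<close> grows with the
    norm, whereas the hypothesis on \<open>f'\<close> has a weight in the squared norm.\<close>
  have norm_q: "norm (y - x) \<le> 1 + q y" for y
  proof -
    have "0 \<le> (norm (y - x) - 1)\<^sup>2" "0 \<le> (norm (y - x))\<^sup>2"
      by auto
    then show ?thesis
      unfolding q_def power2_diff one_power2 mult_1_right using norm_ge_zero[of "y - x"] by linarith
  qed
  have B0: "0 \<le> B"
    using bd(1)[of 0] by simp
  have g_bd: "norm (g y) \<le> 2 * B" for y
  proof -
    have "norm (g y) = 2 * (norm (y - x) * \<bar>f' (q y)\<bar>)"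
      by (simp add: g_def abs_mult)
    also have "\<dots> \<le> 2 * ((1 + q y) * \<bar>f' (q y)\<bar>)"
      by (intro mult_left_mono mult_right_mono norm_q) auto
    also have "\<dots> \<le> 2 * B"
      using bd(2)[OF q_nonneg[of y]] by simp
    finally show ?thesis .
  qed
  have H_bd: "norm (H y) \<le> 6 * B" for y
  proof (rule norm_blinfun_bound)
    show "0 \<le> 6 * B" using B0 by simp
    fix h
    have f'_bd: "\<bar>f' (q y)\<bar> \<le> B"
      using order_trans[OF mult_right_mono[of 1 "1 + q y" "\<bar>f' (q y)\<bar>"] bd(2)[OF q_nonneg]] q_nonneg[of y] by simp
    have "norm (blinfun_apply (H y) h) \<le> norm ((2 * f' (q y)) *\<^sub>R h) + norm ((4 * f'' (q y) * (h \<bullet> (y - x))) *\<^sub>R (y - x))"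
      unfolding H_apply by (rule norm_triangle_ineq)
    also have "norm ((2 * f' (q y)) *\<^sub>R h) \<le> 2 * B * norm h"
      using f'_bd by (simp add: abs_mult mult_right_mono)
    also have "norm ((4 * f'' (q y) * (h \<bullet> (y - x))) *\<^sub>R (y - x)) = 4 * \<bar>f'' (q y)\<bar> * (\<bar>h \<bullet> (y - x)\<bar> * norm (y - x))"
      by (simp add: abs_mult)
    also have "\<dots> \<le> 4 * \<bar>f'' (q y)\<bar> * (norm h * norm (y - x) * norm (y - x))"
      by (intro mult_left_mono mult_right_mono Cauchy_Schwarz_ineq2) auto
    also have "\<dots> = 4 * (q y * \<bar>f'' (q y)\<bar>) * norm h"
      by (simp add: q_def power2_eq_square)
    also have "\<dots> \<le> 4 * B * norm h"
      using bd(3)[OF q_nonneg[of y]] by (simp add: mult_right_mono)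
    finally show "norm (blinfun_apply (H y) h) \<le> 6 * B * norm h"
      by (simp add: algebra_simps)
  qed
  show "(\<lambda>y. f ((norm (y - x))\<^sup>2)) \<in> Cb2"
    unfolding Cb2_def mem_Collect_eq
  proof (intro conjI exI allI)
    show "bounded (range (\<lambda>y. f ((norm (y - x))\<^sup>2)))"
      by (rule boundedI[of _ B]) (auto intro: bd(1))
    show "((\<lambda>y. f ((norm (y - x))\<^sup>2)) has_derivative (\<lambda>h. g y \<bullet> h)) (at y)" for y
      using phi_deriv by (simp add: \<phi>_def q_def)
    show "bounded (range g)"
      by (rule boundedI[of _ "2 * B"]) (auto intro: g_bd)
    show "bounded (range H)"
      by (rule boundedI[of _ "6 * B"]) (auto intro: H_bd)
  qed (fact g_deriv H_cont)+
  have "laplacian \<phi> y = (\<Sum>b\<in>Basis. 2 * f' (q y) * (b \<bullet> b) + 4 * f'' (q y) * ((y - x) \<bullet> b * ((y - x) \<bullet> b)))"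
    unfolding laplacian_eq_sum_second_derivative[OF phi_deriv g_deriv] H_apply
    by (intro sum.cong refl) (simp add: inner_add_left inner_add_right inner_commute mult.assoc)
  also have "\<dots> = 2 * DIM('a) * f' (q y) + 4 * q y * f'' (q y)"
    by (simp add: sum.distrib inner_Basis sum_distrib_left[symmetric] q_inner euclidean_inner[of "y - x" "y - x"])
  finally show "laplacian (\<lambda>y. f ((norm (y - x))\<^sup>2)) y =
      2 * DIM('a) * f' ((norm (y - x))\<^sup>2) + 4 * (norm (y - x))\<^sup>2 * f'' ((norm (y - x))\<^sup>2)"
    by (simp add: \<phi>_def q_def)
qed

section \<open>The Newtonian potential of the heat kernel\<close>

text \<open>The variable \<open>u\<close> stands for a squared distance. Each derivative in
  \<open>u\<close> brings down \<open>- v^2 / 2\<close>, so the family is closed under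
  differentiation; the Green kernel and its first two radial derivatives are the cases k = 0, 2,
  4.\<close>

definition gauss_moment :: "nat \<Rightarrow> real \<Rightarrow> real \<Rightarrow> real \<Rightarrow> real" where
  "gauss_moment k a b u = integral {a..b} (\<lambda>v. v ^ k * exp (- (u * v\<^sup>2 / 2)))"

lemma gauss_moment_integrable: "(\<lambda>v::real. v ^ k * exp (- (u * v\<^sup>2 / 2))) integrable_on {a..b}"
  by (intro integrable_continuous_interval continuous_intros) auto

lemma gauss_moment_deriv:
  "(gauss_moment k a b has_real_derivative - (gauss_moment (k + 2) a b u) / 2) (at u)"
proof -
  have "((\<lambda>u. integral (cbox a b) (\<lambda>v. v ^ k * exp (- (u * v\<^sup>2 / 2)))) has_field_derivative
      integral (cbox a b) (\<lambda>v. - (1 / 2) * (v ^ (k + 2) * exp (- (u * v\<^sup>2 / 2))))) (at u within UNIV)"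
  proof (rule leibniz_rule_field_derivative)
    show "((\<lambda>u. v ^ k * exp (- (u * v\<^sup>2 / 2))) has_field_derivative
        - (1 / 2) * (v ^ (k + 2) * exp (- (u * v\<^sup>2 / 2)))) (at u within UNIV)" for u v :: real
      by (auto intro!: derivative_eq_intros simp: power_add power2_eq_square)
    show "(\<lambda>v. v ^ k * exp (- (u * v\<^sup>2 / 2))) integrable_on cbox a b" for u
      using gauss_moment_integrable by simp
    show "continuous_on (UNIV \<times> cbox a b) (\<lambda>(u, v). - (1 / 2) * (v ^ (k + 2) * exp (- (u * v\<^sup>2 / 2))))"
      by (auto simp: split_beta intro!: continuous_intros)
  qed auto
  moreover have "integral (cbox a b) (\<lambda>v. - (1 / 2) * (v ^ (k + 2) * exp (- (u * v\<^sup>2 / 2)))) =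
      - (gauss_moment (k + 2) a b u) / 2"
    by (subst integral_mult_right) (simp add: gauss_moment_def)
  ultimately show ?thesis
    by (simp add: gauss_moment_def[abs_def])
qed

lemma gauss_moment_continuous: "continuous_on S (gauss_moment k a b)"
  by (rule DERIV_continuous_on[OF has_field_derivative_at_within[OF gauss_moment_deriv]])

lemma gauss_moment_nonneg: "0 \<le> a \<Longrightarrow> 0 \<le> gauss_moment k a b u"
  unfolding gauss_moment_def
  by (intro integral_nonneg gauss_moment_integrable) auto

lemma gauss_moment_le:
  assumes "a \<le> b" and "\<And>v. a \<le> v \<Longrightarrow> v \<le> b \<Longrightarrow> c * (v ^ k * exp (- (u * v\<^sup>2 / 2))) \<le> C"
  shows "c * gauss_moment k a b u \<le> C * (b - a)"
proof -
  have "integral {a..b} (\<lambda>v. c * (v ^ k * exp (- (u * v\<^sup>2 / 2)))) \<le> integral {a..b} (\<lambda>v. C)"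
    by (intro integral_le integrable_continuous_interval continuous_intros) (use assms in auto)
  then show ?thesis
    using assms(1) by (simp add: gauss_moment_def mult.commute)
qed

text \<open>This is \<open>d/dv (v\<^sup>3 exp (- u v\<^sup>2/2))\<close> integrated; it makes the mixture of Gaussians
  \<open>gauss_moment 0 a b\<close> a Green potential of a difference of heat kernels.\<close>

lemma gauss_moment_recursion:
  assumes "a \<le> b"
  shows "3 * gauss_moment 2 a b u - u * gauss_moment 4 a b u =
    b ^ 3 * exp (- (u * b\<^sup>2 / 2)) - a ^ 3 * exp (- (u * a\<^sup>2 / 2))"
proof -
  let ?g = "\<lambda>v::real. v ^ 3 * exp (- (u * v\<^sup>2 / 2))"
  have "((\<lambda>v. 3 * (v ^ 2 * exp (- (u * v\<^sup>2 / 2))) - u * (v ^ 4 * exp (- (u * v\<^sup>2 / 2))))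
      has_integral ?g b - ?g a) {a..b}"
    by (intro fundamental_theorem_of_calculus assms)
       (auto intro!: derivative_eq_intros simp flip: has_real_derivative_iff_has_vector_derivative
         simp: algebra_simps power_numeral_reduce)
  moreover have "((\<lambda>v. 3 * (v ^ 2 * exp (- (u * v\<^sup>2 / 2))) - u * (v ^ 4 * exp (- (u * v\<^sup>2 / 2))))
      has_integral 3 * gauss_moment 2 a b u - u * gauss_moment 4 a b u) {a..b}"
    unfolding gauss_moment_def
    by (intro has_integral_diff has_integral_mult_right integrable_integral gauss_moment_integrable)
  ultimately show ?thesis
    by (rule has_integral_unique[symmetric])
qed

text \<open>Up to constants these are the three weighted bounds that \<open>radial_in_Cb2\<close>
  demands. The weight u is absorbed by x exp (-x) \<le> 1 at x = u v^2 / 2, which is the origin of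
  each 2.\<close>

lemma gauss_moment_bounds:
  assumes "0 \<le> a" "a \<le> b" "0 \<le> u"
  shows "gauss_moment 0 a b u \<le> b"
    and "(1 + u) * gauss_moment 2 a b u \<le> (b\<^sup>2 + 2) * b"
    and "u * gauss_moment 4 a b u \<le> 2 * b\<^sup>2 * b"
proof -
  have xe: "x * exp (- x) \<le> 1" for x :: real
  proof -
    have "x \<le> exp x"
      using exp_ge_add_one_self[of x] by linarith
    then show ?thesis
      by (simp add: exp_minus field_simps)
  qed
  have "1 * gauss_moment 0 a b u \<le> 1 * (b - a)"
    using assms by (intro gauss_moment_le) auto
  then show "gauss_moment 0 a b u \<le> b"
    using assms by simp
  have u2: "u * (v ^ 2 * exp (- (u * v\<^sup>2 / 2))) \<le> 2" for v
    using xe[of "u * v\<^sup>2 / 2"] by (simp add: algebra_simps)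
  have bv: "v\<^sup>2 \<le> b\<^sup>2" if "a \<le> v" "v \<le> b" for v
    using assms that by (intro power_mono) auto
  have "(1 + u) * gauss_moment 2 a b u \<le> (b\<^sup>2 + 2) * (b - a)"
  proof (intro gauss_moment_le assms)
    fix v assume v: "a \<le> v" "v \<le> b"
    have "v\<^sup>2 * exp (- (u * v\<^sup>2 / 2)) \<le> v\<^sup>2 * 1"
      using assms by (intro mult_left_mono) auto
    then show "(1 + u) * (v\<^sup>2 * exp (- (u * v\<^sup>2 / 2))) \<le> b\<^sup>2 + 2"
      using u2[of v] bv[OF v] by (simp add: algebra_simps)
  qed
  also have "\<dots> \<le> (b\<^sup>2 + 2) * b"
    using assms by (intro mult_left_mono) auto
  finally show "(1 + u) * gauss_moment 2 a b u \<le> (b\<^sup>2 + 2) * b" .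
  have "u * gauss_moment 4 a b u \<le> (2 * b\<^sup>2) * (b - a)"
  proof (intro gauss_moment_le assms)
    fix v assume v: "a \<le> v" "v \<le> b"
    have "u * (v ^ 4 * exp (- (u * v\<^sup>2 / 2))) = v\<^sup>2 * (u * (v ^ 2 * exp (- (u * v\<^sup>2 / 2))))"
      by (simp add: power_numeral_reduce)
    also have "\<dots> \<le> b\<^sup>2 * 2"
      using u2[of v] bv[OF v] by (intro mult_mono) (use assms in auto)
    finally show "u * (v ^ 4 * exp (- (u * v\<^sup>2 / 2))) \<le> 2 * b\<^sup>2"
      by simp
  qed
  also have "\<dots> \<le> 2 * b\<^sup>2 * b"
    using assms by (intro mult_left_mono) auto
  finally show "u * gauss_moment 4 a b u \<le> 2 * b\<^sup>2 * b" .
qed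

text \<open>In the parameter \<open>v = s powr (-1/2)\<close>, the Gaussian mixture is \<open>\<integral> p\<^sub>s ds\<close> over
  \<open>1/b\<^sup>2 \<le> s \<le> 1/a\<^sup>2\<close>, where \<open>p\<^sub>s\<close> is the heat kernel in dimension three.\<close>

definition green :: "real \<Rightarrow> real \<Rightarrow> real ^ 3 \<Rightarrow> real ^ 3 \<Rightarrow> real" where
  "green a b x y = 2 / (2 * pi) powr (3 / 2) * gauss_moment 0 a b ((norm (y - x))\<^sup>2)"

text \<open>In dimension three the radial Laplacian 6 f' + 4 u f'' of the mixture is a multiple of
  the left side of \<open>gauss_moment_recursion\<close>, hence reduces to boundary terms at v = a
  and v = b. These are two heat kernels; for a = 0 the first vanishes.\<close>

lemma
  assumes "0 \<le> a" "a \<le> b"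
  shows green_in_Cb2: "green a b x \<in> Cb2"
    and laplacian_green: "laplacian (green a b x) y = 2 / (2 * pi) powr (3 / 2) *
      (a ^ 3 * exp (- ((norm (y - x))\<^sup>2 * a\<^sup>2 / 2)) - b ^ 3 * exp (- ((norm (y - x))\<^sup>2 * b\<^sup>2 / 2)))"
proof -
  let ?c = "2 / (2 * pi) powr (3 / 2)"
  let ?B = "?c * (b + (b\<^sup>2 + 2) * b)"
  have c: "0 \<le> ?c" and b: "0 \<le> b"
    using assms by auto
  have cmult: "?c * t \<le> ?B" if "t \<le> b + (b\<^sup>2 + 2) * b" for t
    using that c by (rule mult_left_mono)
  have d1: "((\<lambda>u. ?c * gauss_moment 0 a b u) has_real_derivative - ?c / 2 * gauss_moment 2 a b u) (at u)" for u
    using DERIV_cmult[OF gauss_moment_deriv[of 0 a b u], of ?c] by (simp add: numeral_2_eq_2)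
  have d2: "((\<lambda>u. - ?c / 2 * gauss_moment 2 a b u) has_real_derivative ?c / 4 * gauss_moment 4 a b u) (at u)" for u
    using DERIV_cmult[OF gauss_moment_deriv[of 2 a b u], of "- ?c / 2"] by (simp add: mult.commute)
  have cont: "continuous_on {0..} (\<lambda>u. ?c / 4 * gauss_moment 4 a b u)"
    by (intro continuous_intros gauss_moment_continuous)
  have bd0: "\<bar>?c * gauss_moment 0 a b u\<bar> \<le> ?B" if "0 \<le> u" for u
  proof -
    have "\<bar>?c * gauss_moment 0 a b u\<bar> = ?c * gauss_moment 0 a b u"
      using gauss_moment_nonneg[OF assms(1), of 0 b u] by (simp add: abs_mult)
    also have "\<dots> \<le> ?B"
      by (rule cmult) (use gauss_moment_bounds(1)[OF assms that] b in \<open>simp add: add_increasing2\<close>)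
    finally show ?thesis .
  qed
  have bd1: "(1 + u) * \<bar>- ?c / 2 * gauss_moment 2 a b u\<bar> \<le> ?B" if "0 \<le> u" for u
  proof -
    have "(1 + u) * \<bar>- ?c / 2 * gauss_moment 2 a b u\<bar> = ?c * ((1 + u) * gauss_moment 2 a b u / 2)"
      using gauss_moment_nonneg[OF assms(1), of 2 b u] by (simp add: abs_mult)
    also have "\<dots> \<le> ?B"
    proof (rule cmult)
      have "0 \<le> (b\<^sup>2 + 2) * b" using b by simp
      then show "(1 + u) * gauss_moment 2 a b u / 2 \<le> b + (b\<^sup>2 + 2) * b"
        using gauss_moment_bounds(2)[OF assms that] b by linarith
    qed
    finally show ?thesis .
  qed
  have bd2: "u * \<bar>?c / 4 * gauss_moment 4 a b u\<bar> \<le> ?B" if "0 \<le> u" for u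
  proof -
    have "u * \<bar>?c / 4 * gauss_moment 4 a b u\<bar> = ?c * (u * gauss_moment 4 a b u / 4)"
      using gauss_moment_nonneg[OF assms(1), of 4 b u] by (simp add: abs_mult)
    also have "\<dots> \<le> ?B"
    proof (rule cmult)
      have "0 \<le> b\<^sup>2 * b" "(b\<^sup>2 + 2) * b = b\<^sup>2 * b + 2 * b" "2 * b\<^sup>2 * b = 2 * (b\<^sup>2 * b)"
        using b by (auto simp: algebra_simps)
      then show "u * gauss_moment 4 a b u / 4 \<le> b + (b\<^sup>2 + 2) * b"
        using gauss_moment_bounds(3)[OF assms that] b by linarith
    qed
    finally show ?thesis .
  qed
  show "green a b x \<in> Cb2"
    unfolding green_def[abs_def] by (rule radial_in_Cb2[OF d1 d2 cont bd0 bd1 bd2])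
  have "laplacian (green a b x) y = 2 * DIM(real ^ 3) * (- ?c / 2 * gauss_moment 2 a b ((norm (y - x))\<^sup>2)) +
      4 * (norm (y - x))\<^sup>2 * (?c / 4 * gauss_moment 4 a b ((norm (y - x))\<^sup>2))"
    unfolding green_def[abs_def] by (rule laplacian_radial[OF d1 d2 cont bd0 bd1 bd2])
  also have "\<dots> = - ?c * (3 * gauss_moment 2 a b ((norm (y - x))\<^sup>2) -
      (norm (y - x))\<^sup>2 * gauss_moment 4 a b ((norm (y - x))\<^sup>2))"
    by (simp add: algebra_simps)
  finally show "laplacian (green a b x) y = ?c *
      (a ^ 3 * exp (- ((norm (y - x))\<^sup>2 * a\<^sup>2 / 2)) - b ^ 3 * exp (- ((norm (y - x))\<^sup>2 * b\<^sup>2 / 2)))"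
    unfolding gauss_moment_recursion[OF assms(2)] by (simp add: algebra_simps)
qed

lemma heat_kernel_eq:
  fixes z :: "real ^ 3"
  assumes "0 < b"
  shows "heat_kernel (1 / b\<^sup>2) z = 1 / (2 * pi) powr (3 / 2) * (b ^ 3 * exp (- ((norm z)\<^sup>2 * b\<^sup>2 / 2)))"
proof -
  have "(2 * pi * (1 / b\<^sup>2)) powr (3 / 2) = (2 * pi) powr (3 / 2) * (1 / b\<^sup>2) powr (3 / 2)"
    by (rule powr_mult)
  also have "(1 / b\<^sup>2) powr (3 / 2) = b powr (-3)"
    using assms by (simp add: powr_divide powr_powr powr_minus_divide flip: powr_numeral)
  also have "\<dots> = 1 / b ^ 3"
    using assms by (simp add: powr_minus_divide powr_numeral)
  finally show ?thesis
    by (simp add: heat_kernel_def)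
qed

lemma half_laplacian_green:
  assumes "0 < b"
  shows "laplacian (green 0 b x) y / 2 = - heat_kernel (1 / b\<^sup>2) (y - x)"
  using assms by (simp add: laplacian_green heat_kernel_eq)

lemma green_nonneg: "0 \<le> a \<Longrightarrow> 0 \<le> green a b x y"
  by (simp add: green_def gauss_moment_nonneg)

lemma green_add:
  assumes "0 \<le> a" "a \<le> b"
  shows "green 0 a x y + green a b x y = green 0 b x y"
proof -
  have "gauss_moment 0 0 a u + gauss_moment 0 a b u = gauss_moment 0 0 b u" for u
    unfolding gauss_moment_def
    by (rule Henstock_Kurzweil_Integration.integral_combine[OF assms gauss_moment_integrable])
  then show ?thesis
    unfolding green_def by (metis distrib_left)
qed

text \<open>Smoothing at scale \<open>1/b\<close> costs at most the factor \<open>exp (1/2)\<close> for \<open>v \<le> b\<close>, so the singular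
  kernels can be compared with bounded ones.\<close>

lemma exp_smoothing:
  fixes r v b :: real
  assumes "0 \<le> v" "v \<le> b" "0 < b"
  shows "exp (- (r\<^sup>2 * v\<^sup>2 / 2)) \<le> 2 * exp (- ((1 / b\<^sup>2 + r\<^sup>2) * v\<^sup>2 / 2))"
proof -
  have "v\<^sup>2 \<le> b\<^sup>2"
    using assms by (intro power_mono)
  then have "1 / b\<^sup>2 * v\<^sup>2 / 2 \<le> 1 / 2"
    using assms by (simp add: field_simps)
  also have "1 / 2 \<le> ln (2::real)"
    using ln2_ge_two_thirds by simp
  finally have "- (r\<^sup>2 * v\<^sup>2 / 2) \<le> ln 2 + - ((1 / b\<^sup>2 + r\<^sup>2) * v\<^sup>2 / 2)"
    by (simp add: algebra_simps)
  then have "exp (- (r\<^sup>2 * v\<^sup>2 / 2)) \<le> exp (ln 2 + - ((1 / b\<^sup>2 + r\<^sup>2) * v\<^sup>2 / 2))"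
    by (simp only: exp_le_cancel_iff)
  also have "\<dots> = 2 * exp (- ((1 / b\<^sup>2 + r\<^sup>2) * v\<^sup>2 / 2))"
    by (simp only: exp_add exp_ln zero_less_numeral)
  finally show ?thesis .
qed

text \<open>Replacing the Gaussian by a multiple of 1 / (1 + u v^2) permits an explicit arctan
  primitive. The 8 is 4 times the crude bound arctan < pi/2 < 2; the 4 combines the smoothing factor
  2 with (1 + x) / 2 \<le> exp (x / 2).\<close>

lemma gauss_moment_upper:
  assumes b: "0 < b"
  shows "gauss_moment 0 0 b (r\<^sup>2) \<le> 8 / sqrt (1 / b\<^sup>2 + r\<^sup>2)"
proof -
  define u where "u = 1 / b\<^sup>2 + r\<^sup>2"
  have u: "0 < u"
    using b by (simp add: u_def add_pos_nonneg)
  have "((\<lambda>v. 4 / sqrt u * arctan (sqrt u * v)) has_real_derivative 4 / (1 + u * v\<^sup>2)) (at v within {0..b})" for v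
    using u by (auto intro!: derivative_eq_intros simp: power_mult_distrib divide_inverse)
  then have "((\<lambda>v. 4 / (1 + u * v\<^sup>2)) has_integral 4 / sqrt u * arctan (sqrt u * b) - 4 / sqrt u * arctan (sqrt u * 0)) {0..b}"
    using b by (intro fundamental_theorem_of_calculus)
       (auto simp flip: has_real_derivative_iff_has_vector_derivative)
  note upper = this
  have lower: "((\<lambda>v. v ^ 0 * exp (- (r\<^sup>2 * v\<^sup>2 / 2))) has_integral gauss_moment 0 0 b (r\<^sup>2)) {0..b}"
    unfolding gauss_moment_def by (intro integrable_integral gauss_moment_integrable)
  have "v ^ 0 * exp (- (r\<^sup>2 * v\<^sup>2 / 2)) \<le> 4 / (1 + u * v\<^sup>2)" if "v \<in> {0..b}" for v
  proof -
    have "(1 + u * v\<^sup>2) / 2 \<le> exp (u * v\<^sup>2 / 2)"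
      using exp_ge_add_one_self[of "u * v\<^sup>2 / 2"] u by (simp add: field_simps)
    moreover have "0 < 1 + u * v\<^sup>2"
      using u by (simp add: add_pos_nonneg)
    ultimately have "2 * exp (- (u * v\<^sup>2 / 2)) \<le> 4 / (1 + u * v\<^sup>2)"
      by (simp add: exp_minus field_simps)
    then show ?thesis
      using exp_smoothing[of v b r] that b by (simp add: u_def)
  qed
  from has_integral_le[OF lower upper this] have "gauss_moment 0 0 b (r\<^sup>2) \<le> 4 / sqrt u * arctan (sqrt u * b) - 4 / sqrt u * arctan (sqrt u * 0)" .
  also have "\<dots> \<le> 4 / sqrt u * 2"
    using arctan_ubound[of "sqrt u * b"] pi_less_4 u by (simp add: divide_right_mono)
  finally show ?thesis
    by (simp add: u_def)
qed

text \<open>On the initial interval up to 1 / sqrt u, which lies below b, the exponent is at most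
  1/2 < ln 2, so the integrand stays above 1/2.\<close>

lemma gauss_moment_lower:
  assumes b: "0 < b"
  shows "1 / (2 * sqrt (1 / b\<^sup>2 + r\<^sup>2)) \<le> gauss_moment 0 0 b (r\<^sup>2)"
proof -
  define u where "u = 1 / b\<^sup>2 + r\<^sup>2"
  have u: "0 < u" "1 / b\<^sup>2 \<le> u"
    using b by (auto simp: u_def add_pos_nonneg)
  define d where "d = 1 / sqrt u"
  have d: "0 < d" "d\<^sup>2 = 1 / u"
    using u by (auto simp: d_def power_divide)
  have "1 / u \<le> b\<^sup>2"
    using u b by (simp add: field_simps)
  then have "d \<le> b"
    by (intro power2_le_imp_le[of d b]) (use b d in auto)
  have "integral {0..d} (\<lambda>v. 1 / 2) \<le> gauss_moment 0 0 d (r\<^sup>2)"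
    unfolding gauss_moment_def
  proof (intro integral_le gauss_moment_integrable)
    fix v assume v: "v \<in> {0..d}"
    have "r\<^sup>2 * v\<^sup>2 \<le> u * d\<^sup>2"
      using v u b by (intro mult_mono power_mono) (auto simp: u_def)
    then have "r\<^sup>2 * v\<^sup>2 / 2 \<le> ln 2"
      using d u ln2_ge_two_thirds by simp
    then have "exp (- ln 2) \<le> exp (- (r\<^sup>2 * v\<^sup>2 / 2))"
      by simp
    then show "1 / 2 \<le> v ^ 0 * exp (- (r\<^sup>2 * v\<^sup>2 / 2))"
      by (simp add: exp_minus field_simps)
  qed auto
  also have "\<dots> \<le> gauss_moment 0 0 b (r\<^sup>2)"
    unfolding gauss_moment_def
    by (intro integral_subset_le gauss_moment_integrable) (use \<open>d \<le> b\<close> in auto)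
  finally show ?thesis
    using d(1) by (simp add: d_def u_def)
qed

text \<open>Uses exp (-x) \<le> x powr (-5/8). The exponent is chosen for two reasons: its square
  gives the power -5/4 of u that the Laplacian of the smoothed root dominates, and v powr (-5/4) is
  integrable at infinity, leaving the decaying factor a powr (-1/4).\<close>

lemma gauss_moment_tail:
  assumes a: "0 < a" "a \<le> b"
  shows "gauss_moment 0 a b (r\<^sup>2) \<le> 16 * a powr (- 1 / 4) * (1 / b\<^sup>2 + r\<^sup>2) powr (- 5 / 8)"
proof -
  define u where "u = 1 / b\<^sup>2 + r\<^sup>2"
  have u: "0 < u"
    using a by (simp add: u_def add_pos_nonneg)
  let ?g = "\<lambda>v. - 16 * u powr (- 5 / 8) * v powr (- 1 / 4)"
  have "(?g has_real_derivative 4 * u powr (- 5 / 8) * v powr (- 5 / 4)) (at v within {a..b})" if "v \<in> {a..b}" for v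
    using DERIV_cmult[OF has_real_derivative_powr[of v "- 1 / 4"], of "- 16 * u powr (- 5 / 8)"] that a
    by (auto intro!: has_field_derivative_at_within simp: mult_ac)
  then have "((\<lambda>v. 4 * u powr (- 5 / 8) * v powr (- 5 / 4)) has_integral ?g b - ?g a) {a..b}"
    using a by (intro fundamental_theorem_of_calculus)
       (auto simp flip: has_real_derivative_iff_has_vector_derivative)
  note upper = this
  have lower: "((\<lambda>v. v ^ 0 * exp (- (r\<^sup>2 * v\<^sup>2 / 2))) has_integral gauss_moment 0 a b (r\<^sup>2)) {a..b}"
    unfolding gauss_moment_def by (intro integrable_integral gauss_moment_integrable)
  have "v ^ 0 * exp (- (r\<^sup>2 * v\<^sup>2 / 2)) \<le> 4 * u powr (- 5 / 8) * v powr (- 5 / 4)" if "v \<in> {a..b}" for v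
  proof -
    have v: "0 < v"
      using that a by auto
    define x where "x = u * v\<^sup>2 / 2"
    have x: "0 < x"
      using u v by (simp add: x_def)
    have "x powr (5 / 8) \<le> 1 + x"
    proof (cases "x \<le> 1")
      case True
      then have "x powr (5 / 8) \<le> 1"
        using x by (intro powr_le1) auto
      then show ?thesis
        using x by simp
    next
      case False
      then have "x powr (5 / 8) \<le> x powr 1"
        by (intro powr_mono) auto
      then show ?thesis
        using x by simp
    qed
    also have "\<dots> \<le> exp x"
      by (rule exp_ge_add_one_self)
    finally have "exp (- x) \<le> x powr (- 5 / 8)"
      using x by (simp add: exp_minus powr_minus field_simps)
    also have "x powr (- 5 / 8) = u powr (- 5 / 8) * v powr (- 5 / 4) * 2 powr (5 / 8)"
      using u v by (simp add: x_def powr_mult powr_divide powr_powr powr_minus_divide flip: powr_numeral)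
    also have "\<dots> \<le> u powr (- 5 / 8) * v powr (- 5 / 4) * 2"
      using powr_mono[of "5 / 8" 1 "2::real"] by (intro mult_left_mono) auto
    finally show ?thesis
      using exp_smoothing[of v b r] that a by (simp add: u_def x_def)
  qed
  from has_integral_le[OF lower upper this] have "gauss_moment 0 a b (r\<^sup>2) \<le> ?g b - ?g a" .
  also have "\<dots> \<le> - ?g a"
    by simp
  finally show ?thesis
    by (simp add: u_def algebra_simps)
qed

text \<open>In u = r^2 the function r powr (-1/2) has exponent -1/4. Its radial Laplacian is -3/2 (e
  + u) powr (-5/4) + 5/4 u (e + u) powr (-9/4), and u \<le> e + u leaves -3/2 + 5/4 = -1/4:
  smoothing does not destroy superharmonicity.\<close>

lemma
  fixes x :: "real ^ 3"
  assumes e: "0 < e"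
  shows smoothed_root_in_Cb2: "(\<lambda>y. (e + (norm (y - x))\<^sup>2) powr (- 1 / 4)) \<in> Cb2"
    and laplacian_smoothed_root: "laplacian (\<lambda>y. (e + (norm (y - x))\<^sup>2) powr (- 1 / 4)) y
      \<le> - (1 / 4) * (e + (norm (y - x))\<^sup>2) powr (- 5 / 4)"
proof -
  let ?f = "\<lambda>u. (e + u) powr (- 1 / 4)"
  let ?f1 = "\<lambda>u. - (1 / 4) * (e + u) powr (- 5 / 4)"
  let ?f2 = "\<lambda>u. 5 / 16 * (e + u) powr (- 9 / 4)"
  have d1: "(?f has_real_derivative ?f1 u) (at u)" if "0 \<le> u" for u
    using e that by (auto intro!: derivative_eq_intros)
  have d2: "(?f1 has_real_derivative ?f2 u) (at u)" if "0 \<le> u" for u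
    using e that by (auto intro!: derivative_eq_intros)
  have cont: "continuous_on {0..} ?f2"
    using e by (intro continuous_intros) auto
  have step: "(e + u) * (e + u) powr p = (e + u) powr (p + 1)" if "0 \<le> u" for u p
    using e that by (simp add: powr_add mult.commute)
  \<comment> \<open>The first summand comes from 1 + u \<le> (1 + 1/e) (e + u), the second from u
    \<le> e + u.\<close>
  define B where "B = (1 + 1 / e) * e powr (- 1 / 4) + e powr (- 5 / 4)"
  have le1: "(e + u) powr (- 1 / 4) \<le> e powr (- 1 / 4)" "(e + u) powr (- 5 / 4) \<le> e powr (- 5 / 4)"
    if "0 \<le> u" for u
    using e that by (auto intro!: powr_mono2')
  have bd0: "\<bar>?f u\<bar> \<le> B" if "0 \<le> u" for u
    using le1[OF that] e by (simp add: B_def distrib_right add_increasing2)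
  have bd1: "(1 + u) * \<bar>?f1 u\<bar> \<le> B" if u: "0 \<le> u" for u
  proof -
    have "1 + u \<le> (1 + 1 / e) * (e + u)"
      using e u by (simp add: field_simps)
    then have "(1 + u) * (e + u) powr (- 5 / 4) \<le> (1 + 1 / e) * (e + u) * (e + u) powr (- 5 / 4)"
      by (intro mult_right_mono) auto
    also have "\<dots> = (1 + 1 / e) * (e + u) powr (- 1 / 4)"
      using step[OF u, of "- 5 / 4"] by (simp add: mult.assoc)
    also have "\<dots> \<le> (1 + 1 / e) * e powr (- 1 / 4)"
      using le1[OF u] e by (intro mult_left_mono) auto
    finally have "(1 + u) * (e + u) powr (- 5 / 4) \<le> B"
      by (simp add: B_def add_increasing2)
    moreover have "0 \<le> (1 + u) * (e + u) powr (- 5 / 4)"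
      using u by simp
    ultimately show ?thesis
      by (simp add: abs_mult)
  qed
  have u2: "u * (e + u) powr (- 9 / 4) \<le> (e + u) powr (- 5 / 4)" if u: "0 \<le> u" for u
  proof -
    have "u * (e + u) powr (- 9 / 4) \<le> (e + u) * (e + u) powr (- 9 / 4)"
      using e by (intro mult_right_mono) auto
    then show ?thesis
      using step[OF u, of "- 9 / 4"] by simp
  qed
  have bd2: "u * \<bar>?f2 u\<bar> \<le> B" if u: "0 \<le> u" for u
  proof -
    have "u * \<bar>?f2 u\<bar> \<le> u * (e + u) powr (- 9 / 4)"
      using u by (simp add: abs_mult)
    also have "\<dots> \<le> e powr (- 5 / 4)"
      using u2[OF u] le1[OF u] by simp
    also have "\<dots> \<le> B"
      using e by (simp add: B_def)
    finally show ?thesis .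
  qed
  show "(\<lambda>y. (e + (norm (y - x))\<^sup>2) powr (- 1 / 4)) \<in> Cb2"
    by (rule radial_in_Cb2[OF d1 d2 cont bd0 bd1 bd2])
  have "laplacian (\<lambda>y. (e + (norm (y - x))\<^sup>2) powr (- 1 / 4)) y =
      2 * DIM(real ^ 3) * ?f1 ((norm (y - x))\<^sup>2) + 4 * (norm (y - x))\<^sup>2 * ?f2 ((norm (y - x))\<^sup>2)"
    by (rule laplacian_radial[OF d1 d2 cont bd0 bd1 bd2])
  then show "laplacian (\<lambda>y. (e + (norm (y - x))\<^sup>2) powr (- 1 / 4)) y
      \<le> - (1 / 4) * (e + (norm (y - x))\<^sup>2) powr (- 5 / 4)"
    using u2[of "(norm (y - x))\<^sup>2"] by (simp add: mult.assoc)
qed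

section \<open>Weak topology and martingales\<close>

lemma finite_measure_integrable_bcontfun:
  fixes f :: "'a::euclidean_space \<Rightarrow> real"
  assumes "m \<in> finite_measures" "f \<in> bcontfun"
  shows "integrable m f"
proof -
  interpret finite_measure m
    using assms(1) by (simp add: finite_measures_def)
  have "sets m = sets borel"
    using assms(1) by (simp add: finite_measures_def)
  then have "f \<in> borel_measurable m"
    using assms(2) borel_measurable_continuous_onI[of f]
    by (simp add: bcontfun_def cong: measurable_cong_sets)
  moreover obtain B where "\<And>x. norm (f x) \<le> B"
    using assms(2) by (auto simp: bcontfun_def bounded_iff)
  ultimately show ?thesis
    by (intro integrable_const_bound[of _ B]) auto
qed

lemma openin_weak_topology_pairing:
  fixes f :: "'a::euclidean_space \<Rightarrow> real"
  assumes "f \<in> bcontfun" "open U"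
  shows "openin weak_topology {m \<in> finite_measures. integral\<^sup>L m f \<in> U}"
  unfolding weak_topology_def using assms by (intro topology_generated_by_Basis) blast

lemma topspace_weak_topology: "topspace weak_topology = (finite_measures :: 'a::euclidean_space measure set)"
proof
  show "topspace weak_topology \<subseteq> (finite_measures :: 'a measure set)"
    by (auto simp: weak_topology_def)
  have "(\<lambda>_::'a. 0::real) \<in> bcontfun"
    by (rule const_bcontfun)
  from openin_weak_topology_pairing[OF this open_UNIV]
  show "(finite_measures :: 'a measure set) \<subseteq> topspace weak_topology"
    using openin_subset by fastforce
qed

lemma space_finite_measure_algebra: "space finite_measure_algebra = finite_measures"
  by (simp add: finite_measure_algebra_def space_measure_of_conv)

lemma measurable_pairing:
  fixes f :: "'a::euclidean_space \<Rightarrow> real"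
  assumes "f \<in> bcontfun"
  shows "(\<lambda>m. integral\<^sup>L m f) \<in> borel_measurable finite_measure_algebra"
proof (rule borel_measurableI)
  fix U :: "real set" assume "open U"
  have "{U. openin weak_topology U} \<subseteq> Pow (finite_measures :: 'a measure set)"
    using openin_subset topspace_weak_topology by fastforce
  then have "U' \<in> sets finite_measure_algebra" if "openin weak_topology U'" for U' :: "'a measure set"
    using that by (simp add: finite_measure_algebra_def sets_measure_of)
  from this[OF openin_weak_topology_pairing[OF assms \<open>open U\<close>]]
  show "(\<lambda>m. integral\<^sup>L m f) -` U \<inter> space finite_measure_algebra \<in> sets finite_measure_algebra"
    by (simp add: space_finite_measure_algebra vimage_def Int_def conj_commute)
qed

lemma continuous_map_pairing:
  fixes f :: "'a::euclidean_space \<Rightarrow> real"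
  assumes "f \<in> bcontfun"
  shows "continuous_map weak_topology euclidean (\<lambda>m. integral\<^sup>L m f)"
  unfolding continuous_map_def topspace_weak_topology
  using openin_weak_topology_pairing[OF assms] by simp

text \<open>Rounding time down to a grid leaves countably many random variables, so the rounded
  process is jointly measurable; continuity of paths passes this to the limit. It is what Tonelli
  needs to exchange expectation and time integral.\<close>

lemma borel_measurable_pair_continuous:
  fixes g :: "real \<Rightarrow> 'w \<Rightarrow> real"
  assumes meas: "\<And>s. g s \<in> borel_measurable M"
    and cont: "\<And>\<omega>. \<omega> \<in> space M \<Longrightarrow> continuous_on UNIV (\<lambda>s. g s \<omega>)"
  shows "(\<lambda>(s, \<omega>). g s \<omega>) \<in> borel_measurable (lborel \<Otimes>\<^sub>M M)"
proof (rule borel_measurable_LIMSEQ_real)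
  let ?r = "\<lambda>n s. real_of_int \<lfloor>s * real (Suc n)\<rfloor> / real (Suc n)"
  show "(\<lambda>(s, \<omega>). g (?r n s) \<omega>) \<in> borel_measurable (lborel \<Otimes>\<^sub>M M)" for n
  proof -
    have "(\<lambda>p. g (real_of_int i / real (Suc n)) (snd p)) \<in> borel_measurable (lborel \<Otimes>\<^sub>M M)" for i :: int
      using meas by measurable
    moreover have "(\<lambda>p. \<lfloor>fst p * real (Suc n)\<rfloor>) \<in> measurable (lborel \<Otimes>\<^sub>M M) (count_space UNIV)"
      by measurable
    ultimately have "(\<lambda>p. g (real_of_int \<lfloor>fst p * real (Suc n)\<rfloor> / real (Suc n)) (snd p)) \<in>
        borel_measurable (lborel \<Otimes>\<^sub>M M)"
      by (rule measurable_compose_countable)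
    then show ?thesis
      by (simp add: split_beta')
  qed
  fix p :: "real \<times> 'w" assume p: "p \<in> space (lborel \<Otimes>\<^sub>M M)"
  have "(\<lambda>n. ?r n (fst p)) \<longlonglongrightarrow> fst p"
  proof (rule tendsto_sandwich[of "\<lambda>n. fst p - 1 / real (Suc n)" _ _ "\<lambda>n. fst p"])
    show "\<forall>\<^sub>F n in sequentially. fst p - 1 / real (Suc n) \<le> ?r n (fst p)"
    proof (intro always_eventually allI)
      fix n
      have "(fst p * real (Suc n) - 1) / real (Suc n) \<le> ?r n (fst p)"
        by (intro divide_right_mono) linarith+
      then show "fst p - 1 / real (Suc n) \<le> ?r n (fst p)"
        by (simp add: diff_divide_distrib del: of_nat_Suc)
    qed
    show "\<forall>\<^sub>F n in sequentially. ?r n (fst p) \<le> fst p"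
      by (intro always_eventually allI) (simp add: divide_le_eq del: of_nat_Suc)
    show "(\<lambda>n. fst p - 1 / real (Suc n)) \<longlonglongrightarrow> fst p"
      using tendsto_diff[OF tendsto_const lim_1_over_n[THEN LIMSEQ_Suc], of "fst p"] by simp
  qed simp
  moreover have "isCont (\<lambda>s. g s (snd p)) (fst p)"
    using cont[of "snd p"] p by (auto simp: space_pair_measure continuous_on_eq_continuous_at)
  ultimately have "(\<lambda>n. g (?r n (fst p)) (snd p)) \<longlonglongrightarrow> g (fst p) (snd p)"
    by (rule isCont_tendsto_compose[rotated])
  then show "(\<lambda>n. case p of (s, \<omega>) \<Rightarrow> g (?r n s) \<omega>) \<longlonglongrightarrow> (case p of (s, \<omega>) \<Rightarrow> g s \<omega>)"
    by (simp add: split_beta)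
qed

section \<open>Means and second moments of martingales\<close>

locale filtered_prob_space = prob_space P for P :: "'w measure" +
  fixes F :: "real \<Rightarrow> 'w measure"
  assumes subalg: "\<And>t. subalgebra P (F t)"
begin

lemma martingale_integral:
  assumes "martingale P F Z" "0 \<le> t"
  shows "integral\<^sup>L P (Z t) = integral\<^sup>L P (Z 0)"
proof -
  interpret finite_measure_subalgebra P "F 0"
    by unfold_locales (rule subalg)
  have int: "integrable P (Z t)" and "AE \<omega> in P. real_cond_exp P (F 0) (Z t) \<omega> = Z 0 \<omega>"
    and "integrable P (Z 0)"
    using assms by (auto simp: martingale_def)
  then have "integral\<^sup>L P (real_cond_exp P (F 0) (Z t)) = integral\<^sup>L P (Z 0)"
    by (intro integral_cong_AE) auto
  then show ?thesis
    using real_cond_exp_int(2)[OF int] by simp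
qed

text \<open>Only an inequality is asserted, as the localized martingales need not be uniformly integrable.\<close>

lemma quadratic_variation_bound:
  assumes Z0: "\<And>\<omega>. \<omega> \<in> space P \<Longrightarrow> Z 0 \<omega> = 0"
    and qv: "quadratic_variation P F Z A" and t: "0 \<le> t"
  shows "(\<integral>\<^sup>+\<omega>. ennreal ((Z t \<omega>)\<^sup>2) \<partial>P) \<le> (\<integral>\<^sup>+\<omega>. ennreal (A t \<omega>) \<partial>P)"
proof (cases "(\<integral>\<^sup>+\<omega>. ennreal (A t \<omega>) \<partial>P) < \<infinity>")
  case False
  then show ?thesis
    by (simp add: not_less top_unique)
next
  case True
  have A_meas: "A t \<in> borel_measurable P"
    using qv t measurable_from_subalg[OF subalg] unfolding quadratic_variation_def by blast
  have A0: "A 0 \<omega> = 0" and A_mono: "mono_on {0..} (\<lambda>t. A t \<omega>)" if "\<omega> \<in> space P" for \<omega>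
    using qv that by (auto simp: quadratic_variation_def)
  have A_nonneg: "0 \<le> A t \<omega>" if "\<omega> \<in> space P" for \<omega>
    using mono_onD[OF A_mono[OF that], of 0 t] A0[OF that] t by simp
  have A_int: "integrable P (A t)"
    by (rule integrableI_nonneg) (use A_meas A_nonneg True in \<open>auto intro!: AE_I2\<close>)
  obtain T :: "nat \<Rightarrow> 'w \<Rightarrow> real" where
    T: "\<forall>n. stopping_time F (T n) \<and> (\<forall>\<omega>\<in>space P. 0 \<le> T n \<omega>)"
    and T_lim: "AE \<omega> in P. incseq (\<lambda>n. T n \<omega>) \<and> filterlim (\<lambda>n. T n \<omega>) at_top sequentially"
    and mart: "martingale P F (\<lambda>t \<omega>. (Z (min t (T n \<omega>)) \<omega>)\<^sup>2 - A (min t (T n \<omega>)) \<omega>)" for n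
    using qv unfolding quadratic_variation_def local_martingale_def by blast
  have T_nonneg: "0 \<le> T n \<omega>" if "\<omega> \<in> space P" for n \<omega>
    using T that by blast
  define W where "W = (\<lambda>n \<omega>. (Z (min t (T n \<omega>)) \<omega>)\<^sup>2 - A (min t (T n \<omega>)) \<omega>)"
  have W_int: "integrable P (W n)" for n
    using mart[of n] t by (simp add: martingale_def W_def)
  have W_mean: "integral\<^sup>L P (W n) = 0" for n
  proof -
    have "integral\<^sup>L P (W n) = (\<integral>\<omega>. (Z (min 0 (T n \<omega>)) \<omega>)\<^sup>2 - A (min 0 (T n \<omega>)) \<omega> \<partial>P)"
      unfolding W_def by (rule martingale_integral[OF mart t])
    also have "\<dots> = (\<integral>\<omega>. 0 \<partial>P)"
      by (intro Bochner_Integration.integral_cong) (auto simp: min_absorb1 T_nonneg Z0 A0)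
    finally show ?thesis by simp
  qed
  \<comment> \<open>Fatou needs nonnegative integrands. Adding the integrable \<open>A t\<close>
    achieves this, and since \<open>W n\<close> has mean zero, the expectation becomes that of
    \<open>A t\<close> for every n.\<close>
  have W_ge: "0 \<le> W n \<omega> + A t \<omega>" if "\<omega> \<in> space P" for n \<omega>
  proof -
    have "A (min t (T n \<omega>)) \<omega> \<le> A t \<omega>"
      by (rule mono_onD[OF A_mono[OF that]]) (use t T_nonneg[OF that] in auto)
    then show ?thesis
      using zero_le_power2[of "Z (min t (T n \<omega>)) \<omega>"] unfolding W_def by linarith
  qed
  have W_nn: "(\<integral>\<^sup>+\<omega>. ennreal (W n \<omega> + A t \<omega>) \<partial>P) = (\<integral>\<^sup>+\<omega>. ennreal (A t \<omega>) \<partial>P)" for n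
  proof -
    have "(\<integral>\<^sup>+\<omega>. ennreal (W n \<omega> + A t \<omega>) \<partial>P) = ennreal (\<integral>\<omega>. W n \<omega> + A t \<omega> \<partial>P)"
      by (rule nn_integral_eq_integral) (use W_int A_int W_ge in \<open>auto intro!: AE_I2\<close>)
    also have "(\<integral>\<omega>. W n \<omega> + A t \<omega> \<partial>P) = integral\<^sup>L P (A t)"
      by (simp add: W_int A_int W_mean)
    also have "ennreal \<dots> = (\<integral>\<^sup>+\<omega>. ennreal (A t \<omega>) \<partial>P)"
      by (rule nn_integral_eq_integral[symmetric]) (use A_int A_nonneg in \<open>auto intro!: AE_I2\<close>)
    finally show ?thesis .
  qed
  have "(\<integral>\<^sup>+\<omega>. ennreal ((Z t \<omega>)\<^sup>2) \<partial>P) \<le> (\<integral>\<^sup>+\<omega>. liminf (\<lambda>n. ennreal (W n \<omega> + A t \<omega>)) \<partial>P)"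
  proof (rule nn_integral_mono_AE)
    show "AE \<omega> in P. ennreal ((Z t \<omega>)\<^sup>2) \<le> liminf (\<lambda>n. ennreal (W n \<omega> + A t \<omega>))"
      using T_lim
    proof eventually_elim
      case (elim \<omega>)
      then have "\<forall>\<^sub>F n in sequentially. t \<le> T n \<omega>"
        by (auto simp: filterlim_at_top)
      then have "\<forall>\<^sub>F n in sequentially. ennreal ((Z t \<omega>)\<^sup>2) \<le> ennreal (W n \<omega> + A t \<omega>)"
        by eventually_elim (simp add: W_def min_absorb1)
      then show ?case
        by (rule Liminf_bounded)
    qed
  qed
  also have "\<dots> \<le> liminf (\<lambda>n. \<integral>\<^sup>+\<omega>. ennreal (W n \<omega> + A t \<omega>) \<partial>P)"
    by (rule nn_integral_liminf) (use W_int A_meas in auto)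
  also have "\<dots> = (\<integral>\<^sup>+\<omega>. ennreal (A t \<omega>) \<partial>P)"
    unfolding W_nn by (simp add: Liminf_const)
  finally show ?thesis .
qed

end

section \<open>Occupation measures\<close>

lemma const_in_Cb2: "(\<lambda>_::'a::euclidean_space. c) \<in> Cb2"
  and laplacian_const: "laplacian (\<lambda>_::'a. c) = (\<lambda>_. 0)"
proof -
  have d: "((\<lambda>_::'a. c) has_derivative (\<lambda>h. 0 \<bullet> h)) (at x)"
    "((\<lambda>_::'a. 0::'a) has_derivative blinfun_apply 0) (at x)" for x
    by (auto intro!: derivative_eq_intros)
  show "(\<lambda>_::'a. c) \<in> Cb2"
    unfolding Cb2_def mem_Collect_eq
  proof (intro conjI exI allI)
    show "((\<lambda>_::'a. c) has_derivative (\<lambda>h. 0 \<bullet> h)) (at x)"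
      "((\<lambda>_::'a. 0::'a) has_derivative blinfun_apply 0) (at x)" for x
      by (fact d)+
  qed auto
  show "laplacian (\<lambda>_::'a. c) = (\<lambda>_. 0)"
    using laplacian_eq_sum_second_derivative[OF d] by auto
qed

lemma bcontfun_cmult:
  fixes f :: "'a::topological_space \<Rightarrow> real"
  assumes "f \<in> bcontfun"
  shows "(\<lambda>x. c * f x) \<in> bcontfun"
proof -
  obtain B where "\<And>x. norm (f x) \<le> B"
    using assms by (auto simp: bcontfun_def bounded_iff)
  then have "norm (c * f x) \<le> \<bar>c\<bar> * B" for x
    by (simp add: abs_mult mult_left_mono)
  moreover have "continuous_on UNIV (\<lambda>x. c * f x)"
    using assms by (auto simp: bcontfun_def intro!: continuous_intros)
  ultimately show ?thesis
    by (rule bcontfun_normI[rotated])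
qed

lemma bcontfun_power2:
  fixes f :: "'a::topological_space \<Rightarrow> real"
  assumes "f \<in> bcontfun"
  shows "(\<lambda>x. (f x)\<^sup>2) \<in> bcontfun"
proof -
  obtain B where "\<And>x. norm (f x) \<le> B"
    using assms by (auto simp: bcontfun_def bounded_iff)
  then have "norm ((f x)\<^sup>2) \<le> B\<^sup>2" for x
    unfolding norm_power by (intro power_mono) auto
  moreover have "continuous_on UNIV (\<lambda>x. (f x)\<^sup>2)"
    using assms by (auto simp: bcontfun_def intro!: continuous_intros)
  ultimately show ?thesis
    by (rule bcontfun_normI[rotated])
qed

section \<open>Pairings of the process, their time integrals and their means\<close>

locale sbm =
  fixes P :: "'w measure" and F :: "real \<Rightarrow> 'w measure"
    and X :: "real \<Rightarrow> 'w \<Rightarrow> 'a::euclidean_space measure" and \<mu> :: "'a measure"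
  assumes sbm: "super_brownian_motion P F X \<mu>"
begin

sublocale filtered_prob_space P F
proof -
  interpret prob_space P
    using sbm by (simp add: super_brownian_motion_def)
  show "filtered_prob_space P F"
    by unfold_locales (use sbm in \<open>simp add: super_brownian_motion_def\<close>)
qed

definition pairing :: "real \<Rightarrow> ('a \<Rightarrow> real) \<Rightarrow> 'w \<Rightarrow> real" where
  "pairing t f \<omega> = integral\<^sup>L (X t \<omega>) f"

definition occupation :: "real \<Rightarrow> ('a \<Rightarrow> real) \<Rightarrow> 'w \<Rightarrow> real" where
  "occupation t f \<omega> = (LBINT s:{0..t}. pairing s f \<omega>)"

lemma X_finite_measure: "0 \<le> t \<Longrightarrow> \<omega> \<in> space P \<Longrightarrow> X t \<omega> \<in> finite_measures"
proof -
  assume t: "0 \<le> t" and \<omega>: "\<omega> \<in> space P"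
  have "X t \<in> measurable (F t) finite_measure_algebra"
    using sbm t by (simp add: super_brownian_motion_def)
  then have "X t \<omega> \<in> space finite_measure_algebra"
    by (rule measurable_space) (use \<omega> subalg[of t] in \<open>simp add: subalgebra_def\<close>)
  then show ?thesis
    by (simp add: space_finite_measure_algebra)
qed

lemma initial_finite_measure: "\<mu> \<in> finite_measures"
  using sbm by (simp add: super_brownian_motion_def)

lemmas X_integrable = finite_measure_integrable_bcontfun[OF X_finite_measure]
lemmas initial_integrable = finite_measure_integrable_bcontfun[OF initial_finite_measure]

lemma pairing_measurable:
  assumes "f \<in> bcontfun" "0 \<le> t"
  shows "pairing t f \<in> borel_measurable P"
proof -
  have "X t \<in> measurable (F t) finite_measure_algebra"
    using sbm assms by (simp add: super_brownian_motion_def)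
  from measurable_compose[OF this measurable_pairing[OF assms(1)]] show ?thesis
    unfolding pairing_def[abs_def] by (rule measurable_from_subalg[OF subalg])
qed

lemma pairing_continuous:
  assumes "f \<in> bcontfun" "\<omega> \<in> space P"
  shows "continuous_on {0..} (\<lambda>t. pairing t f \<omega>)"
proof -
  have "continuous_map (top_of_set {0..}) weak_topology (\<lambda>t. X t \<omega>)"
    using sbm assms by (simp add: super_brownian_motion_def)
  from continuous_map_compose[OF this continuous_map_pairing[OF assms(1)]] show ?thesis
    by (simp add: pairing_def o_def)
qed

lemma pairing_mono:
  assumes "f \<in> bcontfun" "g \<in> bcontfun" "\<And>y. f y \<le> g y" "0 \<le> t" "\<omega> \<in> space P"
  shows "pairing t f \<omega> \<le> pairing t g \<omega>"
  unfolding pairing_def by (intro integral_mono X_integrable assms)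

lemma pairing_nonneg: "(\<And>y. 0 \<le> f y) \<Longrightarrow> 0 \<le> pairing t f \<omega>"
  unfolding pairing_def by (rule Bochner_Integration.integral_nonneg)

lemma pairing_cmult: "pairing t (\<lambda>y. c * f y) \<omega> = c * pairing t f \<omega>"
  unfolding pairing_def by simp

lemma pairing_initial: "AE \<omega> in P. pairing 0 f \<omega> = integral\<^sup>L \<mu> f"
proof -
  have "AE \<omega> in P. X 0 \<omega> = \<mu>"
    using sbm by (simp add: super_brownian_motion_def)
  then show ?thesis
    by eventually_elim (simp add: pairing_def)
qed

lemma pairing_set_integrable:
  assumes "f \<in> bcontfun" "\<omega> \<in> space P"
  shows "set_integrable lborel {0..t} (\<lambda>s. pairing s f \<omega>)"
  by (intro borel_integrable_atLeastAtMost' continuous_on_subset[OF pairing_continuous[OF assms]]) auto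

lemma occupation_mono:
  assumes "f \<in> bcontfun" "g \<in> bcontfun" "\<And>y. f y \<le> g y" "\<omega> \<in> space P"
  shows "occupation t f \<omega> \<le> occupation t g \<omega>"
  unfolding occupation_def
  by (intro set_integral_mono pairing_set_integrable pairing_mono assms) auto

lemma occupation_nonneg: "(\<And>y. 0 \<le> f y) \<Longrightarrow> 0 \<le> occupation t f \<omega>"
  unfolding occupation_def set_lebesgue_integral_def
  by (intro Bochner_Integration.integral_nonneg) (auto intro!: mult_nonneg_nonneg pairing_nonneg)

lemma occupation_cmult: "occupation t (\<lambda>y. c * f y) \<omega> = c * occupation t f \<omega>"
  unfolding occupation_def pairing_cmult by simp

lemma occupation_mono_time:
  assumes "f \<in> bcontfun" "\<And>y. 0 \<le> f y" "\<omega> \<in> space P" "s \<le> t"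
  shows "occupation s f \<omega> \<le> occupation t f \<omega>"
  unfolding occupation_def set_lebesgue_integral_def
proof (rule integral_mono)
  show "integrable lborel (\<lambda>r. indicat_real {0..s} r *\<^sub>R pairing r f \<omega>)"
    "integrable lborel (\<lambda>r. indicat_real {0..t} r *\<^sub>R pairing r f \<omega>)"
    using pairing_set_integrable[OF assms(1,3)] by (auto simp: set_integrable_def)
  show "indicat_real {0..s} r *\<^sub>R pairing r f \<omega> \<le> indicat_real {0..t} r *\<^sub>R pairing r f \<omega>" for r
    using assms(4) pairing_nonneg[OF assms(2)] by (auto simp: indicator_def)
qed

text \<open>Clamping time at zero extends the path continuously to the whole line; at negative times
  \<open>X\<close> is arbitrary.\<close>

lemma pairing_jointly_measurable:
  assumes "f \<in> bcontfun"
  shows "(\<lambda>(s, \<omega>). pairing (max 0 s) f \<omega>) \<in> borel_measurable (lborel \<Otimes>\<^sub>M P)"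
proof (rule borel_measurable_pair_continuous)
  show "pairing (max 0 s) f \<in> borel_measurable P" for s
    by (rule pairing_measurable) (use assms in auto)
  show "continuous_on UNIV (\<lambda>s. pairing (max 0 s) f \<omega>)" if "\<omega> \<in> space P" for \<omega>
    by (rule continuous_on_compose2[OF pairing_continuous[OF assms that]]) (auto intro!: continuous_intros)
qed

lemma nn_integral_occupation:
  assumes f: "f \<in> bcontfun" "\<And>y. 0 \<le> f y"
  shows "(\<integral>\<^sup>+\<omega>. ennreal (occupation t f \<omega>) \<partial>P) =
    (\<integral>\<^sup>+s\<in>{0..t}. (\<integral>\<^sup>+\<omega>. ennreal (pairing s f \<omega>) \<partial>P) \<partial>lborel)"
proof -
  interpret pair_sigma_finite lborel P ..
  have meas: "(\<lambda>(s, \<omega>). ennreal (pairing (max 0 s) f \<omega>) * indicator {0..t} s) \<in> borel_measurable (lborel \<Otimes>\<^sub>M P)"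
    using pairing_jointly_measurable[OF f(1)] by (simp add: split_beta)
  have "ennreal (occupation t f \<omega>) = (\<integral>\<^sup>+s. ennreal (pairing (max 0 s) f \<omega>) * indicator {0..t} s \<partial>lborel)"
    if "\<omega> \<in> space P" for \<omega>
  proof -
    have "ennreal (occupation t f \<omega>) = (\<integral>\<^sup>+s. ennreal (indicator {0..t} s *\<^sub>R pairing s f \<omega>) \<partial>lborel)"
      unfolding occupation_def set_lebesgue_integral_def
      by (rule nn_integral_eq_integral[symmetric])
         (use pairing_set_integrable[OF f(1) that] pairing_nonneg[OF f(2)] in \<open>auto simp: set_integrable_def\<close>)
    also have "\<dots> = (\<integral>\<^sup>+s. ennreal (pairing (max 0 s) f \<omega>) * indicator {0..t} s \<partial>lborel)"
      by (intro nn_integral_cong) (auto simp: indicator_def)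
    finally show ?thesis .
  qed
  then have "(\<integral>\<^sup>+\<omega>. ennreal (occupation t f \<omega>) \<partial>P) =
      (\<integral>\<^sup>+\<omega>. (\<integral>\<^sup>+s. ennreal (pairing (max 0 s) f \<omega>) * indicator {0..t} s \<partial>lborel) \<partial>P)"
    by (intro nn_integral_cong) simp
  also have "\<dots> = (\<integral>\<^sup>+s. (\<integral>\<^sup>+\<omega>. ennreal (pairing (max 0 s) f \<omega>) * indicator {0..t} s \<partial>P) \<partial>lborel)"
    using Fubini'[OF meas] by simp
  also have "\<dots> = (\<integral>\<^sup>+s\<in>{0..t}. (\<integral>\<^sup>+\<omega>. ennreal (pairing s f \<omega>) \<partial>P) \<partial>lborel)"
    by (intro nn_integral_cong) (auto simp: indicator_def)
  finally show ?thesis .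
qed

lemma occupation_measurable:
  assumes f: "f \<in> bcontfun"
  shows "occupation t f \<in> borel_measurable P"
proof -
  have "(\<lambda>\<omega>. \<integral>s. indicator {0..t} s *\<^sub>R pairing (max 0 s) f \<omega> \<partial>lborel) \<in> borel_measurable P"
  proof (rule lborel.borel_measurable_lebesgue_integral)
    have "(\<lambda>p. pairing (max 0 (snd p)) f (fst p)) \<in> borel_measurable (P \<Otimes>\<^sub>M lborel)"
      using measurable_compose[OF measurable_pair_swap' pairing_jointly_measurable[OF f]]
      by (simp add: split_beta')
    then show "(\<lambda>(\<omega>, s). indicator {0..t} s *\<^sub>R pairing (max 0 s) f \<omega>) \<in> borel_measurable (P \<Otimes>\<^sub>M lborel)"
      by (simp add: split_beta')
  qed
  moreover have "occupation t f = (\<lambda>\<omega>. \<integral>s. indicator {0..t} s *\<^sub>R pairing (max 0 s) f \<omega> \<partial>lborel)"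
    unfolding occupation_def[abs_def] set_lebesgue_integral_def
    by (intro ext Bochner_Integration.integral_cong) (auto simp: indicator_def)
  ultimately show ?thesis
    by simp
qed

text \<open>The martingale problem in moment form: the bracket becomes a bound on the second moment,
  which is what Chebyshev's inequality can use.\<close>

definition driving_martingale :: "('a \<Rightarrow> real) \<Rightarrow> (real \<Rightarrow> 'w \<Rightarrow> real) \<Rightarrow> bool" where
  "driving_martingale \<phi> Z \<longleftrightarrow> (\<forall>t\<ge>0. integrable P (Z t) \<and> integral\<^sup>L P (Z t) = 0 \<and>
    (\<integral>\<^sup>+\<omega>. ennreal ((Z t \<omega>)\<^sup>2) \<partial>P) \<le> (\<integral>\<^sup>+\<omega>. ennreal (occupation t (\<lambda>y. (\<phi> y)\<^sup>2) \<omega>) \<partial>P) \<and>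
    (\<forall>\<omega>\<in>space P. pairing t \<phi> \<omega> = pairing 0 \<phi> \<omega> + Z t \<omega> + occupation t (\<lambda>y. laplacian \<phi> y / 2) \<omega>))"

lemma driving_martingaleD:
  assumes "driving_martingale \<phi> Z" "0 \<le> t"
  shows "integrable P (Z t)" and "integral\<^sup>L P (Z t) = 0"
    and "(\<integral>\<^sup>+\<omega>. ennreal ((Z t \<omega>)\<^sup>2) \<partial>P) \<le> (\<integral>\<^sup>+\<omega>. ennreal (occupation t (\<lambda>y. (\<phi> y)\<^sup>2) \<omega>) \<partial>P)"
    and "\<omega> \<in> space P \<Longrightarrow>
      pairing t \<phi> \<omega> = pairing 0 \<phi> \<omega> + Z t \<omega> + occupation t (\<lambda>y. laplacian \<phi> y / 2) \<omega>"
  using assms unfolding driving_martingale_def by blast+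

lemma martingale_problem:
  assumes \<phi>: "\<phi> \<in> Cb2"
  shows "\<exists>Z. driving_martingale \<phi> Z"
proof -
  have "\<forall>\<phi>\<in>Cb2. \<exists>Z. martingale P F Z \<and> continuous_paths P Z \<and> (\<forall>\<omega>\<in>space P. Z 0 \<omega> = 0) \<and>
        (\<forall>\<omega>\<in>space P. \<forall>t\<ge>0. pairing t \<phi> \<omega> = pairing 0 \<phi> \<omega> + Z t \<omega> +
            occupation t (\<lambda>y. laplacian \<phi> y / 2) \<omega>) \<and>
        quadratic_variation P F Z (\<lambda>t \<omega>. occupation t (\<lambda>y. (\<phi> y)\<^sup>2) \<omega>)"
    using sbm unfolding super_brownian_motion_def pairing_def occupation_def by (elim conjE)
  with \<phi> obtain Z where mart: "martingale P F Z" and Z0: "\<And>\<omega>. \<omega> \<in> space P \<Longrightarrow> Z 0 \<omega> = 0"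
    and eq: "\<And>t \<omega>. 0 \<le> t \<Longrightarrow> \<omega> \<in> space P \<Longrightarrow>
      pairing t \<phi> \<omega> = pairing 0 \<phi> \<omega> + Z t \<omega> + occupation t (\<lambda>y. laplacian \<phi> y / 2) \<omega>"
    and qv: "quadratic_variation P F Z (\<lambda>t \<omega>. occupation t (\<lambda>y. (\<phi> y)\<^sup>2) \<omega>)"
    by blast
  show ?thesis
  unfolding driving_martingale_def
  proof (intro exI allI impI conjI ballI)
    fix t :: real assume t: "0 \<le> t"
    show "integrable P (Z t)"
      using mart t by (simp add: martingale_def)
    have "integral\<^sup>L P (Z 0) = (\<integral>\<omega>. 0 \<partial>P)"
      by (rule Bochner_Integration.integral_cong) (auto simp: Z0)
    then show "integral\<^sup>L P (Z t) = 0"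
      using martingale_integral[OF mart t] by simp
    show "(\<integral>\<^sup>+\<omega>. ennreal ((Z t \<omega>)\<^sup>2) \<partial>P) \<le> (\<integral>\<^sup>+\<omega>. ennreal (occupation t (\<lambda>y. (\<phi> y)\<^sup>2) \<omega>) \<partial>P)"
      by (rule quadratic_variation_bound[OF Z0 qv t])
  qed (rule eq)
qed

text \<open>The initial value equals \<mu> only almost surely, so \<open>pairing 0 \<phi>\<close> is
  a random variable that has to be replaced by its constant before taking means.\<close>

lemma initial_plus_martingale:
  assumes "\<phi> \<in> bcontfun" "integrable P Z" "integral\<^sup>L P Z = 0"
  shows "integrable P (\<lambda>\<omega>. pairing 0 \<phi> \<omega> + Z \<omega>)"
    and "(\<integral>\<omega>. pairing 0 \<phi> \<omega> + Z \<omega> \<partial>P) = integral\<^sup>L \<mu> \<phi>"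
proof -
  have ae: "AE \<omega> in P. integral\<^sup>L \<mu> \<phi> + Z \<omega> = pairing 0 \<phi> \<omega> + Z \<omega>"
    using pairing_initial[of \<phi>] by eventually_elim simp
  have meas: "(\<lambda>\<omega>. pairing 0 \<phi> \<omega> + Z \<omega>) \<in> borel_measurable P"
    using pairing_measurable[OF assms(1), of 0] assms(2) by auto
  show "integrable P (\<lambda>\<omega>. pairing 0 \<phi> \<omega> + Z \<omega>)"
    by (rule integrable_cong_AE_imp[OF _ meas ae]) (use assms in auto)
  have "(\<integral>\<omega>. pairing 0 \<phi> \<omega> + Z \<omega> \<partial>P) = (\<integral>\<omega>. integral\<^sup>L \<mu> \<phi> + Z \<omega> \<partial>P)"
    by (rule integral_cong_AE[symmetric]) (use ae meas assms in auto)
  then show "(\<integral>\<omega>. pairing 0 \<phi> \<omega> + Z \<omega> \<partial>P) = integral\<^sup>L \<mu> \<phi>"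
    using assms by (simp add: prob_space)
qed

text \<open>The decomposition puts \<open>pairing t \<phi> + occupation t g\<close> below the
  initial pairing plus the martingale. Both summands are nonnegative, so each is dominated by an
  integrable variable, and taking means removes the martingale. This substitutes for explicit
  first-moment formulas.\<close>

lemma
  assumes \<phi>: "\<phi> \<in> Cb2" "\<And>y. 0 \<le> \<phi> y" and g: "g \<in> bcontfun" "\<And>y. 0 \<le> g y"
    and super: "\<And>y. laplacian \<phi> y / 2 \<le> - g y" and t: "0 \<le> t"
  shows pairing_integrable: "integrable P (pairing t \<phi>)"
    and occupation_integrable: "integrable P (occupation t g)"
    and superharmonic_bound: "integral\<^sup>L P (pairing t \<phi>) + integral\<^sup>L P (occupation t g) \<le> integral\<^sup>L \<mu> \<phi>"
proof -
  note \<phi>_cont = Cb2_imp_bcontfun[OF \<phi>(1)]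
  obtain Z where "driving_martingale \<phi> Z"
    using martingale_problem[OF \<phi>(1)] ..
  note Z = driving_martingaleD(1,2)[OF this] and eq = driving_martingaleD(4)[OF this]
  note R = initial_plus_martingale[OF \<phi>_cont(1) Z[OF t]]
  have half: "(\<lambda>y. laplacian \<phi> y / 2) \<in> bcontfun"
    using bcontfun_cmult[OF \<phi>_cont(2), of "1 / 2"] by simp
  have sum: "pairing t \<phi> \<omega> + occupation t g \<omega> \<le> pairing 0 \<phi> \<omega> + Z t \<omega>" if "\<omega> \<in> space P" for \<omega>
  proof -
    have "occupation t (\<lambda>y. laplacian \<phi> y / 2) \<omega> \<le> occupation t (\<lambda>y. - 1 * g y) \<omega>"
      by (intro occupation_mono half bcontfun_cmult g that) (use super in simp)
    then show ?thesis
      unfolding occupation_cmult using eq[OF t that] by simp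
  qed
  have nonneg: "0 \<le> pairing t \<phi> \<omega>" "0 \<le> occupation t g \<omega>" for \<omega>
    using pairing_nonneg[OF \<phi>(2)] occupation_nonneg[OF g(2)] by auto
  show int1: "integrable P (pairing t \<phi>)"
  proof (rule Bochner_Integration.integrable_bound[OF R(1)])
    show "pairing t \<phi> \<in> borel_measurable P"
      by (rule pairing_measurable[OF \<phi>_cont(1) t])
    show "AE \<omega> in P. norm (pairing t \<phi> \<omega>) \<le> norm (pairing 0 \<phi> \<omega> + Z t \<omega>)"
      using sum nonneg by (intro AE_I2) (smt (verit) real_norm_def)
  qed
  show int2: "integrable P (occupation t g)"
  proof (rule Bochner_Integration.integrable_bound[OF R(1)])
    show "occupation t g \<in> borel_measurable P"
      by (rule occupation_measurable[OF g(1)])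
    show "AE \<omega> in P. norm (occupation t g \<omega>) \<le> norm (pairing 0 \<phi> \<omega> + Z t \<omega>)"
      using sum nonneg by (intro AE_I2) (smt (verit) real_norm_def)
  qed
  have "integral\<^sup>L P (pairing t \<phi>) + integral\<^sup>L P (occupation t g) = (\<integral>\<omega>. pairing t \<phi> \<omega> + occupation t g \<omega> \<partial>P)"
    using int1 int2 by simp
  also have "\<dots> \<le> (\<integral>\<omega>. pairing 0 \<phi> \<omega> + Z t \<omega> \<partial>P)"
    by (rule integral_mono) (use int1 int2 R(1) sum in auto)
  finally show "integral\<^sup>L P (pairing t \<phi>) + integral\<^sup>L P (occupation t g) \<le> integral\<^sup>L \<mu> \<phi>"
    using R(2) by simp
qed

lemma zero_in_bcontfun: "(\<lambda>_::'a. 0::real) \<in> bcontfun"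
  by (rule const_bcontfun)

text \<open>With \<open>h\<close> exactly minus half the Laplacian, the superharmonic bound becomes
  an identity: the mean at time t is the initial value minus the expected occupation of
  \<open>h\<close>, which grows with t.\<close>

lemma pairing_antimono_time:
  assumes \<phi>: "\<phi> \<in> Cb2" "\<And>y. 0 \<le> \<phi> y" and super: "\<And>y. laplacian \<phi> y \<le> 0"
    and st: "0 \<le> s" "s \<le> t"
  shows "integral\<^sup>L P (pairing t \<phi>) \<le> integral\<^sup>L P (pairing s \<phi>)"
proof -
  note \<phi>_cont = Cb2_imp_bcontfun[OF \<phi>(1)]
  define h where "h = (\<lambda>y. - 1 / 2 * laplacian \<phi> y)"
  have h: "h \<in> bcontfun" "\<And>y. 0 \<le> h y"
    using bcontfun_cmult[OF \<phi>_cont(2), of "- 1 / 2"] super by (auto simp: h_def)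
  obtain Z where "driving_martingale \<phi> Z"
    using martingale_problem[OF \<phi>(1)] ..
  note Z = driving_martingaleD(1,2)[OF this] and eq = driving_martingaleD(4)[OF this]
  have "occupation t (\<lambda>y. laplacian \<phi> y / 2) \<omega> = - occupation t h \<omega>" for t \<omega>
    using occupation_cmult[of t "- 1" h \<omega>] by (simp add: h_def)
  then have eq': "pairing t \<phi> \<omega> + occupation t h \<omega> = pairing 0 \<phi> \<omega> + Z t \<omega>" if "0 \<le> t" "\<omega> \<in> space P" for t \<omega>
    using eq[OF that] by simp
  have occ_int: "integrable P (occupation t h)" if "0 \<le> t" for t
    by (rule occupation_integrable[OF \<phi> h _ that]) (simp add: h_def)
  have pair_int: "integrable P (pairing t \<phi>)" if "0 \<le> t" for t
    by (rule pairing_integrable[OF \<phi> h _ that]) (simp add: h_def)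
  have id: "integral\<^sup>L P (pairing t \<phi>) = integral\<^sup>L \<mu> \<phi> - integral\<^sup>L P (occupation t h)" if t: "0 \<le> t" for t
  proof -
    have "integral\<^sup>L P (pairing t \<phi>) + integral\<^sup>L P (occupation t h) = (\<integral>\<omega>. pairing t \<phi> \<omega> + occupation t h \<omega> \<partial>P)"
      using occ_int[OF t] pair_int[OF t] by simp
    also have "\<dots> = (\<integral>\<omega>. pairing 0 \<phi> \<omega> + Z t \<omega> \<partial>P)"
      by (rule Bochner_Integration.integral_cong) (use eq' t in auto)
    finally show ?thesis
      using initial_plus_martingale(2)[OF \<phi>_cont(1) Z(1,2)[OF t]] by simp
  qed
  have "integral\<^sup>L P (occupation s h) \<le> integral\<^sup>L P (occupation t h)"
    by (rule integral_mono) (use occ_int st occupation_mono_time[OF h] in auto)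
  then show ?thesis
    using id st by simp
qed

text \<open>A decreasing function is at most its average over the past. A fixed-time mean is thereby
  traded for an occupation integral, at the price of a factor 1/t.\<close>

lemma time_times_pairing_le:
  assumes \<phi>: "\<phi> \<in> Cb2" "\<And>y. 0 \<le> \<phi> y" and super: "\<And>y. laplacian \<phi> y \<le> 0" and t: "0 \<le> t"
  shows "ennreal (t * integral\<^sup>L P (pairing t \<phi>)) \<le> (\<integral>\<^sup>+\<omega>. ennreal (occupation t \<phi> \<omega>) \<partial>P)"
proof -
  note \<phi>_cont = Cb2_imp_bcontfun[OF \<phi>(1)]
  have pair_nn: "(\<integral>\<^sup>+\<omega>. ennreal (pairing s \<phi> \<omega>) \<partial>P) = ennreal (integral\<^sup>L P (pairing s \<phi>))" if "0 \<le> s" for s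
    by (rule nn_integral_eq_integral)
       (use pairing_integrable[OF \<phi> zero_in_bcontfun _ _ that] super pairing_nonneg[OF \<phi>(2)] in auto)
  have "0 \<le> integral\<^sup>L P (pairing t \<phi>)"
    by (intro Bochner_Integration.integral_nonneg pairing_nonneg \<phi>)
  then have "ennreal (t * integral\<^sup>L P (pairing t \<phi>)) = (\<integral>\<^sup>+s\<in>{0..t}. ennreal (integral\<^sup>L P (pairing t \<phi>)) \<partial>lborel)"
    using t by (subst nn_integral_cmult_indicator) (auto simp: ennreal_mult' mult.commute)
  also have "\<dots> \<le> (\<integral>\<^sup>+s\<in>{0..t}. (\<integral>\<^sup>+\<omega>. ennreal (pairing s \<phi> \<omega>) \<partial>P) \<partial>lborel)"
    by (intro nn_integral_mono)
       (auto simp: indicator_def pair_nn intro!: ennreal_leI pairing_antimono_time \<phi> super)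
  finally show ?thesis
    using nn_integral_occupation[OF \<phi>_cont(1) \<phi>(2)] by simp
qed

text \<open>The constant 1 is harmonic, so the mean total mass never exceeds that of \<mu>.\<close>

lemma nn_integral_occupation_one:
  assumes "0 \<le> t"
  shows "(\<integral>\<^sup>+\<omega>. ennreal (occupation t (\<lambda>_. 1) \<omega>) \<partial>P) \<le> ennreal (t * measure \<mu> (space \<mu>))"
proof -
  have one: "(\<lambda>_::'a. 1::real) \<in> Cb2" and one_cont: "(\<lambda>_::'a. 1::real) \<in> bcontfun"
    by (rule const_in_Cb2 const_bcontfun)+
  have "(\<integral>\<^sup>+\<omega>. ennreal (pairing s (\<lambda>_. 1) \<omega>) \<partial>P) \<le> ennreal (measure \<mu> (space \<mu>))" if s: "0 \<le> s" for s
  proof -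
    have "integral\<^sup>L P (pairing s (\<lambda>_. 1)) + integral\<^sup>L P (occupation s (\<lambda>_. 0)) \<le> integral\<^sup>L \<mu> (\<lambda>_. 1)"
      by (rule superharmonic_bound[OF one _ zero_in_bcontfun _ _ s]) (simp_all add: laplacian_const)
    moreover have "integral\<^sup>L P (occupation s (\<lambda>_. 0)) = 0"
      by (simp add: occupation_def[abs_def] pairing_def)
    moreover have "(\<integral>\<^sup>+\<omega>. ennreal (pairing s (\<lambda>_. 1) \<omega>) \<partial>P) = ennreal (integral\<^sup>L P (pairing s (\<lambda>_. 1)))"
      by (rule nn_integral_eq_integral)
         (use pairing_integrable[OF one _ zero_in_bcontfun _ _ s] pairing_nonneg in \<open>auto simp: laplacian_const\<close>)
    ultimately show ?thesis
      by (auto intro!: ennreal_leI)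
  qed
  then have "(\<integral>\<^sup>+s\<in>{0..t}. (\<integral>\<^sup>+\<omega>. ennreal (pairing s (\<lambda>_. 1) \<omega>) \<partial>P) \<partial>lborel) \<le>
      (\<integral>\<^sup>+s\<in>{0..t}. ennreal (measure \<mu> (space \<mu>)) \<partial>lborel)"
    by (intro nn_integral_mono) (auto simp: indicator_def)
  also have "\<dots> = ennreal (t * measure \<mu> (space \<mu>))"
    using assms by (subst nn_integral_cmult_indicator) (auto simp: ennreal_mult' mult.commute)
  finally show ?thesis
    using nn_integral_occupation[OF one_cont] by simp
qed

end

section \<open>Second-moment estimates\<close>

text \<open>The power acts on the squared distance r^2: p = -1/2 is the Newtonian kernel 1/r, p =
  -1/4 the test function r powr (-1/2), and p = -5/4 the order r powr (-5/2) of its Laplacian, all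
  smoothed at scale 1/b.\<close>

abbreviation smoothed_power :: "real \<Rightarrow> real \<Rightarrow> real ^ 3 \<Rightarrow> real ^ 3 \<Rightarrow> real" where
  "smoothed_power p b x \<equiv> \<lambda>y. (1 / b\<^sup>2 + (norm (y - x))\<^sup>2) powr p"

lemma smoothed_pos: "0 < b \<Longrightarrow> 0 < 1 / b\<^sup>2 + (norm z)\<^sup>2" for b :: real
  by (simp add: add_pos_nonneg)

lemma smoothed_power_bcontfun:
  assumes "0 < b" "p \<le> 0"
  shows "smoothed_power p b x \<in> bcontfun"
proof (rule bcontfun_normI)
  show "continuous_on UNIV (smoothed_power p b x)"
    by (intro continuous_intros) (use assms in \<open>auto simp: add_nonneg_eq_0_iff\<close>)
  show "norm (smoothed_power p b x y) \<le> (1 / b\<^sup>2) powr p" for y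
    using assms by (auto intro!: powr_mono2')
qed

definition green_const :: real where
  "green_const = 2 / (2 * pi) powr (3 / 2)"

lemma green_const_bounds: "0 < green_const" "green_const \<le> 1"
proof -
  show "0 < green_const"
    by (simp add: green_const_def)
  have "2 \<le> (2 * pi) powr 1"
    using pi_gt3 by simp
  also have "\<dots> \<le> (2 * pi) powr (3 / 2)"
    using pi_gt3 by (intro powr_mono) auto
  finally show "green_const \<le> 1"
    by (simp add: green_const_def divide_le_eq)
qed

lemma powr_le_one_plus:
  assumes "0 < (u::real)" "q \<le> p" "p \<le> 0"
  shows "u powr p \<le> u powr q + 1"
proof (cases "u \<le> 1")
  case True
  then have "u powr p \<le> u powr q"
    using assms by (intro powr_mono') auto
  then show ?thesis by simp
next
  case False
  then have "u powr p \<le> u powr 0"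
    using assms by (intro powr_mono) auto
  then show ?thesis
    using assms(1) by (simp add: add_increasing)
qed

lemma green_upper:
  assumes "0 < b"
  shows "green 0 b x y \<le> 8 * smoothed_power (- 1 / 2) b x y"
proof -
  have "green 0 b x y \<le> 1 * gauss_moment 0 0 b ((norm (y - x))\<^sup>2)"
    unfolding green_def green_const_def[symmetric]
    by (intro mult_right_mono green_const_bounds gauss_moment_nonneg) auto
  also have "\<dots> \<le> 8 / sqrt (1 / b\<^sup>2 + (norm (y - x))\<^sup>2)"
    using gauss_moment_upper[OF assms] by simp
  also have "\<dots> = 8 * smoothed_power (- 1 / 2) b x y"
    using smoothed_pos[OF assms, of "y - x"] by (simp add: powr_minus_divide powr_half_sqrt)
  finally show ?thesis .
qed

lemma green_lower:
  assumes "0 < b"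
  shows "green_const / 2 * smoothed_power (- 1 / 2) b x y \<le> green 0 b x y"
proof -
  have "green_const * (1 / (2 * sqrt (1 / b\<^sup>2 + (norm (y - x))\<^sup>2))) \<le> green 0 b x y"
    unfolding green_def green_const_def[symmetric]
    using green_const_bounds by (intro mult_left_mono gauss_moment_lower assms) auto
  then show ?thesis
    using smoothed_pos[OF assms, of "y - x"] by (simp add: powr_minus_divide powr_half_sqrt)
qed

text \<open>The square is of order -1 in r^2. Near the singularity the stronger power -5/4 dominates
  it, and far away it is bounded, whence the summand 1.\<close>

lemma green_power2_upper:
  assumes "0 < b"
  shows "(green 0 b x y)\<^sup>2 \<le> 64 * (smoothed_power (- 5 / 4) b x y + 1)"
proof -
  note u = smoothed_pos[OF assms, of "y - x"]
  have "(green 0 b x y)\<^sup>2 \<le> (8 * smoothed_power (- 1 / 2) b x y)\<^sup>2"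
    by (intro power_mono green_upper assms green_nonneg) simp
  also have "\<dots> = 64 * smoothed_power (- 1) b x y"
    using u by (simp add: power_mult_distrib power2_eq_square flip: powr_add)
  also have "\<dots> \<le> 64 * (smoothed_power (- 5 / 4) b x y + 1)"
    using powr_le_one_plus[OF u, of "- 5 / 4" "- 1"] by simp
  finally show ?thesis .
qed

text \<open>Here the exponent -5/8 doubles to -5/4 exactly, so no additive constant appears and the
  whole bound carries the decay in a.\<close>

lemma green_tail_power2:
  assumes "0 < a" "a \<le> b"
  shows "(green a b x y)\<^sup>2 \<le> 256 * a powr (- 1 / 2) * smoothed_power (- 5 / 4) b x y"
proof -
  have b: "0 < b" using assms by simp
  have "green a b x y \<le> 1 * gauss_moment 0 a b ((norm (y - x))\<^sup>2)"
    unfolding green_def green_const_def[symmetric]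
    using assms by (intro mult_right_mono green_const_bounds gauss_moment_nonneg) auto
  also have "\<dots> \<le> 16 * a powr (- 1 / 4) * smoothed_power (- 5 / 8) b x y"
    using gauss_moment_tail[OF assms] by simp
  finally have "(green a b x y)\<^sup>2 \<le> (16 * a powr (- 1 / 4) * smoothed_power (- 5 / 8) b x y)\<^sup>2"
    using assms by (intro power_mono green_nonneg) auto
  also have "\<dots> = 256 * (a powr (- 1 / 4) * a powr (- 1 / 4)) * (smoothed_power (- 5 / 8) b x y * smoothed_power (- 5 / 8) b x y)"
    by (simp add: power2_eq_square)
  also have "\<dots> = 256 * a powr (- 1 / 2) * smoothed_power (- 5 / 4) b x y"
    by (simp flip: powr_add)
  finally show ?thesis .
qed

lemma nn_integral_le_imp_integrable:
  fixes f :: "'b \<Rightarrow> real"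
  assumes "f \<in> borel_measurable M" "\<And>x. 0 \<le> f x" "(\<integral>\<^sup>+x. ennreal (f x) \<partial>M) \<le> ennreal C" "0 \<le> C"
  shows "integrable M f" and "integral\<^sup>L M f \<le> C"
proof -
  show int: "integrable M f"
    by (rule integrableI_nonneg) (use assms in \<open>auto intro: le_less_trans\<close>)
  have "ennreal (integral\<^sup>L M f) \<le> ennreal C"
    using nn_integral_eq_integral[OF int] assms by simp
  then show "integral\<^sup>L M f \<le> C"
    using assms(4) by simp
qed

section \<open>Moment bounds in dimension three\<close>

locale sbm3 = sbm P F X \<mu> for P :: "'w measure" and F :: "real \<Rightarrow> 'w measure"
  and X :: "real \<Rightarrow> 'w \<Rightarrow> (real ^ 3) measure" and \<mu> :: "(real ^ 3) measure"
begin

definition energy :: "real \<Rightarrow> real \<Rightarrow> real ^ 3 \<Rightarrow> real" where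
  "energy p b x = integral\<^sup>L \<mu> (smoothed_power p b x)"

abbreviation "total_mass \<equiv> measure \<mu> (space \<mu>)"

lemma energy_nonneg: "0 \<le> energy p b x"
  unfolding energy_def by (intro Bochner_Integration.integral_nonneg) auto

lemma green_bcontfun: "0 \<le> a \<Longrightarrow> a \<le> b \<Longrightarrow> green a b x \<in> bcontfun"
  by (rule Cb2_imp_bcontfun(1)[OF green_in_Cb2])

text \<open>Cauchy-Schwarz in the parametric form s \<le> h s^2 + 1/h. With h = 1 it yields
  boundedness at regular points; with h the inverse root of \<open>energy (- 1 / 2) b x\<close> it
  yields growth of lower order near singular ones.\<close>

lemma energy_quarter_le:
  assumes "0 < b" "0 < h"
  shows "energy (- 1 / 4) b x \<le> h * energy (- 1 / 2) b x + total_mass / h"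
proof -
  have "smoothed_power (- 1 / 4) b x y \<le> h * smoothed_power (- 1 / 2) b x y + 1 / h" for y
  proof -
    define s where "s = smoothed_power (- 1 / 4) b x y"
    have s2: "smoothed_power (- 1 / 2) b x y = s\<^sup>2"
      by (simp add: s_def power2_eq_square flip: powr_add)
    have "2 * (h * s) \<le> (h * s)\<^sup>2 + 1"
      using sum_squares_bound[of "h * s" 1] by simp
    moreover have "0 \<le> (h * s)\<^sup>2"
      by simp
    ultimately have "h * s \<le> (h * s)\<^sup>2 + 1"
      by linarith
    then have "s \<le> ((h * s)\<^sup>2 + 1) / h"
      using assms(2) by (simp add: field_simps)
    also have "\<dots> = h * s\<^sup>2 + 1 / h"
      using assms(2) by (simp add: power_mult_distrib add_divide_distrib power2_eq_square)
    finally show ?thesis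
      unfolding s2 s_def[symmetric] .
  qed
  then have "energy (- 1 / 4) b x \<le> (\<integral>y. h * smoothed_power (- 1 / 2) b x y + 1 / h \<partial>\<mu>)"
    unfolding energy_def using assms
    by (intro integral_mono Bochner_Integration.integrable_add integrable_mult_right initial_integrable
        smoothed_power_bcontfun const_bcontfun) auto
  also have "\<dots> = h * energy (- 1 / 2) b x + total_mass / h"
    unfolding energy_def
    using initial_integrable[OF smoothed_power_bcontfun[OF assms(1), of "- 1 / 2" x]]
      initial_integrable[OF const_bcontfun[of "1 / h"]] by simp
  finally show ?thesis .
qed

text \<open>Half the Laplacian of the smoothed root is at most -1/8 of the singular kernel, so
  \<open>superharmonic_bound\<close> applies with that multiple as \<open>g\<close>. The resulting
  bound is uniform in t.\<close>

lemma occupation_singular: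
  assumes b: "0 < b" and t: "0 \<le> t"
  shows "(\<integral>\<^sup>+\<omega>. ennreal (occupation t (smoothed_power (- 5 / 4) b x) \<omega>) \<partial>P) \<le> ennreal (8 * energy (- 1 / 4) b x)"
proof -
  let ?g = "\<lambda>y. 1 / 8 * smoothed_power (- 5 / 4) b x y"
  have e: "0 < 1 / b\<^sup>2" using b by simp
  note root = smoothed_root_in_Cb2[OF e, of x]
  have g: "?g \<in> bcontfun"
    by (intro bcontfun_cmult smoothed_power_bcontfun) (use b in auto)
  have lap: "laplacian (smoothed_power (- 1 / 4) b x) y / 2 \<le> - ?g y" for y
    using laplacian_smoothed_root[OF e, of x y] by simp
  have int: "integrable P (occupation t ?g)"
    by (rule occupation_integrable[OF root _ g _ lap t]) auto
  have "integral\<^sup>L P (pairing t (smoothed_power (- 1 / 4) b x)) + integral\<^sup>L P (occupation t ?g) \<le> energy (- 1 / 4) b x"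
    unfolding energy_def by (rule superharmonic_bound[OF root _ g _ lap t]) auto
  moreover have "0 \<le> integral\<^sup>L P (pairing t (smoothed_power (- 1 / 4) b x))"
    by (intro Bochner_Integration.integral_nonneg pairing_nonneg) auto
  ultimately have le: "integral\<^sup>L P (occupation t ?g) \<le> energy (- 1 / 4) b x"
    by linarith
  have "(\<integral>\<^sup>+\<omega>. ennreal (occupation t (smoothed_power (- 5 / 4) b x) \<omega>) \<partial>P) =
      (\<integral>\<^sup>+\<omega>. ennreal (8 * occupation t ?g \<omega>) \<partial>P)"
    by (simp only: occupation_cmult) simp
  also have "\<dots> = ennreal (\<integral>\<omega>. 8 * occupation t ?g \<omega> \<partial>P)"
    by (rule nn_integral_eq_integral) (use int occupation_nonneg[of ?g] in auto)
  also have "\<dots> \<le> ennreal (8 * energy (- 1 / 4) b x)"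
    using le by (intro ennreal_leI) simp
  finally show ?thesis .
qed

lemma occupation_add:
  assumes "f \<in> bcontfun" "g \<in> bcontfun" "\<omega> \<in> space P"
  shows "occupation t (\<lambda>y. f y + g y) \<omega> = occupation t f \<omega> + occupation t g \<omega>"
proof -
  have "occupation t (\<lambda>y. f y + g y) \<omega> = (LBINT s:{0..t}. pairing s f \<omega> + pairing s g \<omega>)"
    unfolding occupation_def
    by (rule set_lebesgue_integral_cong)
       (use X_integrable assms in \<open>auto simp: pairing_def\<close>)
  also have "\<dots> = occupation t f \<omega> + occupation t g \<omega>"
    unfolding occupation_def by (rule set_integral_add; rule pairing_set_integrable) (use assms in auto)
  finally show ?thesis .
qed

lemma occupation_bound:
  assumes b: "0 < b" and t: "0 \<le> t" and c: "0 \<le> c" and f: "f \<in> bcontfun"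
    and le: "\<And>y. f y \<le> c * (smoothed_power (- 5 / 4) b x y + 1)"
  shows "(\<integral>\<^sup>+\<omega>. ennreal (occupation t f \<omega>) \<partial>P) \<le> ennreal (c * (8 * energy (- 1 / 4) b x + t * total_mass))"
proof -
  let ?s = "smoothed_power (- 5 / 4) b x"
  have s: "?s \<in> bcontfun" and one: "(\<lambda>_::real ^ 3. 1::real) \<in> bcontfun"
    using b by (auto intro: smoothed_power_bcontfun const_bcontfun)
  have sum: "(\<lambda>y. ?s y + 1) \<in> bcontfun"
    using s by (rule plus_cont[OF _ one])
  have nonneg: "0 \<le> occupation t ?s \<omega>" "0 \<le> occupation t (\<lambda>_. 1) \<omega>" for \<omega>
    by (auto intro!: occupation_nonneg)
  have "ennreal (occupation t f \<omega>) \<le> ennreal c * (ennreal (occupation t ?s \<omega>) + ennreal (occupation t (\<lambda>_. 1) \<omega>))"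
    if \<omega>: "\<omega> \<in> space P" for \<omega>
  proof -
    have "occupation t f \<omega> \<le> occupation t (\<lambda>y. c * (?s y + 1)) \<omega>"
      by (intro occupation_mono f bcontfun_cmult sum le \<omega>)
    also have "\<dots> = c * (occupation t ?s \<omega> + occupation t (\<lambda>_. 1) \<omega>)"
      unfolding occupation_cmult occupation_add[OF s one \<omega>] ..
    finally show ?thesis
      using c nonneg by (simp flip: ennreal_mult' ennreal_plus add: ennreal_leI)
  qed
  then have "(\<integral>\<^sup>+\<omega>. ennreal (occupation t f \<omega>) \<partial>P) \<le>
      (\<integral>\<^sup>+\<omega>. ennreal c * (ennreal (occupation t ?s \<omega>) + ennreal (occupation t (\<lambda>_. 1) \<omega>)) \<partial>P)"
    by (rule nn_integral_mono)
  also have "\<dots> = ennreal c * ((\<integral>\<^sup>+\<omega>. ennreal (occupation t ?s \<omega>) \<partial>P) + (\<integral>\<^sup>+\<omega>. ennreal (occupation t (\<lambda>_. 1) \<omega>) \<partial>P))"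
    using occupation_measurable[OF s, of t] occupation_measurable[OF one, of t]
    by (simp add: nn_integral_cmult nn_integral_add)
  also have "\<dots> \<le> ennreal c * (ennreal (8 * energy (- 1 / 4) b x) + ennreal (t * total_mass))"
    by (intro mult_left_mono add_mono occupation_singular nn_integral_occupation_one b t) auto
  also have "\<dots> = ennreal (c * (8 * energy (- 1 / 4) b x + t * total_mass))"
    using c t energy_nonneg by (simp add: ennreal_mult' ennreal_plus)
  finally show ?thesis .
qed

lemma laplacian_green_nonpos: "0 < b \<Longrightarrow> laplacian (green 0 b x) y \<le> 0"
  using half_laplacian_green[of b x y] by (simp add: heat_kernel_def)

lemma heat_kernel_bcontfun:
  assumes "0 < b"
  shows "(\<lambda>y. heat_kernel (1 / b\<^sup>2) (y - x :: real ^ 3)) \<in> bcontfun"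
proof -
  have "laplacian (green 0 b x) \<in> bcontfun"
    using assms by (intro Cb2_imp_bcontfun(2) green_in_Cb2) auto
  from bcontfun_cmult[OF this, of "- 1 / 2"] show ?thesis
    using half_laplacian_green[OF assms, of x] by (simp add: field_simps)
qed

lemma green_pairing_integrable:
  assumes "0 < b" "0 \<le> t"
  shows "integrable P (pairing t (green 0 b x))"
  by (rule pairing_integrable[OF green_in_Cb2 _ zero_in_bcontfun _ _ assms(2)])
     (use assms laplacian_green_nonpos green_nonneg in auto)

lemma green_pairing_le_initial:
  assumes "0 < b" "0 \<le> t"
  shows "integral\<^sup>L P (pairing t (green 0 b x)) \<le> integral\<^sup>L \<mu> (green 0 b x)"
proof -
  have "integral\<^sup>L P (pairing t (green 0 b x)) + integral\<^sup>L P (occupation t (\<lambda>_. 0)) \<le> integral\<^sup>L \<mu> (green 0 b x)"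
    by (rule superharmonic_bound[OF green_in_Cb2 _ zero_in_bcontfun _ _ assms(2)])
       (use assms laplacian_green_nonpos green_nonneg in auto)
  moreover have "integral\<^sup>L P (occupation t (\<lambda>_. 0)) = 0"
    by (simp add: occupation_def[abs_def] pairing_def)
  ultimately show ?thesis by simp
qed

text \<open>\<open>green_pairing_le_initial\<close> bounds the mean by the potential itself, which
  is useless for comparison with it. Averaging over time brings the bound down to the order of the
  weaker energy with exponent -1/4.\<close>

lemma green_pairing_bound:
  assumes b: "0 < b" and t: "0 < t"
  shows "t * integral\<^sup>L P (pairing t (green 0 b x)) \<le> 8 * (8 * energy (- 1 / 4) b x + t * total_mass)"
proof -
  have "ennreal (t * integral\<^sup>L P (pairing t (green 0 b x))) \<le> (\<integral>\<^sup>+\<omega>. ennreal (occupation t (green 0 b x) \<omega>) \<partial>P)"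
    by (rule time_times_pairing_le) (use b t green_in_Cb2 green_nonneg laplacian_green_nonpos in auto)
  also have "\<dots> \<le> ennreal (8 * (8 * energy (- 1 / 4) b x + t * total_mass))"
  proof (rule occupation_bound)
    fix y
    have "green 0 b x y \<le> 8 * smoothed_power (- 1 / 2) b x y"
      by (rule green_upper[OF b])
    also have "\<dots> \<le> 8 * (smoothed_power (- 5 / 4) b x y + 1)"
      using powr_le_one_plus[OF smoothed_pos[OF b, of "y - x"], of "- 5 / 4" "- 1 / 2"] by simp
    finally show "green 0 b x y \<le> 8 * (smoothed_power (- 5 / 4) b x y + 1)" .
  qed (use b t in \<open>auto intro!: green_bcontfun\<close>)
  finally show ?thesis
    by (rule ennreal_le_iff[THEN iffD1, rotated]) (use energy_nonneg t in auto)
qed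

lemma driving_martingale_power2:
  assumes Z: "driving_martingale \<phi> Z" and t: "0 \<le> t" and C: "0 \<le> C"
    and le: "(\<integral>\<^sup>+\<omega>. ennreal (occupation t (\<lambda>y. (\<phi> y)\<^sup>2) \<omega>) \<partial>P) \<le> ennreal C"
  shows "integrable P (\<lambda>\<omega>. (Z t \<omega>)\<^sup>2)" and "(\<integral>\<omega>. (Z t \<omega>)\<^sup>2 \<partial>P) \<le> C"
  using nn_integral_le_imp_integrable[of "\<lambda>\<omega>. (Z t \<omega>)\<^sup>2" P C] driving_martingaleD[OF Z t] C le
  by (auto intro: order_trans)

lemma green_martingale_power2:
  assumes Z: "driving_martingale (green 0 b x) Z" and b: "0 < b" and t: "0 \<le> t"
  shows "integrable P (\<lambda>\<omega>. (Z t \<omega>)\<^sup>2)"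
    and "(\<integral>\<omega>. (Z t \<omega>)\<^sup>2 \<partial>P) \<le> 64 * (8 * energy (- 1 / 4) b x + t * total_mass)"
proof -
  have "(\<integral>\<^sup>+\<omega>. ennreal (occupation t (\<lambda>y. (green 0 b x y)\<^sup>2) \<omega>) \<partial>P) \<le>
      ennreal (64 * (8 * energy (- 1 / 4) b x + t * total_mass))"
  proof (rule occupation_bound[OF b t])
    show "(\<lambda>y. (green 0 b x y)\<^sup>2) \<in> bcontfun"
      using b by (intro bcontfun_power2 green_bcontfun) auto
  qed (simp, rule green_power2_upper[OF b])
  from driving_martingale_power2[OF Z t _ this]
  show "integrable P (\<lambda>\<omega>. (Z t \<omega>)\<^sup>2)" "(\<integral>\<omega>. (Z t \<omega>)\<^sup>2 \<partial>P) \<le> 64 * (8 * energy (- 1 / 4) b x + t * total_mass)"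
    using energy_nonneg t by auto
qed

text \<open>The variance contributed by scales finer than 1/a vanishes as a grows as long as the
  energy stays bounded. The 2048 is 256 from \<open>green_tail_power2\<close> times 8 from
  \<open>occupation_singular\<close>.\<close>

lemma green_tail_martingale_power2:
  assumes Z: "driving_martingale (green a b x) Z" and a: "0 < a" "a \<le> b" and t: "0 \<le> t"
  shows "integrable P (\<lambda>\<omega>. (Z t \<omega>)\<^sup>2)"
    and "(\<integral>\<omega>. (Z t \<omega>)\<^sup>2 \<partial>P) \<le> 2048 * a powr (- 1 / 2) * energy (- 1 / 4) b x"
proof -
  have b: "0 < b" using a by simp
  let ?c = "256 * a powr (- 1 / 2)"
  let ?s = "smoothed_power (- 5 / 4) b x"
  have s: "?s \<in> bcontfun"
    using b by (auto intro: smoothed_power_bcontfun)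
  have "(\<integral>\<^sup>+\<omega>. ennreal (occupation t (\<lambda>y. (green a b x y)\<^sup>2) \<omega>) \<partial>P) \<le>
      (\<integral>\<^sup>+\<omega>. ennreal ?c * ennreal (occupation t ?s \<omega>) \<partial>P)"
  proof (rule nn_integral_mono)
    fix \<omega> assume \<omega>: "\<omega> \<in> space P"
    have "occupation t (\<lambda>y. (green a b x y)\<^sup>2) \<omega> \<le> occupation t (\<lambda>y. ?c * ?s y) \<omega>"
      using a s \<omega> green_tail_power2[OF a]
      by (intro occupation_mono bcontfun_power2 green_bcontfun bcontfun_cmult) auto
    then show "ennreal (occupation t (\<lambda>y. (green a b x y)\<^sup>2) \<omega>) \<le> ennreal ?c * ennreal (occupation t ?s \<omega>)"
      unfolding occupation_cmult by (simp flip: ennreal_mult' add: ennreal_leI)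
  qed
  also have "\<dots> = ennreal ?c * (\<integral>\<^sup>+\<omega>. ennreal (occupation t ?s \<omega>) \<partial>P)"
    using occupation_measurable[OF s, of t] by (intro nn_integral_cmult) auto
  also have "\<dots> \<le> ennreal ?c * ennreal (8 * energy (- 1 / 4) b x)"
    by (intro mult_left_mono occupation_singular b t) auto
  also have "\<dots> = ennreal (2048 * a powr (- 1 / 2) * energy (- 1 / 4) b x)"
    by (simp add: mult.assoc flip: ennreal_mult')
  finally have "(\<integral>\<^sup>+\<omega>. ennreal (occupation t (\<lambda>y. (green a b x y)\<^sup>2) \<omega>) \<partial>P) \<le>
      ennreal (2048 * a powr (- 1 / 2) * energy (- 1 / 4) b x)" .
  from driving_martingale_power2[OF Z t _ this]
  show "integrable P (\<lambda>\<omega>. (Z t \<omega>)\<^sup>2)" "(\<integral>\<omega>. (Z t \<omega>)\<^sup>2 \<partial>P) \<le> 2048 * a powr (- 1 / 2) * energy (- 1 / 4) b x"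
    using energy_nonneg by auto
qed

end

text \<open>Completeness of L1 gives an almost sure limit along a subsequence of integers; the
  Cauchy bound and Fatou extend convergence to the continuous parameter, and Markov's inequality
  turns it into convergence in probability.\<close>

lemma (in prob_space) L1_Cauchy_imp_tendsto_in_prob:
  fixes U :: "real \<Rightarrow> 'a \<Rightarrow> real"
  assumes int: "\<And>b. 0 < b \<Longrightarrow> integrable M (U b)"
    and cauchy: "\<And>e. 0 < e \<Longrightarrow> \<exists>B>0. \<forall>a\<ge>B. \<forall>b\<ge>a. (\<integral>\<omega>. \<bar>U b \<omega> - U a \<omega>\<bar> \<partial>M) \<le> e"
  obtains Y where "Y \<in> borel_measurable M" "tendsto_in_prob M U Y at_top"
proof -
  \<comment> \<open>The successor keeps the parameter positive, where integrability is
    assumed.\<close>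
  define s where "s n = U (real (Suc n))" for n
  have s_int: "integrable M (s n)" for n
    unfolding s_def by (rule int) simp
  have "\<exists>N. \<forall>i\<ge>N. \<forall>j\<ge>N. (LINT x|M. norm (s i x - s j x)) < e" if e: "0 < e" for e
  proof -
    obtain B where B: "0 < B" "\<And>a b. B \<le> a \<Longrightarrow> a \<le> b \<Longrightarrow> (\<integral>\<omega>. \<bar>U b \<omega> - U a \<omega>\<bar> \<partial>M) \<le> e / 2"
      using cauchy[of "e / 2"] e by auto
    obtain N :: nat where N: "B \<le> real N"
      using real_arch_simple by blast
    have less: "(LINT x|M. norm (s j x - s i x)) < e" if "N \<le> i" "i \<le> j" for i j
      using B(2)[of "real (Suc i)" "real (Suc j)"] that N e by (simp add: s_def)
    then have "(LINT x|M. norm (s i x - s j x)) < e" if "N \<le> i" "N \<le> j" for i j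
      using less[of i j] less[of j i] that by (cases "i \<le> j") (auto simp: abs_minus_commute)
    then show ?thesis by blast
  qed
  from cauchy_L1_AE_cauchy_subseq[OF s_int this]
  obtain r where r: "strict_mono r" and r_cauchy: "AE x in M. Cauchy (\<lambda>i. s (r i) x)"
    by blast
  define Y where "Y x = lim (\<lambda>i. s (r i) x)" for x
  have Y_meas[measurable]: "Y \<in> borel_measurable M"
    unfolding Y_def[abs_def] using s_int by (intro borel_measurable_lim_metric) auto
  have Y_lim: "AE x in M. (\<lambda>i. s (r i) x) \<longlonglongrightarrow> Y x"
    using r_cauchy by eventually_elim (simp add: Y_def real_Cauchy_convergent convergent_LIMSEQ_iff[symmetric])
  \<comment> \<open>For fixed real b, Fatou along the subsequence replaces the second argument of
    the Cauchy bound by the limit \<open>Y\<close>.\<close>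
  have L1: "\<exists>B>0. \<forall>b\<ge>B. (\<integral>\<^sup>+\<omega>. ennreal \<bar>U b \<omega> - Y \<omega>\<bar> \<partial>M) \<le> ennreal e" if e: "0 < e" for e
  proof -
    obtain B where B: "0 < B" "\<And>a b. B \<le> a \<Longrightarrow> a \<le> b \<Longrightarrow> (\<integral>\<omega>. \<bar>U b \<omega> - U a \<omega>\<bar> \<partial>M) \<le> e"
      using cauchy[OF e] by auto
    have "(\<integral>\<^sup>+\<omega>. ennreal \<bar>U b \<omega> - Y \<omega>\<bar> \<partial>M) \<le> ennreal e" if b: "B \<le> b" for b
    proof -
      have U_int: "integrable M (U b)"
        by (rule int) (use B(1) b in simp)
      have "(\<integral>\<^sup>+\<omega>. ennreal \<bar>U b \<omega> - Y \<omega>\<bar> \<partial>M) = (\<integral>\<^sup>+\<omega>. liminf (\<lambda>i. ennreal \<bar>U b \<omega> - s (r i) \<omega>\<bar>) \<partial>M)"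
      proof (rule nn_integral_cong_AE)
        show "AE \<omega> in M. ennreal \<bar>U b \<omega> - Y \<omega>\<bar> = liminf (\<lambda>i. ennreal \<bar>U b \<omega> - s (r i) \<omega>\<bar>)"
          using Y_lim
        proof eventually_elim
          case (elim \<omega>)
          then have "(\<lambda>i. ennreal \<bar>U b \<omega> - s (r i) \<omega>\<bar>) \<longlonglongrightarrow> ennreal \<bar>U b \<omega> - Y \<omega>\<bar>"
            by (intro tendsto_intros)
          then show ?case
            by (intro lim_imp_Liminf[symmetric]) auto
        qed
      qed
      also have "\<dots> \<le> liminf (\<lambda>i. \<integral>\<^sup>+\<omega>. ennreal \<bar>U b \<omega> - s (r i) \<omega>\<bar> \<partial>M)"
        by (rule nn_integral_liminf) (use U_int s_int in auto)
      also have "\<dots> \<le> liminf (\<lambda>i. ennreal e)"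
      proof (rule Liminf_mono)
        obtain N :: nat where N: "b \<le> real N"
          using real_arch_simple by blast
        show "\<forall>\<^sub>F i in sequentially. (\<integral>\<^sup>+\<omega>. ennreal \<bar>U b \<omega> - s (r i) \<omega>\<bar> \<partial>M) \<le> ennreal e"
          using eventually_ge_at_top[of N]
        proof eventually_elim
          case (elim i)
          then have "b \<le> real (Suc (r i))"
            using N seq_suble[OF r, of i] by simp
          then have "(\<integral>\<omega>. \<bar>s (r i) \<omega> - U b \<omega>\<bar> \<partial>M) \<le> e"
            unfolding s_def by (rule B(2)[OF b])
          then have "(\<integral>\<omega>. \<bar>U b \<omega> - s (r i) \<omega>\<bar> \<partial>M) \<le> e"
            by (simp add: abs_minus_commute)
          moreover have "(\<integral>\<^sup>+\<omega>. ennreal \<bar>U b \<omega> - s (r i) \<omega>\<bar> \<partial>M) = ennreal (\<integral>\<omega>. \<bar>U b \<omega> - s (r i) \<omega>\<bar> \<partial>M)"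
            by (rule nn_integral_eq_integral) (use U_int s_int in auto)
          ultimately show ?case
            by (simp add: ennreal_leI)
        qed
      qed
      also have "\<dots> = ennreal e"
        by (simp add: Liminf_const)
      finally show ?thesis .
    qed
    with B(1) show ?thesis by blast
  qed
  have "tendsto_in_prob M U Y at_top"
    unfolding tendsto_in_prob_def
  proof (intro allI impI tendstoI)
    fix \<delta> e :: real assume \<delta>: "0 < \<delta>" and e: "0 < e"
    obtain B where B: "0 < B" "\<And>b. B \<le> b \<Longrightarrow> (\<integral>\<^sup>+\<omega>. ennreal \<bar>U b \<omega> - Y \<omega>\<bar> \<partial>M) \<le> ennreal (\<delta> * e / 2)"
      using L1[of "\<delta> * e / 2"] \<delta> e by auto
    show "\<forall>\<^sub>F b in at_top. dist (measure M {\<omega> \<in> space M. \<delta> < \<bar>U b \<omega> - Y \<omega>\<bar>}) 0 < e"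
      using eventually_ge_at_top[of B]
    proof eventually_elim
      case (elim b)
      have [measurable]: "U b \<in> borel_measurable M"
        using int[of b] B(1) elim by simp
      have diff: "integrable M (\<lambda>\<omega>. \<bar>U b \<omega> - Y \<omega>\<bar>)" "(\<integral>\<omega>. \<bar>U b \<omega> - Y \<omega>\<bar> \<partial>M) \<le> \<delta> * e / 2"
        using nn_integral_le_imp_integrable[OF _ _ B(2)[OF elim]] \<delta> e by auto
      have "measure M {\<omega> \<in> space M. \<delta> < \<bar>U b \<omega> - Y \<omega>\<bar>} \<le> measure M {\<omega> \<in> space M. \<delta> \<le> \<bar>U b \<omega> - Y \<omega>\<bar>}"
        by (intro finite_measure_mono) auto
      also have "\<dots> \<le> (\<integral>\<omega>. \<bar>U b \<omega> - Y \<omega>\<bar> \<partial>M) / \<delta>"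
        by (rule integral_Markov_inequality_measure[of _ _ "{}"]) (use diff(1) \<delta> in auto)
      also have "\<dots> \<le> e / 2"
        using diff(2) \<delta> by (simp add: divide_le_eq mult.commute)
      finally show ?case
        using e by simp
    qed
  qed
  with Y_meas show ?thesis by (rule that)
qed

text \<open>At r = 0 the smoothed kernel is sqrt (n + 1) and diverges, in agreement with
  \<open>1 / 0 = \<infinity>\<close> in \<open>ennreal\<close>; this is how an atom of \<mu> is
  detected.\<close>

lemma singular_kernel_limit:
  assumes "0 \<le> (r::real)"
  shows "(\<lambda>n. ennreal ((1 / real (Suc n) + r\<^sup>2) powr (- 1 / 2))) \<longlonglongrightarrow> 1 / ennreal r"
proof (cases "r = 0")
  case True
  have "filterlim (\<lambda>n. sqrt (real (Suc n))) at_top sequentially"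
    by (intro filterlim_compose[OF sqrt_at_top] filterlim_compose[OF filterlim_real_sequentially] filterlim_Suc)
  then have "(\<lambda>n. ennreal (sqrt (real (Suc n)))) \<longlonglongrightarrow> top"
    by (simp add: ennreal_tendsto_top_eq_at_top)
  then show ?thesis
    using True by (simp add: powr_minus_divide powr_half_sqrt real_sqrt_divide)
next
  case False
  then have r: "0 < r" using assms by simp
  have "(\<lambda>n. (1 / real (Suc n) + r\<^sup>2) powr (- 1 / 2)) \<longlonglongrightarrow> (0 + r\<^sup>2) powr (- 1 / 2)"
    using r by (intro tendsto_intros lim_1_over_n[THEN LIMSEQ_Suc]) auto
  moreover have "(0 + r\<^sup>2) powr (- 1 / 2) = 1 / r"
    using r by (simp add: powr_minus_divide powr_half_sqrt)
  moreover have "1 / ennreal r = ennreal (1 / r)"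
    using divide_ennreal[of 1 r] r by simp
  ultimately show ?thesis
    by (metis tendsto_ennrealI)
qed

section \<open>Energies at regular and near singular points; Tanaka's formula\<close>

context sbm3
begin

lemma ennreal_energy: "0 < b \<Longrightarrow> p \<le> 0 \<Longrightarrow> ennreal (energy p b x) = (\<integral>\<^sup>+y. ennreal (smoothed_power p b x y) \<partial>\<mu>)"
  unfolding energy_def
  by (rule nn_integral_eq_integral[symmetric]) (auto intro!: initial_integrable smoothed_power_bcontfun)

lemma energy_bounded:
  assumes "x \<notin> singular_points \<mu>"
  obtains C where "\<And>b. 0 < b \<Longrightarrow> energy (- 1 / 2) b x \<le> C"
proof -
  define S where "S = (\<integral>\<^sup>+y. 1 / ennreal (norm (y - x)) \<partial>\<mu>)"
  have S: "S < top"
    using assms by (auto simp: singular_points_def S_def less_top)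
  have "energy (- 1 / 2) b x \<le> enn2real S" if b: "0 < b" for b
  proof -
    have "ennreal (smoothed_power (- 1 / 2) b x y) \<le> 1 / ennreal (norm (y - x))" for y
    proof (cases "y = x")
      case False
      then have "smoothed_power (- 1 / 2) b x y \<le> ((norm (y - x))\<^sup>2) powr (- 1 / 2)"
        using b by (intro powr_mono2') auto
      also have "\<dots> = 1 / norm (y - x)"
        using False by (simp add: powr_minus_divide powr_half_sqrt)
      finally show ?thesis
        using divide_ennreal[of 1 "norm (y - x)"] False by (simp add: ennreal_leI)
    qed simp
    then have "(\<integral>\<^sup>+y. ennreal (smoothed_power (- 1 / 2) b x y) \<partial>\<mu>) \<le> S"
      unfolding S_def by (rule nn_integral_mono)
    moreover have "ennreal (energy (- 1 / 2) b x) = (\<integral>\<^sup>+y. ennreal (smoothed_power (- 1 / 2) b x y) \<partial>\<mu>)"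
      by (rule ennreal_energy) (use b in auto)
    ultimately have "enn2real (ennreal (energy (- 1 / 2) b x)) \<le> enn2real S"
      using S by (intro enn2real_mono) auto
    then show ?thesis
      using energy_nonneg by simp
  qed
  then show ?thesis by (rule that)
qed

text \<open>Fatou produces one smoothing level h at which the kernel centred at
  \<open>x\<^sub>0\<close> already has a large integral. Moving the centre to x and changing the
  scale then costs at most a factor 2, uniformly over all pairs (b, x) in the stated region.\<close>

lemma energy_blowup:
  assumes x0: "x\<^sub>0 \<in> singular_points \<mu>"
  shows "\<exists>h>0. \<forall>b>0. \<forall>x. 1 / b\<^sup>2 + (norm (x - x\<^sub>0))\<^sup>2 < h \<longrightarrow> \<Gamma> \<le> energy (- 1 / 2) b x"
proof -
  let ?k = "\<lambda>h y. (h + (norm (y - x\<^sub>0))\<^sup>2) powr (- 1 / 2)"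
  have k_bcontfun: "?k h \<in> bcontfun" if "0 < h" for h
  proof -
    have "smoothed_power (- 1 / 2) (1 / sqrt h) x\<^sub>0 \<in> bcontfun"
      by (rule smoothed_power_bcontfun) (use that in auto)
    moreover have "smoothed_power (- 1 / 2) (1 / sqrt h) x\<^sub>0 = ?k h"
      using that by (simp add: power_divide)
    ultimately show ?thesis
      by (simp only:)
  qed
  have k_int: "ennreal (\<integral>y. ?k h y \<partial>\<mu>) = (\<integral>\<^sup>+y. ennreal (?k h y) \<partial>\<mu>)" if "0 < h" for h
    by (rule nn_integral_eq_integral[symmetric, OF initial_integrable[OF k_bcontfun[OF that]]]) simp
  have "top = (\<integral>\<^sup>+y. liminf (\<lambda>n. ennreal (?k (1 / real (Suc n)) y)) \<partial>\<mu>)"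
  proof -
    have "liminf (\<lambda>n. ennreal (?k (1 / real (Suc n)) y)) = 1 / ennreal (norm (y - x\<^sub>0))" for y
      by (intro lim_imp_Liminf singular_kernel_limit) auto
    then show ?thesis
      using x0 by (simp add: singular_points_def)
  qed
  also have "\<dots> \<le> liminf (\<lambda>n. \<integral>\<^sup>+y. ennreal (?k (1 / real (Suc n)) y) \<partial>\<mu>)"
    by (rule nn_integral_liminf) (use initial_integrable[OF k_bcontfun] in auto)
  finally have "liminf (\<lambda>n. \<integral>\<^sup>+y. ennreal (?k (1 / real (Suc n)) y) \<partial>\<mu>) = top"
    by (simp add: top_unique)
  \<comment> \<open>The factor 2 pays for the recentring below, where 4 powr (-1/2) = 1/2; the
    absolute value covers negative \<Gamma>.\<close>
  then have "ennreal (2 * \<bar>\<Gamma>\<bar>) < liminf (\<lambda>n. \<integral>\<^sup>+y. ennreal (?k (1 / real (Suc n)) y) \<partial>\<mu>)"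
    by simp
  then have "\<forall>\<^sub>F n in sequentially. ennreal (2 * \<bar>\<Gamma>\<bar>) < (\<integral>\<^sup>+y. ennreal (?k (1 / real (Suc n)) y) \<partial>\<mu>)"
    by (rule less_LiminfD)
  then obtain n where n: "ennreal (2 * \<bar>\<Gamma>\<bar>) < (\<integral>\<^sup>+y. ennreal (?k (1 / real (Suc n)) y) \<partial>\<mu>)"
    by (auto simp: eventually_sequentially)
  define h where "h = 1 / real (Suc n)"
  have h: "0 < h" by (simp add: h_def)
  have big: "2 * \<bar>\<Gamma>\<bar> < (\<integral>y. ?k h y \<partial>\<mu>)"
    using n unfolding h_def[symmetric] k_int[OF h, symmetric] by (simp add: ennreal_less_iff)
  have "\<Gamma> \<le> energy (- 1 / 2) b x" if b: "0 < b" and close: "1 / b\<^sup>2 + (norm (x - x\<^sub>0))\<^sup>2 < h" for b x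
  proof -
    have "1 / 2 * ?k h y \<le> smoothed_power (- 1 / 2) b x y" for y
    proof -
      have "(norm (y - x))\<^sup>2 \<le> (norm (y - x\<^sub>0) + norm (x - x\<^sub>0))\<^sup>2"
        using norm_triangle_ineq4[of "y - x\<^sub>0" "x - x\<^sub>0"] by (intro power_mono) auto
      also have "\<dots> \<le> 2 * (norm (y - x\<^sub>0))\<^sup>2 + 2 * (norm (x - x\<^sub>0))\<^sup>2"
        using sum_squares_bound[of "norm (y - x\<^sub>0)" "norm (x - x\<^sub>0)"] by (simp add: power2_sum)
      finally have "1 / b\<^sup>2 + (norm (y - x))\<^sup>2 \<le> 4 * (h + (norm (y - x\<^sub>0))\<^sup>2)"
        using close h zero_le_power2[of "norm (y - x\<^sub>0)"] zero_le_power2[of "norm (x - x\<^sub>0)"]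
          divide_nonneg_nonneg[OF zero_le_one zero_le_power2[of b]] by argo
      then have "(4 * (h + (norm (y - x\<^sub>0))\<^sup>2)) powr (- 1 / 2) \<le> smoothed_power (- 1 / 2) b x y"
        by (intro powr_mono2') (use smoothed_pos[OF b] in auto)
      moreover have "(4 * (h + (norm (y - x\<^sub>0))\<^sup>2)) powr (- 1 / 2) = 1 / 2 * ?k h y"
        unfolding powr_mult by (simp add: powr_minus_divide powr_half_sqrt)
      ultimately show ?thesis by simp
    qed
    then have "(\<integral>y. 1 / 2 * ?k h y \<partial>\<mu>) \<le> energy (- 1 / 2) b x"
      unfolding energy_def
      by (intro integral_mono integrable_mult_right initial_integrable k_bcontfun h smoothed_power_bcontfun b) auto
    then show ?thesis
      using big by simp
  qed
  with h show ?thesis by blast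
qed

text \<open>The approximation of the local time at \<epsilon> = 1/b^2, parametrized so that it pairs
  with \<open>green 0 b x\<close> in Tanaka's formula and \<epsilon> \<rightarrow> 0 becomes b
  \<rightarrow> \<infinity>.\<close>

definition heat_occupation :: "real \<Rightarrow> real \<Rightarrow> real ^ 3 \<Rightarrow> 'w \<Rightarrow> real" where
  "heat_occupation t b x = occupation t (\<lambda>y. heat_kernel (1 / b\<^sup>2) (y - x))"

lemma green_decomposition:
  assumes Z: "driving_martingale (green 0 b x) Z" and b: "0 < b" and t: "0 \<le> t" and \<omega>: "\<omega> \<in> space P"
  shows "pairing t (green 0 b x) \<omega> + heat_occupation t b x \<omega> = pairing 0 (green 0 b x) \<omega> + Z t \<omega>"
proof -
  have "occupation t (\<lambda>y. laplacian (green 0 b x) y / 2) \<omega> = - heat_occupation t b x \<omega>"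
    unfolding half_laplacian_green[OF b] heat_occupation_def
    using occupation_cmult[of t "- 1" "\<lambda>y. heat_kernel (1 / b\<^sup>2) (y - x)" \<omega>] by simp
  then show ?thesis
    using driving_martingaleD(4)[OF Z t \<omega>] by simp
qed

lemma heat_occupation_integrable:
  assumes b: "0 < b" and t: "0 \<le> t"
  shows "integrable P (heat_occupation t b x)"
  unfolding heat_occupation_def
  by (rule occupation_integrable[OF green_in_Cb2[of 0 b x] _ heat_kernel_bcontfun[OF b] _ _ t])
     (use b half_laplacian_green[OF b] in \<open>auto simp: green_nonneg heat_kernel_def\<close>)

lemma green_split:
  assumes "0 < a" "a \<le> b"
  shows "green a b x y = green 0 b x y - green 0 a x y"
  using green_add[of a b x y] assms by simp

text \<open>The martingale problem for \<open>green a b x\<close>, whose half Laplacian is the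
  difference of the two heat kernels, expresses the increment by an initial term, a terminal term
  and a martingale. The first two are nonnegative, so their absolute values integrate to differences
  in b and a that will be controlled by monotonicity.\<close>

lemma heat_occupation_increment:
  assumes a: "0 < a" "a \<le> b" and t: "0 \<le> t"
  shows "(\<integral>\<omega>. \<bar>heat_occupation t b x \<omega> - heat_occupation t a x \<omega>\<bar> \<partial>P) \<le>
    (integral\<^sup>L \<mu> (green 0 b x) - integral\<^sup>L \<mu> (green 0 a x)) +
    (integral\<^sup>L P (pairing t (green 0 b x)) - integral\<^sup>L P (pairing t (green 0 a x))) +
    a powr (- 1 / 4) * (1 + 2048 * energy (- 1 / 4) b x)"
proof -
  have b: "0 < b" using a by simp
  let ?g = "green a b x"
  let ?p = "\<lambda>c y. heat_kernel (1 / c\<^sup>2) (y - x)"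
  have Cb2: "?g \<in> Cb2"
    using a by (intro green_in_Cb2) auto
  have cont: "green 0 a x \<in> bcontfun" "green 0 b x \<in> bcontfun"
    using a by (auto intro!: green_bcontfun)
  obtain Z where Z: "driving_martingale ?g Z"
    using martingale_problem[OF Cb2] ..
  note Z2 = green_tail_martingale_power2[OF Z a t]
  have lap: "laplacian ?g y / 2 = ?p a y + - 1 * ?p b y" for y
    using a b by (simp add: laplacian_green heat_kernel_eq field_simps)
  have eq: "heat_occupation t b x \<omega> - heat_occupation t a x \<omega> = pairing 0 ?g \<omega> + Z t \<omega> - pairing t ?g \<omega>"
    if \<omega>: "\<omega> \<in> space P" for \<omega>
  proof -
    have "occupation t (\<lambda>y. laplacian ?g y / 2) \<omega> = heat_occupation t a x \<omega> - heat_occupation t b x \<omega>"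
      unfolding lap heat_occupation_def
        occupation_add[OF heat_kernel_bcontfun[OF a(1)] bcontfun_cmult[OF heat_kernel_bcontfun[OF b]] \<omega>] occupation_cmult
      by simp
    then show ?thesis
      using driving_martingaleD(4)[OF Z t \<omega>] by simp
  qed
  have pairing_split: "pairing s ?g \<omega> = pairing s (green 0 b x) \<omega> - pairing s (green 0 a x) \<omega>"
    if "0 \<le> s" "\<omega> \<in> space P" for s \<omega>
    unfolding pairing_def green_split[OF a, abs_def]
    by (intro Bochner_Integration.integral_diff X_integrable cont that)
  have pos: "0 \<le> pairing s ?g \<omega>" for s \<omega>
    using a by (intro pairing_nonneg green_nonneg) auto
  have int_t: "integrable P (pairing t ?g)"
    and mean_t: "integral\<^sup>L P (pairing t ?g) = integral\<^sup>L P (pairing t (green 0 b x)) - integral\<^sup>L P (pairing t (green 0 a x))"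
  proof -
    have d: "integrable P (\<lambda>\<omega>. pairing t (green 0 b x) \<omega> - pairing t (green 0 a x) \<omega>)"
      using green_pairing_integrable[OF a(1) t] green_pairing_integrable[OF b t] by auto
    then show "integrable P (pairing t ?g)"
      by (rule Bochner_Integration.integrable_cong[OF refl, THEN iffD1, rotated]) (simp add: pairing_split t)
    have "integral\<^sup>L P (pairing t ?g) = (\<integral>\<omega>. pairing t (green 0 b x) \<omega> - pairing t (green 0 a x) \<omega> \<partial>P)"
      by (rule Bochner_Integration.integral_cong) (auto simp: pairing_split t)
    then show "integral\<^sup>L P (pairing t ?g) = integral\<^sup>L P (pairing t (green 0 b x)) - integral\<^sup>L P (pairing t (green 0 a x))"
      using green_pairing_integrable[OF a(1) t] green_pairing_integrable[OF b t] by simp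
  qed
  \<comment> \<open>The martingale has variance of order d^2, so |z| \<le> d + z^2 / d balances both
    terms at order d.\<close>
  define d where "d = a powr (- 1 / 4)"
  have d: "0 < d" using a by (simp add: d_def)
  have Zabs: "\<bar>z\<bar> \<le> d + z\<^sup>2 / d" for z :: real
  proof -
    have "2 * (\<bar>z\<bar> * d) \<le> z\<^sup>2 + d\<^sup>2"
      using sum_squares_bound[of "\<bar>z\<bar>" d] by simp
    then have "\<bar>z\<bar> * d \<le> z\<^sup>2 + d\<^sup>2"
      using mult_nonneg_nonneg[OF abs_ge_zero less_imp_le[OF d], of z] by linarith
    then have "\<bar>z\<bar> \<le> (z\<^sup>2 + d\<^sup>2) / d"
      using d by (simp add: pos_le_divide_eq)
    also have "\<dots> = d + z\<^sup>2 / d"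
      using d by (simp add: add_divide_distrib power2_eq_square)
    finally show ?thesis .
  qed
  let ?m = "integral\<^sup>L \<mu> ?g"
  have m0: "0 \<le> ?m"
    using a by (intro Bochner_Integration.integral_nonneg green_nonneg) auto
  have "(\<integral>\<omega>. \<bar>heat_occupation t b x \<omega> - heat_occupation t a x \<omega>\<bar> \<partial>P) \<le>
      (\<integral>\<omega>. ?m + pairing t ?g \<omega> + (d + (Z t \<omega>)\<^sup>2 / d) \<partial>P)"
  proof (rule integral_mono_AE)
    show "integrable P (\<lambda>\<omega>. \<bar>heat_occupation t b x \<omega> - heat_occupation t a x \<omega>\<bar>)"
      using heat_occupation_integrable[OF a(1) t] heat_occupation_integrable[OF b t] by auto
    show "integrable P (\<lambda>\<omega>. ?m + pairing t ?g \<omega> + (d + (Z t \<omega>)\<^sup>2 / d))"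
      using int_t Z2(1) by auto
    show "AE \<omega> in P. \<bar>heat_occupation t b x \<omega> - heat_occupation t a x \<omega>\<bar> \<le> ?m + pairing t ?g \<omega> + (d + (Z t \<omega>)\<^sup>2 / d)"
      using pairing_initial[of ?g] AE_space
    proof eventually_elim
      case (elim \<omega>)
      then show ?case
        using eq[of \<omega>] Zabs[of "Z t \<omega>"] pos[of t \<omega>] m0 by simp
    qed
  qed
  also have "\<dots> = ?m + integral\<^sup>L P (pairing t ?g) + (d + (\<integral>\<omega>. (Z t \<omega>)\<^sup>2 \<partial>P) / d)"
    using int_t Z2(1) by (simp add: prob_space)
  also have "(\<integral>\<omega>. (Z t \<omega>)\<^sup>2 \<partial>P) / d \<le> 2048 * a powr (- 1 / 2) * energy (- 1 / 4) b x / d"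
    using Z2(2) d by (intro divide_right_mono) auto
  also have "a powr (- 1 / 2) = d * d"
    by (simp add: d_def flip: powr_add)
  also have "?m = integral\<^sup>L \<mu> (green 0 b x) - integral\<^sup>L \<mu> (green 0 a x)"
    unfolding green_split[OF a, abs_def]
    by (intro Bochner_Integration.integral_diff initial_integrable cont)
  finally show ?thesis
    unfolding mean_t d_def[symmetric] using d by (simp add: algebra_simps)
qed

end

section \<open>Convergence and lower tail of the regularized local time\<close>

lemma mono_bounded_increments_small:
  fixes f :: "real \<Rightarrow> real"
  assumes mono: "\<And>a b. 0 < a \<Longrightarrow> a \<le> b \<Longrightarrow> f a \<le> f b" and bdd: "\<And>b. 0 < b \<Longrightarrow> f b \<le> C" and e: "0 < e"
  shows "\<exists>B>0. \<forall>a\<ge>B. \<forall>b\<ge>a. f b - f a \<le> e"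
proof -
  let ?S = "f ` {0<..}"
  have S: "?S \<noteq> {}" "bdd_above ?S"
    using bdd by (auto intro!: bdd_aboveI[of _ C])
  have "Sup ?S - e < Sup ?S"
    using e by simp
  then obtain B where B: "0 < B" "Sup ?S - e < f B"
    using less_cSup_iff[OF S] by auto
  have "f b - f a \<le> e" if "B \<le> a" "a \<le> b" for a b
  proof -
    have "f b \<le> Sup ?S"
      using S B that by (intro cSup_upper) auto
    moreover have "f B \<le> f a"
      using B that by (intro mono)
    ultimately show ?thesis
      using B by linarith
  qed
  with B(1) show ?thesis by blast
qed

context sbm3
begin

text \<open>Regularity of x enters as boundedness of \<open>energy (- 1 / 2) b x\<close> in b, which
  bounds the deterministic potentials and, through \<open>energy_quarter_le\<close>, the martingale
  variance.\<close>

lemma heat_occupation_converges: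
  assumes x: "x \<notin> singular_points \<mu>" and t: "0 \<le> t"
  obtains Y where "Y \<in> borel_measurable P" "tendsto_in_prob P (\<lambda>b. heat_occupation t b x) Y at_top"
proof (rule L1_Cauchy_imp_tendsto_in_prob)
  show "integrable P (heat_occupation t b x)" if "0 < b" for b
    by (rule heat_occupation_integrable[OF that t])
next
  fix e :: real assume e: "0 < e"
  obtain C where C: "\<And>b. 0 < b \<Longrightarrow> energy (- 1 / 2) b x \<le> C"
    using energy_bounded[OF x] by blast
  define R where "R = 1 + 2048 * (C + total_mass)"
  have R: "1 + 2048 * energy (- 1 / 4) b x \<le> R" if "0 < b" for b
    using energy_quarter_le[OF that, of 1 x] C[OF that] by (simp add: R_def)
  \<comment> \<open>The initial and terminal differences in \<open>heat_occupation_increment\<close>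
    together are one increment of \<open>m\<close>. It is monotone because
    \<open>green 0 b x\<close> increases with b, and bounded, so its increments become small without
    its limit being identified.\<close>
  define m where "m b = integral\<^sup>L \<mu> (green 0 b x) + integral\<^sup>L P (pairing t (green 0 b x))" for b
  have m_mono: "m a \<le> m b" if a: "0 < a" "a \<le> b" for a b
  proof -
    have b: "0 < b" using a by simp
    have le: "green 0 a x y \<le> green 0 b x y" for y
      using green_split[OF a, of x y] green_nonneg[of a b x y] a by simp
    have cont: "green 0 a x \<in> bcontfun" "green 0 b x \<in> bcontfun"
      using a by (auto intro!: green_bcontfun)
    have "integral\<^sup>L \<mu> (green 0 a x) \<le> integral\<^sup>L \<mu> (green 0 b x)"
      by (intro integral_mono initial_integrable cont le)
    moreover have "integral\<^sup>L P (pairing t (green 0 a x)) \<le> integral\<^sup>L P (pairing t (green 0 b x))"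
      by (intro integral_mono green_pairing_integrable pairing_mono cont le t a(1) b)
    ultimately show ?thesis
      by (simp add: m_def)
  qed
  have m_le: "m b \<le> 16 * C" if b: "0 < b" for b
  proof -
    have "integral\<^sup>L \<mu> (green 0 b x) \<le> (\<integral>y. 8 * smoothed_power (- 1 / 2) b x y \<partial>\<mu>)"
      using b by (intro integral_mono integrable_mult_right initial_integrable green_bcontfun
          smoothed_power_bcontfun green_upper) auto
    also have "\<dots> \<le> 8 * C"
      using C[OF b] by (simp add: energy_def)
    finally show ?thesis
      using green_pairing_le_initial[OF b t, of x] by (simp add: m_def)
  qed
  have "\<exists>B>0. \<forall>a\<ge>B. \<forall>b\<ge>a. m b - m a \<le> e / 2"
    by (rule mono_bounded_increments_small[OF m_mono m_le]) (use e in auto)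
  then obtain B where B: "0 < B" "\<And>a b. B \<le> a \<Longrightarrow> a \<le> b \<Longrightarrow> m b - m a \<le> e / 2"
    by blast
  have "((\<lambda>a. a powr (- 1 / 4) * R) \<longlongrightarrow> 0 * R) at_top"
    by (intro tendsto_mult tendsto_neg_powr filterlim_ident tendsto_const) auto
  then have "\<forall>\<^sub>F a in at_top. a powr (- 1 / 4) * R < e / 2"
    using e by (intro order_tendstoD(2)) auto
  then obtain A where A: "\<And>a. A \<le> a \<Longrightarrow> a powr (- 1 / 4) * R < e / 2"
    by (auto simp: eventually_at_top_linorder)
  have "(\<integral>\<omega>. \<bar>heat_occupation t b x \<omega> - heat_occupation t a x \<omega>\<bar> \<partial>P) \<le> e"
    if a: "max A B \<le> a" "a \<le> b" for a b
  proof -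
    have a0: "0 < a" and b0: "0 < b" and "A \<le> a" "B \<le> a"
      using a B(1) by auto
    have "a powr (- 1 / 4) * (1 + 2048 * energy (- 1 / 4) b x) \<le> a powr (- 1 / 4) * R"
      by (intro mult_left_mono R b0) auto
    then show ?thesis
      using heat_occupation_increment[OF a0 a(2) t, of x] B(2)[OF \<open>B \<le> a\<close> a(2)] A[OF \<open>A \<le> a\<close>]
      by (simp add: m_def)
  qed
  then show "\<exists>B>0. \<forall>a\<ge>B. \<forall>b\<ge>a. (\<integral>\<omega>. \<bar>heat_occupation t b x \<omega> - heat_occupation t a x \<omega>\<bar> \<partial>P) \<le> e"
    using B(1) by (intro exI[of _ "max A B"]) auto
qed (rule that)

text \<open>Chebyshev for the martingale part and Markov for \<open>X\<^sub>t(green)\<close>.\<close>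

lemma heat_occupation_lower_tail:
  assumes b: "0 < b" and t: "0 < t" and q: "0 < q" and le: "k + q \<le> integral\<^sup>L \<mu> (green 0 b x)"
  defines "E \<equiv> 8 * energy (- 1 / 4) b x + t * total_mass"
  shows "prob {\<omega>\<in>space P. heat_occupation t b x \<omega> \<le> k} \<le> 256 * E / q\<^sup>2 + 16 * E / (t * q)"
proof -
  have t0: "0 \<le> t" using t by simp
  have Cb2: "green 0 b x \<in> Cb2"
    using b by (intro green_in_Cb2) auto
  obtain Z where Z: "driving_martingale (green 0 b x) Z"
    using martingale_problem[OF Cb2] ..
  note Z2 = green_martingale_power2[OF Z b t0, folded E_def]
  note pair_int = green_pairing_integrable[OF b t0, of x]
  note U_int = heat_occupation_integrable[OF b t0, of x]
  let ?A = "{\<omega>\<in>space P. q\<^sup>2 / 4 \<le> (Z t \<omega>)\<^sup>2}" and ?B = "{\<omega>\<in>space P. q / 2 \<le> pairing t (green 0 b x) \<omega>}"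
  have [measurable]: "Z t \<in> borel_measurable P" "pairing t (green 0 b x) \<in> borel_measurable P"
    "heat_occupation t b x \<in> borel_measurable P"
    using driving_martingaleD(1)[OF Z t0] pair_int U_int by auto
  have "prob {\<omega>\<in>space P. heat_occupation t b x \<omega> \<le> k} \<le> prob (?A \<union> ?B)"
  proof (rule finite_measure_mono_AE)
    show "AE \<omega> in P. \<omega> \<in> {\<omega>\<in>space P. heat_occupation t b x \<omega> \<le> k} \<longrightarrow> \<omega> \<in> ?A \<union> ?B"
      using pairing_initial[of "green 0 b x"] AE_space
    proof eventually_elim
      case (elim \<omega>)
      show ?case
      proof
        assume "\<omega> \<in> {\<omega>\<in>space P. heat_occupation t b x \<omega> \<le> k}"
        \<comment> \<open>Tanaka's formula: if the occupation is at most k while the potential is at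
          least k + q, then the terminal term minus the martingale must make up for q, so one of
          them has size at least q/2.\<close>
        then have "q \<le> pairing t (green 0 b x) \<omega> - Z t \<omega>"
          using green_decomposition[OF Z b t0 elim(2)] elim(1) le by simp
        then consider "q / 2 \<le> \<bar>Z t \<omega>\<bar>" | "q / 2 \<le> pairing t (green 0 b x) \<omega>"
          by linarith
        then show "\<omega> \<in> ?A \<union> ?B"
        proof cases
          case 1
          then have "(q / 2)\<^sup>2 \<le> \<bar>Z t \<omega>\<bar>\<^sup>2"
            using q by (intro power_mono) auto
          then show ?thesis
            using elim(2) by (simp add: power_divide)
        next
          case 2
          then show ?thesis using elim(2) by simp
        qed
      qed
    qed
  qed measurable
  also have "\<dots> \<le> prob ?A + prob ?B"
    by (rule measure_Un_le) measurable
  also have "prob ?A \<le> (\<integral>\<omega>. (Z t \<omega>)\<^sup>2 \<partial>P) / (q\<^sup>2 / 4)"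
    by (rule integral_Markov_inequality_measure[of _ _ "{}"]) (use Z2(1) q in auto)
  also have "\<dots> \<le> 64 * E / (q\<^sup>2 / 4)"
    using Z2(2) by (intro divide_right_mono) auto
  also have "prob ?B \<le> integral\<^sup>L P (pairing t (green 0 b x)) / (q / 2)"
    by (rule integral_Markov_inequality_measure[of _ _ "{}"])
       (use pair_int q green_nonneg in \<open>auto intro!: pairing_nonneg AE_I2\<close>)
  also have "\<dots> \<le> (8 * E / t) / (q / 2)"
    using green_pairing_bound[OF b t, of x] q t
    by (intro divide_right_mono) (auto simp: E_def pos_le_divide_eq mult.commute)
  finally show ?thesis
    by (simp add: mult.assoc)
qed

text \<open>Let s be the root of the Newtonian energy. The potential of \<mu> grows like s^2,
  whereas the quantity \<open>E\<close> of the lower tail estimate is of order s. The two terms of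
  that estimate are then of order s^(-3) and s^(-1), both at most a multiple of 1/s.\<close>

lemma heat_occupation_large:
  assumes t: "0 < t" and k: "0 \<le> k" and e: "0 < e"
  shows "\<exists>\<Gamma>. \<forall>b>0. \<forall>x. \<Gamma> \<le> energy (- 1 / 2) b x \<longrightarrow>
    prob {\<omega>\<in>space P. heat_occupation t b x \<omega> \<le> k} \<le> e"
proof -
  let ?c = "green_const"
  define A where "A = 8 * (1 + total_mass) + t * total_mass"
  define D where "D = 4096 * A / ?c\<^sup>2 + 64 * A / (t * ?c)"
  have c: "0 < ?c" by (rule green_const_bounds)
  have A: "0 \<le> A" using t by (simp add: A_def)
  have D: "0 \<le> D" using A c t by (simp add: D_def)
  \<comment> \<open>The three summands ensure s \<ge> 1, k \<le> q and D / e \<le> s,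
    respectively.\<close>
  define \<Gamma> where "\<Gamma> = 1 + 4 * k / ?c + (D / e)\<^sup>2"
  have "prob {\<omega>\<in>space P. heat_occupation t b x \<omega> \<le> k} \<le> e"
    if b: "0 < b" and large: "\<Gamma> \<le> energy (- 1 / 2) b x" for b x
  proof -
    define s where "s = sqrt (energy (- 1 / 2) b x)"
    have s2: "energy (- 1 / 2) b x = s\<^sup>2"
      by (simp add: s_def energy_nonneg)
    have "0 \<le> 4 * k / ?c" "0 \<le> (D / e)\<^sup>2"
      using k c by auto
    then have large': "1 \<le> s\<^sup>2" "4 * k / ?c \<le> s\<^sup>2" "(D / e)\<^sup>2 \<le> s\<^sup>2"
      using large unfolding s2 \<Gamma>_def by linarith+
    have "0 \<le> s" by (simp add: s_def energy_nonneg)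
    then have s1: "1 \<le> s"
      using large'(1) by (intro power2_le_imp_le[of 1 s]) auto
    have Ds: "D / e \<le> s"
      using large'(3) \<open>0 \<le> s\<close> by (rule power2_le_imp_le)
    \<comment> \<open>Half of the lower bound c s^2 / 2 for the potential; the other half absorbs
      k.\<close>
    define q where "q = ?c * s\<^sup>2 / 4"
    have q: "0 < q" using c s1 by (simp add: q_def)
    have kq: "k \<le> q"
      using large'(2) c by (simp add: q_def field_simps)
    have "?c / 2 * energy (- 1 / 2) b x \<le> integral\<^sup>L \<mu> (green 0 b x)"
    proof -
      have "(\<integral>y. ?c / 2 * smoothed_power (- 1 / 2) b x y \<partial>\<mu>) \<le> integral\<^sup>L \<mu> (green 0 b x)"
        using b by (intro integral_mono integrable_mult_right initial_integrable green_bcontfun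
            smoothed_power_bcontfun green_lower) auto
      then show ?thesis
        by (simp add: energy_def)
    qed
    then have "k + q \<le> integral\<^sup>L \<mu> (green 0 b x)"
      using kq unfolding s2 q_def by simp
    note tail = heat_occupation_lower_tail[OF b t q this]
    \<comment> \<open>The choice h = 1/s balances both terms of \<open>energy_quarter_le\<close> at
      order s.\<close>
    have "energy (- 1 / 4) b x \<le> (1 / s) * s\<^sup>2 + total_mass / (1 / s)"
      using energy_quarter_le[OF b, of "1 / s" x] s1 unfolding s2 by simp
    also have "\<dots> = (1 + total_mass) * s"
      using s1 by (simp add: power2_eq_square algebra_simps)
    finally have "8 * energy (- 1 / 4) b x + t * total_mass \<le> 8 * ((1 + total_mass) * s) + t * total_mass * s"
      using mult_left_mono[OF s1, of "t * total_mass"] t by (simp add: add_mono)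
    also have "\<dots> = A * s"
      by (simp add: A_def algebra_simps)
    finally have E: "8 * energy (- 1 / 4) b x + t * total_mass \<le> A * s" .
    have "256 * (8 * energy (- 1 / 4) b x + t * total_mass) / q\<^sup>2 \<le> 256 * (A * s) / q\<^sup>2"
      using E by (intro divide_right_mono mult_left_mono) auto
    also have "\<dots> = 4096 * A / ?c\<^sup>2 / s ^ 3"
      using s1 c by (simp add: q_def field_simps power_numeral_reduce)
    also have "\<dots> \<le> 4096 * A / ?c\<^sup>2 / s"
      using s1 A c power_increasing[of 1 3 s] by (intro divide_left_mono) auto
    finally have 1: "256 * (8 * energy (- 1 / 4) b x + t * total_mass) / q\<^sup>2 \<le> 4096 * A / ?c\<^sup>2 / s" .
    have "16 * (8 * energy (- 1 / 4) b x + t * total_mass) / (t * q) \<le> 16 * (A * s) / (t * q)"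
      using E t q by (intro divide_right_mono mult_left_mono) auto
    also have "\<dots> = 64 * A / (t * ?c) / s"
      using s1 c t by (simp add: q_def field_simps power_numeral_reduce)
    finally have 2: "16 * (8 * energy (- 1 / 4) b x + t * total_mass) / (t * q) \<le> 64 * A / (t * ?c) / s" .
    have "prob {\<omega>\<in>space P. heat_occupation t b x \<omega> \<le> k} \<le> D / s"
      using tail 1 2 by (simp add: D_def add_divide_distrib)
    also have "\<dots> \<le> e"
      using Ds s1 e by (simp add: field_simps)
    finally show ?thesis .
  qed
  then show ?thesis by blast
qed

end

section \<open>Blow-up of the local time\<close>

context sbm3
begin

lemma tendsto_in_prob_heat_kernel:
  assumes "tendsto_in_prob P (\<lambda>b. heat_occupation t b x) Y at_top"
  shows "tendsto_in_prob P (\<lambda>\<epsilon> \<omega>. LBINT s:{0..t}. integral\<^sup>L (X s \<omega>) (\<lambda>y. heat_kernel \<epsilon> (y - x))) Y (at_right 0)"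
  unfolding tendsto_in_prob_def
proof (intro allI impI)
  fix \<delta> :: real assume \<delta>: "0 < \<delta>"
  have "filterlim (\<lambda>\<epsilon>::real. sqrt (inverse \<epsilon>)) at_top (at_right 0)"
    by (rule filterlim_compose[OF sqrt_at_top filterlim_inverse_at_top_right])
  moreover have "((\<lambda>b. prob {\<omega>\<in>space P. \<delta> < \<bar>heat_occupation t b x \<omega> - Y \<omega>\<bar>}) \<longlongrightarrow> 0) at_top"
    using assms \<delta> by (simp add: tendsto_in_prob_def)
  ultimately have "((\<lambda>\<epsilon>. prob {\<omega>\<in>space P. \<delta> < \<bar>heat_occupation t (sqrt (inverse \<epsilon>)) x \<omega> - Y \<omega>\<bar>}) \<longlongrightarrow> 0) (at_right 0)"
    by (rule filterlim_compose[rotated])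
  moreover have "\<forall>\<^sub>F \<epsilon> in at_right 0.
      prob {\<omega>\<in>space P. \<delta> < \<bar>heat_occupation t (sqrt (inverse \<epsilon>)) x \<omega> - Y \<omega>\<bar>} =
      prob {\<omega>\<in>space P. \<delta> < \<bar>(LBINT s:{0..t}. integral\<^sup>L (X s \<omega>) (\<lambda>y. heat_kernel \<epsilon> (y - x))) - Y \<omega>\<bar>}"
    using eventually_at_right_less[of 0]
  proof eventually_elim
    case (elim \<epsilon>)
    then have "1 / (sqrt (inverse \<epsilon>))\<^sup>2 = \<epsilon>"
      by (simp add: field_simps)
    then show ?case
      unfolding heat_occupation_def occupation_def pairing_def by simp
  qed
  ultimately show "((\<lambda>\<epsilon>. prob {\<omega>\<in>space P.
      \<delta> < \<bar>(LBINT s:{0..t}. integral\<^sup>L (X s \<omega>) (\<lambda>y. heat_kernel \<epsilon> (y - x))) - Y \<omega>\<bar>}) \<longlongrightarrow> 0) (at_right 0)"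
    by (rule Lim_transform_eventually)
qed

text \<open>The order of choices matters: \<Gamma> and h do not depend on x, so they fix the
  neighbourhood of \<open>x\<^sub>0\<close>; for a regular x in it, b is then taken so large that
  the approximation is within 1 of the local time with high probability. This slack explains k +
  1.\<close>

lemma local_time_large_near_singular_point:
  assumes L: "sbm_local_time P X \<mu> L" and x0: "x\<^sub>0 \<in> singular_points \<mu>"
    and t: "0 < t" and k: "0 \<le> k" and e: "0 < e"
  shows "\<forall>\<^sub>F x in at x\<^sub>0 within - singular_points \<mu>. prob {\<omega>\<in>space P. L t x \<omega> \<le> ennreal k} \<le> e"
proof -
  have t0: "0 \<le> t" using t by simp
  obtain \<Gamma> where \<Gamma>: "\<And>b x. 0 < b \<Longrightarrow> \<Gamma> \<le> energy (- 1 / 2) b x \<Longrightarrow>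
      prob {\<omega>\<in>space P. heat_occupation t b x \<omega> \<le> k + 1} \<le> e / 2"
    using heat_occupation_large[OF t, of "k + 1" "e / 2"] k e by auto
  obtain h where h: "0 < h" "\<And>b x. 0 < b \<Longrightarrow> 1 / b\<^sup>2 + (norm (x - x\<^sub>0))\<^sup>2 < h \<Longrightarrow> \<Gamma> \<le> energy (- 1 / 2) b x"
    using energy_blowup[OF x0, of \<Gamma>] by blast
  \<comment> \<open>One half of h is reserved for the distance to \<open>x\<^sub>0\<close>, the
    other for 1/b^2.\<close>
  have "\<forall>\<^sub>F x in at x\<^sub>0 within - singular_points \<mu>. x \<in> - singular_points \<mu> \<and> dist x x\<^sub>0 < sqrt (h / 2)"
    using h(1) by (auto simp: eventually_at intro!: exI[of _ "sqrt (h / 2)"])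
  then show ?thesis
  proof eventually_elim
    case (elim x)
    then have x: "x \<notin> singular_points \<mu>" and close: "dist x x\<^sub>0 < sqrt (h / 2)"
      by auto
    have "(norm (x - x\<^sub>0))\<^sup>2 < (sqrt (h / 2))\<^sup>2"
      using close by (intro power_strict_mono) (auto simp: dist_norm)
    then have x_close: "(norm (x - x\<^sub>0))\<^sup>2 < h / 2"
      using h(1) by simp
    obtain Y where Y: "Y \<in> borel_measurable P" and conv: "tendsto_in_prob P (\<lambda>b. heat_occupation t b x) Y at_top"
      using heat_occupation_converges[OF x t0] by blast
    have L_eq: "AE \<omega> in P. L t x \<omega> = ennreal (Y \<omega>)"
      using L tendsto_in_prob_heat_kernel[OF conv] t0 Y unfolding sbm_local_time_def by blast
    have [measurable]: "L t x \<in> borel_measurable P"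
      using L t0 unfolding sbm_local_time_def by blast
    have "\<forall>\<^sub>F b in at_top. prob {\<omega>\<in>space P. 1 < \<bar>heat_occupation t b x \<omega> - Y \<omega>\<bar>} < e / 2"
      by (rule order_tendstoD(2)[of _ 0]) (use conv e in \<open>auto simp: tendsto_in_prob_def\<close>)
    moreover have "\<forall>\<^sub>F b in at_top. sqrt (2 / h) < b"
      by (rule eventually_gt_at_top)
    ultimately have "\<forall>\<^sub>F b in at_top. prob {\<omega>\<in>space P. 1 < \<bar>heat_occupation t b x \<omega> - Y \<omega>\<bar>} < e / 2 \<and> sqrt (2 / h) < b"
      by (rule eventually_conj)
    then obtain b where b1: "prob {\<omega>\<in>space P. 1 < \<bar>heat_occupation t b x \<omega> - Y \<omega>\<bar>} < e / 2"
      and b2: "sqrt (2 / h) < b"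
      by (auto dest: eventually_happens)
    have "0 < sqrt (2 / h)" using h(1) by simp
    then have b: "0 < b" using b2 by linarith
    have "(sqrt (2 / h))\<^sup>2 < b\<^sup>2"
      using b2 h(1) by (intro power_strict_mono) auto
    then have "1 / b\<^sup>2 < h / 2"
      using h(1) b by (simp add: field_simps)
    then have "\<Gamma> \<le> energy (- 1 / 2) b x"
      using x_close by (intro h(2) b) linarith
    from \<Gamma>[OF b this] have tail: "prob {\<omega>\<in>space P. heat_occupation t b x \<omega> \<le> k + 1} \<le> e / 2" .
    have [measurable]: "heat_occupation t b x \<in> borel_measurable P"
      using heat_occupation_integrable[OF b t0, of x] by simp
    note Y[measurable]
    have "prob {\<omega>\<in>space P. L t x \<omega> \<le> ennreal k} \<le>
        prob ({\<omega>\<in>space P. heat_occupation t b x \<omega> \<le> k + 1} \<union> {\<omega>\<in>space P. 1 < \<bar>heat_occupation t b x \<omega> - Y \<omega>\<bar>})"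
    proof (rule finite_measure_mono_AE)
      show "AE \<omega> in P. \<omega> \<in> {\<omega>\<in>space P. L t x \<omega> \<le> ennreal k} \<longrightarrow>
          \<omega> \<in> {\<omega>\<in>space P. heat_occupation t b x \<omega> \<le> k + 1} \<union> {\<omega>\<in>space P. 1 < \<bar>heat_occupation t b x \<omega> - Y \<omega>\<bar>}"
        using L_eq
      proof eventually_elim
        case (elim \<omega>)
        \<comment> \<open>\<open>ennreal\<close> truncates a negative \<open>Y\<close> to zero,
          which is harmless because k is nonnegative.\<close>
        then have "L t x \<omega> \<le> ennreal k \<Longrightarrow> Y \<omega> \<le> k"
          using k by simp
        then show ?case by auto
      qed
    qed measurable
    also have "\<dots> \<le> prob {\<omega>\<in>space P. heat_occupation t b x \<omega> \<le> k + 1} +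
        prob {\<omega>\<in>space P. 1 < \<bar>heat_occupation t b x \<omega> - Y \<omega>\<bar>}"
      by (rule measure_Un_le) measurable
    finally show ?case
      using tail b1 by linarith
  qed
qed

end

text \<open>Dyadic shells: the \<open>k\<close>-th one has volume of order \<open>8\<^sup>-\<^sup>k\<close> and \<open>1 / norm z\<close> is of order \<open>2\<^sup>k\<close> on it.\<close>

lemma inverse_norm_le_dyadic:
  fixes z :: "'a::real_normed_vector"
  assumes "z \<noteq> 0"
  shows "1 / ennreal (norm z) \<le> 1 + (\<Sum>k. ennreal (2 ^ Suc k) * indicator (ball 0 ((1 / 2) ^ k)) z)"
proof -
  define f where "f k = ennreal (2 ^ Suc k) * indicator (ball 0 ((1 / 2) ^ k)) z" for k
  have eq: "1 / ennreal (norm z) = ennreal (1 / norm z)"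
    using divide_ennreal[of 1 "norm z"] assms by simp
  have "ennreal (1 / norm z) \<le> 1 + suminf f"
  proof (cases "norm z < 1")
    case False
    then have "1 / norm z \<le> 1 / 1"
      by (intro divide_left_mono) auto
    then have "ennreal (1 / norm z) \<le> ennreal 1"
      by (intro ennreal_leI) simp
    also have "\<dots> \<le> 1 + suminf f"
      unfolding ennreal_1 by (rule add_increasing2[OF zero_le order_refl])
    finally show ?thesis .
  next
    case True
    \<comment> \<open>The shell index: n is positive since the norm is below 1, and minimality puts
      z inside the ball for n - 1 but not inside the one for n.\<close>
    define n where "n = (LEAST n. (1 / 2) ^ n \<le> norm z)"
    obtain j where "(1 / 2 :: real) ^ j < norm z"
      using real_arch_pow_inv[of "norm z" "1 / 2"] assms by auto
    then have n: "(1 / 2) ^ n \<le> norm z"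
      unfolding n_def by (rule LeastI[OF less_imp_le])
    with True have "n \<noteq> 0"
      by (intro notI) simp
    then obtain k where k: "n = Suc k"
      using not0_implies_Suc by blast
    then have "\<not> (1 / 2) ^ k \<le> norm z"
      using not_less_Least[of k "\<lambda>n. (1 / 2) ^ n \<le> norm z"] by (simp add: n_def)
    then have z: "z \<in> ball 0 ((1 / 2) ^ k)"
      by simp
    have "1 / norm z \<le> 1 / (1 / 2) ^ n"
      using n assms by (intro divide_left_mono) auto
    also have "\<dots> = 2 ^ Suc k"
      unfolding k by (simp only: power_one_over div_by_1 divide_divide_eq_right mult_1_left)
    finally have "ennreal (1 / norm z) \<le> f k"
      using z by (simp only: f_def indicator_simps mult_1_right) (rule ennreal_leI)
    also have "\<dots> = sum f {k}"
      by simp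
    also have "\<dots> \<le> suminf f"
      by (rule sum_le_suminf[OF summableI]) auto
    also have "\<dots> \<le> 1 + suminf f"
      by (rule add_increasing[OF zero_le order_refl])
    finally show ?thesis .
  qed
  then show ?thesis
    unfolding eq f_def .
qed

text \<open>Weights 2^(k+1) against volumes proportional to 8^(-k) give a geometric series of ratio
  1/4. Uniformity in y is what allows integrating against \<mu> afterwards.\<close>

lemma nn_integral_inverse_norm_bounded:
  "\<exists>C. \<forall>y::real ^ 3. (\<integral>\<^sup>+x\<in>ball a r. 1 / ennreal (norm (y - x)) \<partial>lborel) \<le> ennreal C"
proof -
  let ?V = "unit_ball_vol (real (DIM(real ^ 3)))"
  have V: "0 \<le> ?V" by simp
  define C where "C = measure lborel (ball a r) + 2 * ?V * (1 / (1 - 1 / 4))"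
  have "(\<integral>\<^sup>+x\<in>ball a r. 1 / ennreal (norm (y - x)) \<partial>lborel) \<le> ennreal C" for y :: "real ^ 3"
  proof -
    have "(\<integral>\<^sup>+x\<in>ball a r. 1 / ennreal (norm (y - x)) \<partial>lborel) \<le>
        (\<integral>\<^sup>+x. indicator (ball a r) x + (\<Sum>k. ennreal (2 ^ Suc k) * indicator (ball y ((1 / 2) ^ k)) x) \<partial>lborel)"
    proof (rule nn_integral_mono_AE)
      show "AE x in lborel. 1 / ennreal (norm (y - x)) * indicator (ball a r) x \<le>
          indicator (ball a r) x + (\<Sum>k. ennreal (2 ^ Suc k) * indicator (ball y ((1 / 2) ^ k)) x)"
        using AE_lborel_singleton[of y]
      proof eventually_elim
        case (elim x)
        then have "1 / ennreal (norm (y - x)) \<le> 1 + (\<Sum>k. ennreal (2 ^ Suc k) * indicator (ball 0 ((1 / 2) ^ k)) (y - x))"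
          by (intro inverse_norm_le_dyadic) auto
        also have "(\<lambda>k. ennreal (2 ^ Suc k) * indicator (ball 0 ((1 / 2) ^ k)) (y - x)) =
            (\<lambda>k. ennreal (2 ^ Suc k) * indicator (ball y ((1 / 2) ^ k)) x)"
          by (auto simp: fun_eq_iff indicator_def dist_norm norm_minus_commute)
        finally show ?case
          by (auto simp: indicator_def)
      qed
    qed
    also have "\<dots> = emeasure lborel (ball a r) + (\<Sum>k. ennreal (2 ^ Suc k) * emeasure lborel (ball y ((1 / 2) ^ k)))"
    proof -
      have balls [measurable]: "ball c s \<in> sets borel" for c :: "real ^ 3" and s
        by simp
      have "(\<integral>\<^sup>+x. (\<Sum>k. ennreal (2 ^ Suc k) * indicator (ball y ((1 / 2) ^ k)) x) \<partial>lborel) =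
          (\<Sum>k. \<integral>\<^sup>+x. ennreal (2 ^ Suc k) * indicator (ball y ((1 / 2) ^ k)) x \<partial>lborel)"
        by (rule nn_integral_suminf) measurable
      also have "\<dots> = (\<Sum>k. ennreal (2 ^ Suc k) * emeasure lborel (ball y ((1 / 2) ^ k)))"
        by (intro suminf_cong nn_integral_cmult_indicator) simp
      finally have sum: "(\<integral>\<^sup>+x. (\<Sum>k. ennreal (2 ^ Suc k) * indicator (ball y ((1 / 2) ^ k)) x) \<partial>lborel) = \<dots>" .
      have "(\<lambda>x. \<Sum>k. ennreal (2 ^ Suc k) * indicator (ball y ((1 / 2) ^ k)) x) \<in> borel_measurable lborel"
        by (rule borel_measurable_suminf_order) measurable
      then have "(\<integral>\<^sup>+x. indicator (ball a r) x + (\<Sum>k. ennreal (2 ^ Suc k) * indicator (ball y ((1 / 2) ^ k)) x) \<partial>lborel) =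
          (\<integral>\<^sup>+x. indicator (ball a r) x \<partial>lborel) +
          (\<integral>\<^sup>+x. (\<Sum>k. ennreal (2 ^ Suc k) * indicator (ball y ((1 / 2) ^ k)) x) \<partial>lborel)"
        by (intro nn_integral_add) auto
      then show ?thesis
        unfolding sum by (simp only: nn_integral_indicator balls sets_lborel)
    qed
    also have "emeasure lborel (ball a r) = ennreal (measure lborel (ball a r))"
      using emeasure_lborel_ball_finite[of a r] by (intro emeasure_eq_ennreal_measure) auto
    also have "(\<Sum>k. ennreal (2 ^ Suc k) * emeasure lborel (ball y ((1 / 2) ^ k))) = (\<Sum>k. ennreal (2 * ?V * (1 / 4) ^ k))"
    proof (rule suminf_cong)
      fix k
      have "(2::real) ^ Suc k * (?V * ((1 / 2) ^ k) ^ DIM(real ^ 3)) = 2 * ?V * (2 * (1 / 2) ^ 3) ^ k"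
        unfolding power_mult_distrib by (simp add: power_mult[symmetric] mult.commute)
      then show "ennreal (2 ^ Suc k) * emeasure lborel (ball y ((1 / 2) ^ k)) = ennreal (2 * ?V * (1 / 4) ^ k)"
        using V by (simp add: emeasure_ball power3_eq_cube del: power_Suc flip: ennreal_mult')
    qed
    also have "\<dots> = ennreal (2 * ?V * (1 / (1 - 1 / 4)))"
    proof (rule suminf_ennreal_eq)
      show "(\<lambda>k. 2 * ?V * (1 / 4) ^ k) sums (2 * ?V * (1 / (1 - 1 / 4)))"
        by (intro sums_mult geometric_sums) simp
    qed (use V in auto)
    also have "ennreal (measure lborel (ball a r)) + \<dots> = ennreal C"
      unfolding C_def using V by (intro ennreal_plus[symmetric]) auto
    finally show ?thesis .
  qed
  then show ?thesis by blast
qed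

text \<open>By Tonelli the Newtonian potential of \<open>\<mu>\<close> is locally integrable.\<close>

lemma regular_points_dense:
  fixes \<mu> :: "(real ^ 3) measure"
  assumes \<mu>: "\<mu> \<in> finite_measures"
  shows "x islimpt - singular_points \<mu>"
proof (rule ccontr)
  assume "\<not> x islimpt - singular_points \<mu>"
  then obtain U where U: "x \<in> U" "open U" and sing: "\<And>z. z \<in> U \<Longrightarrow> z \<noteq> x \<Longrightarrow> z \<in> singular_points \<mu>"
    unfolding islimpt_def by blast
  obtain r where r: "0 < r" "ball x r \<subseteq> U"
    using U by (auto simp: open_contains_ball)
  interpret finite_measure \<mu>
    using \<mu> by (simp add: finite_measures_def)
  have sets[measurable_cong]: "sets \<mu> = sets borel"
    using \<mu> by (simp add: finite_measures_def)
  interpret pair_sigma_finite \<mu> lborel ..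
  obtain C where C: "\<And>y. (\<integral>\<^sup>+z\<in>ball x r. 1 / ennreal (norm (y - z)) \<partial>lborel) \<le> ennreal C"
    using nn_integral_inverse_norm_bounded[of x r] by blast
  have meas: "(\<lambda>(y, z). 1 / ennreal (norm (y - z)) * indicator (ball x r) z) \<in> borel_measurable (\<mu> \<Otimes>\<^sub>M lborel)"
  proof -
    have [measurable]: "ball x r \<in> sets borel"
      by simp
    show ?thesis by measurable
  qed
  \<comment> \<open>If all points of a ball except its centre were singular, the potential would be
    infinite almost everywhere on a set of positive volume.\<close>
  have "(\<integral>\<^sup>+z. top * indicator (ball x r) z \<partial>lborel) \<le>
      (\<integral>\<^sup>+z. (\<integral>\<^sup>+y. 1 / ennreal (norm (y - z)) * indicator (ball x r) z \<partial>\<mu>) \<partial>lborel)"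
  proof (rule nn_integral_mono_AE)
    show "AE z in lborel. top * indicator (ball x r) z \<le>
        (\<integral>\<^sup>+y. 1 / ennreal (norm (y - z)) * indicator (ball x r) z \<partial>\<mu>)"
      using AE_lborel_singleton[of x]
    proof eventually_elim
      case (elim z)
      then show ?case
        using sing[of z] r(2) by (auto simp: indicator_def singular_points_def)
    qed
  qed
  also have "\<dots> = (\<integral>\<^sup>+y. (\<integral>\<^sup>+z\<in>ball x r. 1 / ennreal (norm (y - z)) \<partial>lborel) \<partial>\<mu>)"
    using Fubini'[OF meas] by simp
  also have "\<dots> \<le> (\<integral>\<^sup>+y. ennreal C \<partial>\<mu>)"
    by (intro nn_integral_mono C)
  also have "\<dots> < top"
    using emeasure_finite[of "space \<mu>"] by (simp add: ennreal_mult_less_top less_top[symmetric] ennreal_mult_eq_top_iff)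
  finally have "top * emeasure lborel (ball x r) < top"
    by (simp add: nn_integral_cmult_indicator)
  moreover have "emeasure lborel (ball x r) \<noteq> 0"
    using open_not_negligible[of "ball x r"] r(1) by (auto simp: negligible_iff_null_sets null_sets_def)
  ultimately show False
    by (simp add: ennreal_top_mult)
qed

theorem theorem1p5:
  fixes P :: "'w measure"
    and F :: "real \<Rightarrow> 'w measure"
    and X :: "real \<Rightarrow> 'w \<Rightarrow> (real ^ 3) measure"
    and \<mu> :: "(real ^ 3) measure"
    and L :: "real \<Rightarrow> real ^ 3 \<Rightarrow> 'w \<Rightarrow> ennreal"
    and x\<^sub>0 :: "real ^ 3"
  assumes "super_brownian_motion P F X \<mu>"
    and "sbm_local_time P X \<mu> L"
    and "x\<^sub>0 \<in> singular_points \<mu>"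
  shows "(AE \<omega> in P. \<forall>t>0. \<not> finite_cont_within UNIV (\<lambda>x. L t x \<omega>) x\<^sub>0) \<and>
    (\<forall>t>0. \<forall>K<\<infinity>.
       ((\<lambda>x. measure P {\<omega>\<in>space P. K < L t x \<omega>}) \<longlongrightarrow> 1) (at x\<^sub>0 within - singular_points \<mu>))"
proof
  interpret sbm3 P F X \<mu>
    by unfold_locales (rule assms(1))
  note large = local_time_large_near_singular_point[OF assms(2,3)]
  have L_meas[measurable]: "L t x \<in> borel_measurable P" if "0 < t" for t x
    using assms(2) that less_imp_le unfolding sbm_local_time_def by blast
  show "\<forall>t>0. \<forall>K<\<infinity>. ((\<lambda>x. measure P {\<omega>\<in>space P. K < L t x \<omega>}) \<longlongrightarrow> 1)
      (at x\<^sub>0 within - singular_points \<mu>)"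
  proof (intro allI impI tendstoI)
    fix t :: real and K :: ennreal and e :: real
    assume t: "0 < t" and K: "K < \<infinity>" and e: "0 < e"
    then obtain k where k: "K = ennreal k" "0 \<le> k"
      by (cases K) auto
    have "0 < e / 2" using e by simp
    from large[OF t k(2) this]
    show "\<forall>\<^sub>F x in at x\<^sub>0 within - singular_points \<mu>. dist (prob {\<omega>\<in>space P. K < L t x \<omega>}) 1 < e"
    proof eventually_elim
      case (elim x)
      note L_meas[OF t, measurable]
      have "{\<omega>\<in>space P. K < L t x \<omega>} = space P - {\<omega>\<in>space P. L t x \<omega> \<le> ennreal k}"
        by (auto simp: k(1))
      then have "prob {\<omega>\<in>space P. K < L t x \<omega>} = 1 - prob {\<omega>\<in>space P. L t x \<omega> \<le> ennreal k}"
        by (simp add: prob_compl)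
      then show ?case
        using elim e by (simp add: dist_real_def)
    qed
  qed
  \<comment> \<open>The estimate in probability is upgraded to an almost sure one along a sequence
    that depends on t.\<close>
  have unbounded: "\<exists>f. f \<longlonglongrightarrow> x\<^sub>0 \<and> (AE \<omega> in P. \<forall>\<^sub>F n in sequentially. ennreal (real n) < L t (f n) \<omega>)"
    if t: "0 < t" for t
  proof -
    obtain g where g: "\<And>n. g n \<in> - singular_points \<mu> - {x\<^sub>0}" "g \<longlonglongrightarrow> x\<^sub>0"
      using regular_points_dense[OF initial_finite_measure, of x\<^sub>0] unfolding islimpt_sequential by blast
    \<comment> \<open>Density of the regular points makes the one-sided neighbourhoods nonempty.
      Point number n is taken so close to \<open>x\<^sub>0\<close> that the local time fails to
      exceed n with probability at most 2^(-n), a summable bound for Borel-Cantelli.\<close>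
    have "\<forall>n. \<exists>x. dist x x\<^sub>0 < 1 / real (Suc n) \<and> prob {\<omega>\<in>space P. L t x \<omega> \<le> ennreal (real n)} \<le> (1 / 2) ^ n"
    proof
      fix n
      have "\<forall>\<^sub>F x in at x\<^sub>0 within - singular_points \<mu>. prob {\<omega>\<in>space P. L t x \<omega> \<le> ennreal (real n)} \<le> (1 / 2) ^ n"
        by (rule large[OF t]) auto
      moreover have "filterlim g (at x\<^sub>0 within - singular_points \<mu>) sequentially"
        using g by (auto simp: filterlim_at)
      ultimately have "\<forall>\<^sub>F i in sequentially. prob {\<omega>\<in>space P. L t (g i) \<omega> \<le> ennreal (real n)} \<le> (1 / 2) ^ n"
        by (rule eventually_compose_filterlim)
      moreover have "\<forall>\<^sub>F i in sequentially. dist (g i) x\<^sub>0 < 1 / real (Suc n)"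
        using g(2) by (rule tendstoD) simp
      ultimately have "\<forall>\<^sub>F i in sequentially. dist (g i) x\<^sub>0 < 1 / real (Suc n) \<and>
          prob {\<omega>\<in>space P. L t (g i) \<omega> \<le> ennreal (real n)} \<le> (1 / 2) ^ n"
        by eventually_elim auto
      from eventually_happens'[OF sequentially_bot this] show "\<exists>x. dist x x\<^sub>0 < 1 / real (Suc n) \<and> prob {\<omega>\<in>space P. L t x \<omega> \<le> ennreal (real n)} \<le> (1 / 2) ^ n"
        by blast
    qed
    from choice[OF this] obtain f where f: "\<And>n. dist (f n) x\<^sub>0 < 1 / real (Suc n)"
      "\<And>n. prob {\<omega>\<in>space P. L t (f n) \<omega> \<le> ennreal (real n)} \<le> (1 / 2) ^ n"
      by blast
    have "(\<lambda>n. dist (f n) x\<^sub>0) \<longlonglongrightarrow> 0"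
    proof (rule tendsto_sandwich[OF _ _ tendsto_const LIMSEQ_Suc[OF lim_1_over_n]])
      show "\<forall>\<^sub>F n in sequentially. dist (f n) x\<^sub>0 \<le> 1 / real (Suc n)"
        using f(1) by (intro always_eventually allI less_imp_le)
    qed simp
    then have "f \<longlonglongrightarrow> x\<^sub>0"
      by (rule tendsto_dist_iff[THEN iffD2])
    moreover have "AE \<omega> in P. \<forall>\<^sub>F n in sequentially. \<omega> \<in> space P - {\<omega>\<in>space P. L t (f n) \<omega> \<le> ennreal (real n)}"
    proof (rule borel_cantelli_AE1)
      show "{\<omega>\<in>space P. L t (f n) \<omega> \<le> ennreal (real n)} \<in> sets P" for n
        using L_meas[OF t, of "f n"] by measurable
      show "summable (\<lambda>n. prob {\<omega>\<in>space P. L t (f n) \<omega> \<le> ennreal (real n)})"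
      proof (rule summable_comparison_test')
        show "summable (\<lambda>n. (1 / 2 :: real) ^ n)"
          by (rule summable_geometric) simp
        show "norm (prob {\<omega>\<in>space P. L t (f n) \<omega> \<le> ennreal (real n)}) \<le> (1 / 2) ^ n" if "0 \<le> n" for n
          using f(2)[of n] by simp
      qed
    qed (simp add: emeasure_eq_measure)
    then have "AE \<omega> in P. \<forall>\<^sub>F n in sequentially. ennreal (real n) < L t (f n) \<omega>"
    proof eventually_elim
      case (elim \<omega>)
      then show ?case
        by eventually_elim (simp add: not_le)
    qed
    ultimately show ?thesis by blast
  qed
  \<comment> \<open>Countably many times 1 / (i + 1) cost only one null set; monotonicity in t
    carries the divergence along \<open>f i\<close> to every later time.\<close>
  have "\<forall>i. \<exists>f. f \<longlonglongrightarrow> x\<^sub>0 \<and> (AE \<omega> in P. \<forall>\<^sub>F n in sequentially. ennreal (real n) < L (1 / real (Suc i)) (f n) \<omega>)"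
    by (intro allI unbounded) simp
  from choice[OF this] obtain f where f: "\<And>i. f i \<longlonglongrightarrow> x\<^sub>0"
    and f_large: "\<And>i. AE \<omega> in P. \<forall>\<^sub>F n in sequentially. ennreal (real n) < L (1 / real (Suc i)) (f i n) \<omega>"
    by blast
  have mono: "AE \<omega> in P. \<forall>x. mono_on {0..} (\<lambda>t. L t x \<omega>)"
    using assms(2) unfolding sbm_local_time_def by blast
  have "AE \<omega> in P. \<forall>i. \<forall>\<^sub>F n in sequentially. ennreal (real n) < L (1 / real (Suc i)) (f i n) \<omega>"
    unfolding AE_all_countable by (intro allI f_large)
  with mono show "AE \<omega> in P. \<forall>t>0. \<not> finite_cont_within UNIV (\<lambda>x. L t x \<omega>) x\<^sub>0"
  proof eventually_elim
    case (elim \<omega>)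
    show ?case
    proof (intro allI impI notI)
      fix t :: real assume t: "0 < t" and cont: "finite_cont_within UNIV (\<lambda>x. L t x \<omega>) x\<^sub>0"
      obtain i where i: "1 / real (Suc i) < t"
        using reals_Archimedean[OF t] by (auto simp: inverse_eq_divide)
      have lim: "(\<lambda>n. L t (f i n) \<omega>) \<longlonglongrightarrow> L t x\<^sub>0 \<omega>"
        by (rule isCont_tendsto_compose[OF _ f]) (use cont in \<open>simp add: finite_cont_within_def\<close>)
      \<comment> \<open>Finiteness at \<open>x\<^sub>0\<close> is part of
        \<open>finite_cont_within\<close>, so continuity would keep the values along the sequence
        below a fixed integer, while they exceed n.\<close>
      obtain m :: nat where m: "L t x\<^sub>0 \<omega> < ennreal (real m)"
        using cont ennreal_Ex_less_of_nat[of "L t x\<^sub>0 \<omega>"]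
        by (auto simp: finite_cont_within_def ennreal_of_nat_eq_real_of_nat)
      have "\<forall>\<^sub>F n in sequentially. L t (f i n) \<omega> < ennreal (real m)"
        using lim m by (rule order_tendstoD(2))
      moreover have "\<forall>\<^sub>F n in sequentially. ennreal (real n) < L (1 / real (Suc i)) (f i n) \<omega>"
        using elim(2) by blast
      ultimately have "\<forall>\<^sub>F n in sequentially. n < m"
      proof eventually_elim
        case (elim n)
        have "L (1 / real (Suc i)) (f i n) \<omega> \<le> L t (f i n) \<omega>"
          using \<open>\<forall>x. mono_on {0..} (\<lambda>t. L t x \<omega>)\<close> i t by (intro mono_onD[of "{0..}" "\<lambda>t. L t (f i n) \<omega>"]) auto
        with elim have "ennreal (real n) < ennreal (real m)"
          by order
        then show ?case
          by (simp add: ennreal_less_iff)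
      qed
      moreover have "\<forall>\<^sub>F n in sequentially. m \<le> n"
        by (rule eventually_ge_at_top)
      ultimately have "\<forall>\<^sub>F n :: nat in sequentially. False"
        by eventually_elim simp
      then show False
        by simp
    qed
  qed
qed

end
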